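(* Let $M$ be a smooth finite-dimensional manifold, $V$ a Banach space, $\mathbf y=(y,y^\dagger)\in CRP_{\mathbf X}(M)$, $U$ a parallelism on $M$ and $\boldsymbol\alpha\in CRP_y^U(M,V)$. Then the integral $\int\langle\boldsymbol\alpha,d\mathbf y^{\mathcal G}\rangle$ depends only on the parallelism $U$ and not on the logarithm $\psi$ used to make the gauge $\mathcal G=(\psi,U)$: if $\psi$ and $\tilde\psi$ are logarithms such that $\mathcal G=(\psi,U)$ and $\tilde{\mathcal G}=(\tilde\psi,U)$ are gauges, then $$\int\langle\boldsymbol\alpha,d\mathbf y^{\mathcal G}\rangle=\int\langle\boldsymbol\alpha,d\mathbf y^{\tilde{\mathcal G}}\rangle.$$
   Context: Rough paths. $W=\mathbb R^k$, $T>0$, $1\le p<3$, $\Delta_{[0,T]}=\{(s,t):0\le s\le t\le T\}$. A control is a continuous $\omega:\Delta_{[0,T]}\to[0,\infty)$ with $\omega(s,s)=0$ and $\omega(s,t)+\omega(t,u)\le\omega(s,u)$ for $s\le t\le u$. $\mathbf X=(x,\mathbb X)$ is a fixed weak-geometric $p$-rough path with control $\omega$: $x:[0,T]\to W$ and $\mathbb X:\Delta_{[0,T]}\to W\otimes W$ are continuous and, with $x_{s,t}:=x_t-x_s$, one has $\mathbb X_{s,u}=\mathbb X_{s,t}+\mathbb X_{t,u}+x_{s,t}\otimes x_{t,u}$ for $s\le t\le u$, $|x_{s,t}|\le\omega(s,t)^{1/p}$, $|\mathbb X_{s,t}|\le\omega(s,t)^{2/p}$, and the symmetric part of $\mathbb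 X_{s,t}$ equals $\frac12x_{s,t}\otimes x_{s,t}$. $F_{s,t}\approx_iG_{s,t}$ means: there are $C<\infty$, $\delta>0$ (with $\delta$ small enough that all expressions are defined) such that $|F_{s,t}-G_{s,t}|\le C\omega(s,t)^{i/p}$ for all $0\le s\le t\le T$ with $t-s\le\delta$; for values in spaces built from $T_{y_s}M$ the norm is the (operator) norm from any fixed Riemannian metric on $M$. $CRP_{\mathbf X}(V)$: continuous pairs $(z,z^\dagger)$, $z:[0,T]\to V$, $z^\dagger:[0,T]\to L(W,V)$, for which there is $C$ with $|z_t-z_s-z_s^\dagger x_{s,t}|\le C\omega(s,t)^{2/p}$ and $|z_t^\dagger-z_s^\dagger|\le C\omega(s,t)^{1/p}$ for all $0\le s\le t\le T$. Gauges. A diagonal domain is an open $\mathcal D\subseteq M\times M$ containing the diagonal. A logarithm is a smooth $\psi:\mathcal D\to TM$ with $\psi(m,n)\in T_mM$, $\psi(m,m)=0_m$, and differential of $\psi(m,\cdot)$ at $m$ equal to the identity of $T_mM$. A parallelism is a smooth map $(n,m)\in\mathcal D\mapsto U(n,m)\in L(T_mM,T_nM)$ with $U(m,m)=I$. A gauge is a pair $(\psi,U)$ of these with common domain $\mathcal D$. $CRP_{\mathbf X}(M)$: continuous pairs $(y,y^\dagger)$, $y:[0,T]\to M$, $y_s^\dagger\in L(W,T_{y_s}M)$, with $\psi(y_s,y_t)\approx_2y_s^\dagger x_{s,t}$ and $U(y_s,y_t)y_t^\dagger\approx_1y_s^\dagger$ (this does not depend on the gauge chosen). $CRP_y^U(M,V)$: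 pairs $(\alpha,\alpha^\dagger)$ with $\alpha_s\in L(T_{y_s}M,V)$, $\alpha_s^\dagger\in L(W\otimes T_{y_s}M,V)$, $\alpha_t\circ U(y_t,y_s)-\alpha_s-\alpha_s^\dagger(x_{s,t}\otimes(\cdot))\approx_20$ and $\alpha_t^\dagger\circ(I\otimes U(y_t,y_s))-\alpha_s^\dagger\approx_10$. Compatibility tensor. For parallelisms $\tilde U,U$: $S_m^{\tilde U,U}[v\otimes w]:=v\left[n\mapsto U(n,m)^{-1}\tilde U(n,m)w\right]$ (derivative at $m$ in direction $v$ of a $T_mM$-valued function), $v,w\in T_mM$. For a gauge $\mathcal G=(\psi,U)$: $S^{\mathcal G}:=S^{U^\psi,U}$ where $U^\psi(m,n):=$ differential of $\psi(m,\cdot)$ at $n$, viewed as a map $T_nM\to T_mM$. Integral. For $\boldsymbol\alpha\in CRP_y^U(M,V)$, $\int\langle\boldsymbol\alpha,d\mathbf y^{\mathcal G}\rangle$ is the unique $(z,z^\dagger)\in CRP_{\mathbf X}(V)$ with $z_0=0$, $z_s^\dagger=\alpha_s\circ y_s^\dagger$ and $z_t-z_s\approx_3\alpha_s\left(\psi(y_s,y_t)+S^{\mathcal G}_{y_s}((y_s^\dagger\otimes y_s^\dagger)\mathbb X_{s,t})\right)+\alpha_s^\dagger(I\otimes y_s^\dagger)\mathbb X_{s,t}$. *)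

theory Defs
  imports "HOL-Analysis.Analysis"
begin

text \<open>Used only on open subsets of finite-dimensional spaces, where being k times continuously
  differentiable can be tested on iterated directional derivatives.\<close>

primrec Ck_on :: "nat \<Rightarrow> 'a::real_normed_vector set \<Rightarrow> ('a \<Rightarrow> 'b::real_normed_vector) \<Rightarrow> bool"
where
  "Ck_on 0 S f \<longleftrightarrow> continuous_on S f"
| "Ck_on (Suc k) S f \<longleftrightarrow>
     (\<forall>x\<in>S. f differentiable (at x)) \<and>
     (\<forall>v. Ck_on k S (\<lambda>x. frechet_derivative f (at x) v))"

definition smooth_on :: "'a::real_normed_vector set \<Rightarrow> ('a \<Rightarrow> 'b::real_normed_vector) \<Rightarrow> bool"
where "smooth_on S f \<longleftrightarrow> (\<forall>k. Ck_on k S f)"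

text \<open>The manifold is a whole (Hausdorff, second countable) topological type \<open>'m\<close>, modelled on a
  finite-dimensional normed space \<open>'e\<close>; dimension 0 is allowed. A chart is a pair of a domain and a
  coordinate map, whose values outside the domain are irrelevant.\<close>

type_synonym ('m, 'e) chart = "'m set \<times> ('m \<Rightarrow> 'e)"

abbreviation cdom :: "('m, 'e) chart \<Rightarrow> 'm set" where "cdom c \<equiv> fst c"
abbreviation cmap :: "('m, 'e) chart \<Rightarrow> 'm \<Rightarrow> 'e" where "cmap c \<equiv> snd c"
abbreviation crange :: "('m, 'e) chart \<Rightarrow> 'e set" where "crange c \<equiv> cmap c ` cdom c"
abbreviation cinv :: "('m, 'e) chart \<Rightarrow> 'e \<Rightarrow> 'm" where "cinv c \<equiv> inv_into (cdom c) (cmap c)"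

definition is_chart :: "('m::topological_space, 'e::real_normed_vector) chart \<Rightarrow> bool"
where "is_chart c \<longleftrightarrow> open (cdom c) \<and> open (crange c) \<and>
         homeomorphism (cdom c) (crange c) (cmap c) (cinv c)"

definition smooth_manifold ::
  "('m::{t2_space, second_countable_topology}, 'e::real_normed_vector) chart set \<Rightarrow> bool"
where "smooth_manifold A \<longleftrightarrow>
         (\<exists>B::'e set. finite B \<and> span B = UNIV) \<and>
         (\<forall>c\<in>A. is_chart c) \<and> (\<Union>c\<in>A. cdom c) = UNIV \<and>
         (\<forall>c\<in>A. \<forall>c'\<in>A. smooth_on (cmap c ` (cdom c \<inter> cdom c')) (cmap c' \<circ> cinv c))"

text \<open>The tangent space at \<open>m\<close> is realised as the model space \<open>'e\<close>, a vector \<open>v :: 'e\<close> standing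
  for the tangent vector whose components in the chart \<open>chart_at A m\<close> are \<open>v\<close>. So linear maps
  between (or out of) tangent spaces are elements of \<open>'e \<Rightarrow>\<^sub>L _\<close>. As \<open>chart_at A m\<close> jumps with \<open>m\<close>,
  continuity and smoothness of tangent-space valued maps have to be expressed in the components
  with respect to a fixed chart \<open>c\<close>, given by \<open>to_coord A c m\<close>.\<close>

definition chart_at :: "('m, 'e) chart set \<Rightarrow> 'm \<Rightarrow> ('m, 'e) chart"
where "chart_at A m = (SOME c. c \<in> A \<and> m \<in> cdom c)"

definition coord_change ::
  "('m, 'e::real_normed_vector) chart \<Rightarrow> ('m, 'e) chart \<Rightarrow> 'm \<Rightarrow> 'e \<Rightarrow>\<^sub>L 'e"
where "coord_change c c' m =
         Blinfun (frechet_derivative (cmap c' \<circ> cinv c) (at (cmap c m)))"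

abbreviation to_coord ::
  "('m, 'e::real_normed_vector) chart set \<Rightarrow> ('m, 'e) chart \<Rightarrow> 'm \<Rightarrow> 'e \<Rightarrow>\<^sub>L 'e"
where "to_coord A c m \<equiv> coord_change (chart_at A m) c m"

abbreviation from_coord ::
  "('m, 'e::real_normed_vector) chart set \<Rightarrow> ('m, 'e) chart \<Rightarrow> 'm \<Rightarrow> 'e \<Rightarrow>\<^sub>L 'e"
where "from_coord A c m \<equiv> coord_change c (chart_at A m) m"

text \<open>Differential at \<open>m\<close> of a map from the manifold into a fixed normed space, as a map on the
  tangent space at \<open>m\<close>.\<close>

definition mdiff ::
  "('m, 'e::real_normed_vector) chart set \<Rightarrow> ('m \<Rightarrow> 'b::real_normed_vector) \<Rightarrow> 'm \<Rightarrow> 'e \<Rightarrow> 'b"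
where "mdiff A f m =
         frechet_derivative (f \<circ> cinv (chart_at A m)) (at (cmap (chart_at A m) m))"

definition has_mdiff_at ::
  "('m, 'e::real_normed_vector) chart set \<Rightarrow> ('m \<Rightarrow> 'b::real_normed_vector) \<Rightarrow> 'm \<Rightarrow> ('e \<Rightarrow> 'b) \<Rightarrow> bool"
where "has_mdiff_at A f m L \<longleftrightarrow>
         ((f \<circ> cinv (chart_at A m)) has_derivative L) (at (cmap (chart_at A m) m))"

definition riemannian_metric ::
  "('m, 'e::real_normed_vector) chart set \<Rightarrow> ('m \<Rightarrow> 'e \<Rightarrow> 'e \<Rightarrow> real) \<Rightarrow> bool"
where "riemannian_metric A g \<longleftrightarrow>
         (\<forall>m. bilinear (g m) \<and> (\<forall>v w. g m v w = g m w v) \<and> (\<forall>v. v \<noteq> 0 \<longrightarrow> 0 < g m v v)) \<and>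
         (\<forall>c\<in>A. \<forall>v w. smooth_on (crange c)
            (\<lambda>a. g (cinv c a) (blinfun_apply (from_coord A c (cinv c a)) v)
                              (blinfun_apply (from_coord A c (cinv c a)) w)))"

definition tnorm :: "('m \<Rightarrow> 'e \<Rightarrow> 'e \<Rightarrow> real) \<Rightarrow> 'm \<Rightarrow> 'e \<Rightarrow> real"
where "tnorm g m v = sqrt (g m v v)"

definition op_norm :: "('a \<Rightarrow> real) \<Rightarrow> ('b \<Rightarrow> real) \<Rightarrow> ('a \<Rightarrow> 'b) \<Rightarrow> real"
where "op_norm N N' F = (SUP v\<in>{v. N v \<le> 1}. N' (F v))"

text \<open>With W the Euclidean space \<open>real^'k\<close>, the tensor product of W with a vector space \<open>'a\<close> is
  \<open>'a^'k\<close>, the sum of \<open>e\<^sub>i \<otimes> a\<^sub>i\<close> being the vector with components \<open>a\<^sub>i\<close>; in particular the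
  tensor square of W is \<open>real^'k^'k\<close>.\<close>

definition tens :: "real^'k \<Rightarrow> 'a::real_vector \<Rightarrow> 'a^'k"
where "tens w v = (\<chi> i. (w $ i) *\<^sub>R v)"

definition id_tens :: "('a \<Rightarrow> 'b) \<Rightarrow> 'a^'k \<Rightarrow> 'b^'k"  \<comment> \<open>\<open>I \<otimes> L\<close>\<close>
where "id_tens L X = (\<chi> i. L (X $ i))"

text \<open>For bilinear \<open>S\<close>, viewed as a linear map on the tensor square of its argument space, and
  linear \<open>L\<close> on W: the value of \<open>S\<close> at \<open>(L \<otimes> L) X\<close>.\<close>

definition bilin_tens ::
  "('a \<Rightarrow> 'a \<Rightarrow> 'b::real_vector) \<Rightarrow> (real^'k \<Rightarrow> 'a) \<Rightarrow> real^'k^'k \<Rightarrow> 'b"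
where "bilin_tens S L X = (\<Sum>i\<in>UNIV. \<Sum>j\<in>UNIV. (X $ i $ j) *\<^sub>R S (L (axis i 1)) (L (axis j 1)))"

definition tens_norm :: "('m \<Rightarrow> 'e \<Rightarrow> 'e \<Rightarrow> real) \<Rightarrow> 'm \<Rightarrow> 'e^'k \<Rightarrow> real"
where "tens_norm g m X = sqrt (\<Sum>i\<in>UNIV. g m (X $ i) (X $ i))"

definition control :: "real \<Rightarrow> (real \<Rightarrow> real \<Rightarrow> real) \<Rightarrow> bool"
where "control T \<omega> \<longleftrightarrow>
         continuous_on {(s, t). 0 \<le> s \<and> s \<le> t \<and> t \<le> T} (\<lambda>(s, t). \<omega> s t) \<and>
         (\<forall>s t. 0 \<le> s \<and> s \<le> t \<and> t \<le> T \<longrightarrow> 0 \<le> \<omega> s t) \<and>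
         (\<forall>s. 0 \<le> s \<and> s \<le> T \<longrightarrow> \<omega> s s = 0) \<and>
         (\<forall>s t u. 0 \<le> s \<and> s \<le> t \<and> t \<le> u \<and> u \<le> T \<longrightarrow> \<omega> s t + \<omega> t u \<le> \<omega> s u)"

definition weak_geometric_rough_path ::
  "real \<Rightarrow> real \<Rightarrow> (real \<Rightarrow> real \<Rightarrow> real) \<Rightarrow> (real \<Rightarrow> real^'k) \<Rightarrow> (real \<Rightarrow> real \<Rightarrow> real^'k^'k) \<Rightarrow> bool"
where "weak_geometric_rough_path p T \<omega> x X \<longleftrightarrow>
         control T \<omega> \<and> continuous_on {0..T} x \<and>
         continuous_on {(s, t). 0 \<le> s \<and> s \<le> t \<and> t \<le> T} (\<lambda>(s, t). X s t) \<and>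
         (\<forall>s t u. 0 \<le> s \<and> s \<le> t \<and> t \<le> u \<and> u \<le> T \<longrightarrow>
            X s u = X s t + X t u + tens (x t - x s) (x u - x t)) \<and>
         (\<forall>s t. 0 \<le> s \<and> s \<le> t \<and> t \<le> T \<longrightarrow>
            norm (x t - x s) \<le> \<omega> s t powr (1 / p) \<and>
            norm (X s t) \<le> \<omega> s t powr (2 / p) \<and>
            (1 / 2) *\<^sub>R (X s t + transpose (X s t)) = (1 / 2) *\<^sub>R tens (x t - x s) (x t - x s))"

text \<open>\<open>approx p T \<omega> i dfn N F G\<close> is the relation between \<open>F\<close> and \<open>G\<close> of order \<open>i\<close>: \<open>dfn s t\<close> says that
  the expressions are defined at \<open>(s, t)\<close>, and the norm \<open>N s\<close> may depend on \<open>s\<close>.\<close>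

definition approx ::
  "real \<Rightarrow> real \<Rightarrow> (real \<Rightarrow> real \<Rightarrow> real) \<Rightarrow> real \<Rightarrow> (real \<Rightarrow> real \<Rightarrow> bool) \<Rightarrow> (real \<Rightarrow> 'b \<Rightarrow> real) \<Rightarrow>
   (real \<Rightarrow> real \<Rightarrow> 'b::minus) \<Rightarrow> (real \<Rightarrow> real \<Rightarrow> 'b) \<Rightarrow> bool"
where "approx p T \<omega> i dfn N F G \<longleftrightarrow>
         (\<exists>C. \<exists>\<delta>>0. \<forall>s t. 0 \<le> s \<and> s \<le> t \<and> t \<le> T \<and> t - s \<le> \<delta> \<longrightarrow>
            dfn s t \<and> N s (F s t - G s t) \<le> C * \<omega> s t powr (i / p))"

text \<open>Maps on \<open>[0, T]\<close> with values in \<open>V\<close> are represented by extensional functions, so that they are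
  equal as soon as they agree on \<open>[0, T]\<close>.\<close>

definition CRP_V ::
  "real \<Rightarrow> real \<Rightarrow> (real \<Rightarrow> real \<Rightarrow> real) \<Rightarrow> (real \<Rightarrow> real^'k) \<Rightarrow>
   ((real \<Rightarrow> 'v::real_normed_vector) \<times> (real \<Rightarrow> (real^'k) \<Rightarrow>\<^sub>L 'v)) set"
where "CRP_V p T \<omega> x = {(z, z').
         z \<in> extensional {0..T} \<and> z' \<in> extensional {0..T} \<and>
         continuous_on {0..T} z \<and> continuous_on {0..T} z' \<and>
         (\<exists>C. \<forall>s t. 0 \<le> s \<and> s \<le> t \<and> t \<le> T \<longrightarrow>
            norm (z t - z s - blinfun_apply (z' s) (x t - x s)) \<le> C * \<omega> s t powr (2 / p) \<and>
            norm (z' t - z' s) \<le> C * \<omega> s t powr (1 / p))}"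

definition diagonal_domain :: "('m::topological_space \<times> 'm) set \<Rightarrow> bool"
where "diagonal_domain D \<longleftrightarrow> open D \<and> (\<forall>m. (m, m) \<in> D)"

definition logarithm ::
  "('m::topological_space, 'e::real_normed_vector) chart set \<Rightarrow> ('m \<times> 'm) set \<Rightarrow>
   ('m \<Rightarrow> 'm \<Rightarrow> 'e) \<Rightarrow> bool"
where "logarithm A D \<psi> \<longleftrightarrow>
         diagonal_domain D \<and>
         (\<forall>c\<in>A. \<forall>c'\<in>A. smooth_on
            {(a, b). a \<in> crange c \<and> b \<in> crange c' \<and> (cinv c a, cinv c' b) \<in> D}
            (\<lambda>(a, b). blinfun_apply (to_coord A c (cinv c a)) (\<psi> (cinv c a) (cinv c' b)))) \<and>
         (\<forall>m. \<psi> m m = 0) \<and>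
         (\<forall>m. has_mdiff_at A (\<psi> m) m id)"

text \<open>\<open>U n m\<close> maps the tangent space at \<open>m\<close> to the one at \<open>n\<close>.\<close>

definition parallelism ::
  "('m::topological_space, 'e::real_normed_vector) chart set \<Rightarrow> ('m \<times> 'm) set \<Rightarrow>
   ('m \<Rightarrow> 'm \<Rightarrow> 'e \<Rightarrow>\<^sub>L 'e) \<Rightarrow> bool"
where "parallelism A D U \<longleftrightarrow>
         diagonal_domain D \<and>
         (\<forall>c\<in>A. \<forall>c'\<in>A. smooth_on
            {(a, b). a \<in> crange c \<and> b \<in> crange c' \<and> (cinv c a, cinv c' b) \<in> D}
            (\<lambda>(a, b). to_coord A c (cinv c a) o\<^sub>L U (cinv c a) (cinv c' b)
                        o\<^sub>L from_coord A c' (cinv c' b))) \<and>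
         (\<forall>m. U m m = id_blinfun)"

definition gauge_on ::
  "('m::topological_space, 'e::real_normed_vector) chart set \<Rightarrow> ('m \<times> 'm) set \<Rightarrow>
   ('m \<Rightarrow> 'm \<Rightarrow> 'e) \<Rightarrow> ('m \<Rightarrow> 'm \<Rightarrow> 'e \<Rightarrow>\<^sub>L 'e) \<Rightarrow> bool"
where "gauge_on A D \<psi> U \<longleftrightarrow> logarithm A D \<psi> \<and> parallelism A D U"

text \<open>The compatibility tensor as a bilinear map. The inverse of \<open>U n m\<close> only matters for \<open>n\<close> near
  \<open>m\<close>, where \<open>U n m\<close> is invertible.\<close>

definition compat ::
  "('m, 'e::real_normed_vector) chart set \<Rightarrow> ('m \<Rightarrow> 'm \<Rightarrow> 'e \<Rightarrow>\<^sub>L 'e) \<Rightarrow> ('m \<Rightarrow> 'm \<Rightarrow> 'e \<Rightarrow>\<^sub>L 'e) \<Rightarrow>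
   'm \<Rightarrow> 'e \<Rightarrow> 'e \<Rightarrow> 'e"
where "compat A U' U m v w =
         mdiff A (\<lambda>n. inv (blinfun_apply (U n m)) (blinfun_apply (U' n m) w)) m v"

definition log_parallelism ::
  "('m, 'e::real_normed_vector) chart set \<Rightarrow> ('m \<Rightarrow> 'm \<Rightarrow> 'e) \<Rightarrow> 'm \<Rightarrow> 'm \<Rightarrow> 'e \<Rightarrow>\<^sub>L 'e"
where "log_parallelism A \<psi> m n = Blinfun (mdiff A (\<psi> m) n)"

definition gauge_compat ::
  "('m, 'e::real_normed_vector) chart set \<Rightarrow> ('m \<Rightarrow> 'm \<Rightarrow> 'e) \<Rightarrow> ('m \<Rightarrow> 'm \<Rightarrow> 'e \<Rightarrow>\<^sub>L 'e) \<Rightarrow>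
   'm \<Rightarrow> 'e \<Rightarrow> 'e \<Rightarrow> 'e"
where "gauge_compat A \<psi> U = compat A (log_parallelism A \<psi>) U"

text \<open>The two estimates do not depend on the gauge, so it is enough to have them for some gauge.\<close>

definition CRP_M ::
  "('m::topological_space, 'e::real_normed_vector) chart set \<Rightarrow> ('m \<Rightarrow> 'e \<Rightarrow> 'e \<Rightarrow> real) \<Rightarrow>
   real \<Rightarrow> real \<Rightarrow> (real \<Rightarrow> real \<Rightarrow> real) \<Rightarrow> (real \<Rightarrow> real^'k) \<Rightarrow>
   ((real \<Rightarrow> 'm) \<times> (real \<Rightarrow> (real^'k) \<Rightarrow>\<^sub>L 'e)) set"
where "CRP_M A g p T \<omega> x = {(y, y').
         continuous_on {0..T} y \<and>
         (\<forall>c\<in>A. continuous_on {s\<in>{0..T}. y s \<in> cdom c} (\<lambda>s. to_coord A c (y s) o\<^sub>L y' s)) \<and>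
         (\<exists>D \<psi> U. gauge_on A D \<psi> U \<and>
            approx p T \<omega> 2 (\<lambda>s t. (y s, y t) \<in> D) (\<lambda>s. tnorm g (y s))
              (\<lambda>s t. \<psi> (y s) (y t)) (\<lambda>s t. blinfun_apply (y' s) (x t - x s)) \<and>
            approx p T \<omega> 1 (\<lambda>s t. (y s, y t) \<in> D) (\<lambda>s. op_norm norm (tnorm g (y s)))
              (\<lambda>s t w. blinfun_apply (U (y s) (y t)) (blinfun_apply (y' t) w))
              (\<lambda>s t w. blinfun_apply (y' s) w))}"

definition CRP_form ::
  "('m::topological_space \<times> 'm) set \<Rightarrow> ('m \<Rightarrow> 'm \<Rightarrow> 'e \<Rightarrow>\<^sub>L 'e) \<Rightarrow> ('m \<Rightarrow> 'e \<Rightarrow> 'e \<Rightarrow> real) \<Rightarrow>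
   real \<Rightarrow> real \<Rightarrow> (real \<Rightarrow> real \<Rightarrow> real) \<Rightarrow> (real \<Rightarrow> real^'k) \<Rightarrow> (real \<Rightarrow> 'm) \<Rightarrow>
   ((real \<Rightarrow> 'e::real_normed_vector \<Rightarrow>\<^sub>L 'v::real_normed_vector) \<times> (real \<Rightarrow> ('e^'k) \<Rightarrow>\<^sub>L 'v)) set"
where "CRP_form D U g p T \<omega> x y =
       {(\<alpha>, \<alpha>').
         approx p T \<omega> 2 (\<lambda>s t. (y t, y s) \<in> D) (\<lambda>s. op_norm (tnorm g (y s)) norm)
           (\<lambda>s t v. blinfun_apply (\<alpha> t) (blinfun_apply (U (y t) (y s)) v) - blinfun_apply (\<alpha> s) v
              - blinfun_apply (\<alpha>' s) (tens (x t - x s) v)) (\<lambda>s t v. 0) \<and>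
         approx p T \<omega> 1 (\<lambda>s t. (y t, y s) \<in> D) (\<lambda>s. op_norm (tens_norm g (y s)) norm)
           (\<lambda>s t \<xi>. blinfun_apply (\<alpha>' t) (id_tens (blinfun_apply (U (y t) (y s))) \<xi>)
              - blinfun_apply (\<alpha>' s) \<xi>) (\<lambda>s t \<xi>. 0)}"

definition is_rough_integral ::
  "('m::topological_space, 'e::real_normed_vector) chart set \<Rightarrow> ('m \<times> 'm) set \<Rightarrow>
   ('m \<Rightarrow> 'm \<Rightarrow> 'e) \<Rightarrow> ('m \<Rightarrow> 'm \<Rightarrow> 'e \<Rightarrow>\<^sub>L 'e) \<Rightarrow>
   real \<Rightarrow> real \<Rightarrow> (real \<Rightarrow> real \<Rightarrow> real) \<Rightarrow> (real \<Rightarrow> real^'k) \<Rightarrow> (real \<Rightarrow> real \<Rightarrow> real^'k^'k) \<Rightarrow>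
   (real \<Rightarrow> 'm) \<times> (real \<Rightarrow> (real^'k) \<Rightarrow>\<^sub>L 'e) \<Rightarrow>
   (real \<Rightarrow> 'e \<Rightarrow>\<^sub>L 'v::real_normed_vector) \<times> (real \<Rightarrow> ('e^'k) \<Rightarrow>\<^sub>L 'v) \<Rightarrow>
   (real \<Rightarrow> 'v) \<times> (real \<Rightarrow> (real^'k) \<Rightarrow>\<^sub>L 'v) \<Rightarrow> bool"
where "is_rough_integral A D \<psi> U p T \<omega> x X =
       (\<lambda>(y, y') (\<alpha>, \<alpha>') (z, z').
         (z, z') \<in> CRP_V p T \<omega> x \<and> z 0 = 0 \<and> (\<forall>s\<in>{0..T}. z' s = \<alpha> s o\<^sub>L y' s) \<and>
         approx p T \<omega> 3 (\<lambda>s t. (y s, y t) \<in> D) (\<lambda>s. norm)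
           (\<lambda>s t. z t - z s)
           (\<lambda>s t. blinfun_apply (\<alpha> s)
                    (\<psi> (y s) (y t)
                     + bilin_tens (gauge_compat A \<psi> U (y s)) (blinfun_apply (y' s)) (X s t))
                  + blinfun_apply (\<alpha>' s) (id_tens (blinfun_apply (y' s)) (X s t))))"

text \<open>For \<open>V\<close> complete, \<open>1 \<le> p < 3\<close> and data as in the definitions above, there is exactly one
  such pair, by the sewing lemma.\<close>

definition rough_integral ::
  "('m::topological_space, 'e::real_normed_vector) chart set \<Rightarrow> ('m \<times> 'm) set \<Rightarrow>
   ('m \<Rightarrow> 'm \<Rightarrow> 'e) \<Rightarrow> ('m \<Rightarrow> 'm \<Rightarrow> 'e \<Rightarrow>\<^sub>L 'e) \<Rightarrow>
   real \<Rightarrow> real \<Rightarrow> (real \<Rightarrow> real \<Rightarrow> real) \<Rightarrow> (real \<Rightarrow> real^'k) \<Rightarrow> (real \<Rightarrow> real \<Rightarrow> real^'k^'k) \<Rightarrow>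
   (real \<Rightarrow> 'm) \<times> (real \<Rightarrow> (real^'k) \<Rightarrow>\<^sub>L 'e) \<Rightarrow>
   (real \<Rightarrow> 'e \<Rightarrow>\<^sub>L 'v::banach) \<times> (real \<Rightarrow> ('e^'k) \<Rightarrow>\<^sub>L 'v) \<Rightarrow>
   (real \<Rightarrow> 'v) \<times> (real \<Rightarrow> (real^'k) \<Rightarrow>\<^sub>L 'v)"
where "rough_integral A D \<psi> U p T \<omega> x X yy \<alpha>\<alpha> =
         (THE zz. is_rough_integral A D \<psi> U p T \<omega> x X yy \<alpha>\<alpha> zz)"

end

theory Submission
  imports Defs
begin

text \<open>In a fixed chart a logarithm satisfies \<open>\<psi>(a, b) = (b - a) + Q(b - a, b - a) / 2 + O(\<bar>b - a\<bar>\<^sup>3)\<close>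
  with \<open>Q = \<partial>\<^sub>2\<partial>\<^sub>2\<psi>(a, a)\<close>. Differentiating \<open>\<partial>\<^sub>2\<psi>(a, a) = id\<close> along the diagonal gives
  \<open>\<partial>\<^sub>1\<partial>\<^sub>2\<psi>(a, a) = - Q\<close>, so the compatibility tensor is \<open>- Q\<close> minus a term that depends on \<open>U\<close> only.
  Since the symmetric part of \<open>X\<close> is \<open>x \<otimes> x / 2\<close> and \<open>Q\<close> is symmetric, the two contributions of \<open>Q\<close>
  to the compensated increment cancel up to \<open>\<omega> powr (3 / p)\<close>. As \<open>\<alpha>\<close> is bounded, the conditions that
  characterise the integral for two logarithms are equivalent, so neither existence nor uniqueness
  of the integral is needed.\<close>

section \<open>Finite-dimensional normed spaces\<close>

text \<open>The model space \<open>'e\<close> carries only a norm and a finite spanning set, and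
  smoothness is given through iterated directional derivatives. Hence bounds for linear families,
  compact balls, symmetric second derivatives and a Taylor bound with constants uniform along the
  diagonal have to come before any geometry. Tangent vectors are components in
  \<open>chart_at A m\<close>, which jumps with \<open>m\<close>; the estimates are therefore made
  for times near some \<open>t0\<close> in one fixed chart, and compactness of \<open>{0..T}\<close>
  makes them uniform. Cancelling Q(b - a, b - a) against the term of the compatibility tensor needs
  a comparison of two different vectors: the increment d = b - a and the vector v obtained by
  applying the velocity to the increment of the driving path. \<open>CRP_M\<close> speaks about v
  only through the logarithm of some gauge, possibly neither of the two being compared. Once d - v
  is of order 2 and d, v are of order 1, Q(d, d) - Q(v, v) is of order 3. Boundedness of \<alpha> is
  a second obstacle, since \<open>CRP_form\<close> controls \<alpha> only along transport by
  \<open>U\<close>.\<close>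

lemma finite_span_imp_basis:
  fixes B :: "'e::real_vector set"
  assumes "finite B" "span B = UNIV"
  obtains C :: "'e set" where "finite C" "independent C" "span C = UNIV"
proof -
  obtain C where "C \<subseteq> B" "independent C" "B \<subseteq> span C"
    by (metis real_vector.maximal_independent_subset)
  then have "span C = UNIV"
    by (metis assms(2) real_vector.span_mono real_vector.span_span top.extremum_unique)
  then show thesis
    using that[OF finite_subset[OF \<open>C \<subseteq> B\<close> assms(1)] \<open>independent C\<close>] by simp
qed

text \<open>Tychonoff's theorem. Coefficient families indexed by \<open>B\<close> are encoded as
  functions on the whole type; the factor {0} at indices outside \<open>B\<close> makes the set a
  full product of compact sets.\<close>

lemma compact_bounded_coefficients:
  "compact {f :: 'a \<Rightarrow> real. \<forall>b. f b \<in> (if b \<in> B then {-r..r} else {0})}"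
proof -
  have "compactin (product_topology (\<lambda>_. euclidean) UNIV)
          (\<Pi>\<^sub>E b\<in>UNIV. if b \<in> B then {-r..r} else {0::real})"
    by (subst compactin_PiE) auto
  moreover have "(\<Pi>\<^sub>E b\<in>UNIV. if b \<in> B then {-r..r} else {0::real}) =
      {f. \<forall>b. f b \<in> (if b \<in> B then {-r..r} else {0})}"
    by (auto simp: PiE_def Pi_def extensional_def)
  ultimately show ?thesis
    by (simp add: euclidean_product_topology)
qed

lemma continuous_on_linear_combination:
  "continuous_on S (\<lambda>f. \<Sum>b\<in>B. f b *\<^sub>R (b :: 'e::real_normed_vector))"
  by (intro continuous_on_sum continuous_on_scaleR continuous_on_const
      continuous_on_subset[OF continuous_on_product_coordinates]) auto

text \<open>On the compact set of families with maximum norm 1 the norm of the linear combination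
  attains a minimum, which independence makes positive. Dividing an arbitrary family by its maximum
  norm \<open>m\<close> gives the general bound.\<close>

lemma independent_coefficients_bound:
  fixes B :: "'e::real_normed_vector set"
  assumes "finite B" "independent B"
  obtains \<mu> where "\<mu> > 0" "\<And>f b. b \<in> B \<Longrightarrow> \<mu> * \<bar>f b\<bar> \<le> norm (\<Sum>b\<in>B. f b *\<^sub>R b)"
proof (cases "B = {}")
  case True
  with that[of 1] show thesis by simp
next
  case False
  define K where "K = {f :: 'e \<Rightarrow> real. \<forall>b. f b \<in> (if b \<in> B then {-1..1} else {0})}"
  \<comment> \<open>The unit sphere of the maximum norm; the union over \<open>B\<close> is closed
    because \<open>B\<close> is finite.\<close>
  define K1 where "K1 = K \<inter> (\<Union>b\<in>B. {f. \<bar>f b\<bar> = 1})"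
  have "closed {f :: 'e \<Rightarrow> real. \<bar>f b\<bar> = 1}" for b
    by (intro closed_Collect_eq continuous_intros) (rule continuous_on_product_coordinates)+
  then have "closed (\<Union>b\<in>B. {f :: 'e \<Rightarrow> real. \<bar>f b\<bar> = 1})"
    using assms by blast
  moreover have "compact K"
    unfolding K_def by (rule compact_bounded_coefficients)
  ultimately have "compact K1"
    unfolding K1_def by blast
  obtain b0 where "b0 \<in> B" using False by blast
  then have "(\<lambda>b. if b = b0 then 1 else 0) \<in> K1"
    by (auto simp: K1_def K_def)
  then have "K1 \<noteq> {}" by blast
  have "continuous_on K1 (\<lambda>f. norm (\<Sum>b\<in>B. f b *\<^sub>R b))"
    by (intro continuous_on_norm continuous_on_linear_combination)
  then obtain f0 where f0: "f0 \<in> K1"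
      "\<And>f. f \<in> K1 \<Longrightarrow> norm (\<Sum>b\<in>B. f0 b *\<^sub>R b) \<le> norm (\<Sum>b\<in>B. f b *\<^sub>R b)"
    using continuous_attains_inf[OF \<open>compact K1\<close> \<open>K1 \<noteq> {}\<close>] by blast
  define \<mu> where "\<mu> = norm (\<Sum>b\<in>B. f0 b *\<^sub>R b)"
  obtain b1 where "b1 \<in> B" "\<bar>f0 b1\<bar> = 1"
    using f0(1) by (auto simp: K1_def)
  have "\<mu> > 0"
  proof (rule ccontr)
    assume "\<not> \<mu> > 0"
    then have "(\<Sum>b\<in>B. f0 b *\<^sub>R b) = 0" by (simp add: \<mu>_def)
    then have "f0 b1 = 0"
      using \<open>b1 \<in> B\<close> independentD[OF assms(2,1) order_refl] by blast
    with \<open>\<bar>f0 b1\<bar> = 1\<close> show False by simp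
  qed
  moreover have "\<mu> * \<bar>f b\<bar> \<le> norm (\<Sum>b\<in>B. f b *\<^sub>R b)" if "b \<in> B" for f b
  proof -
    define m where "m = Max ((\<lambda>b. \<bar>f b\<bar>) ` B)"
    have m: "\<bar>f c\<bar> \<le> m" if "c \<in> B" for c
      unfolding m_def using that assms by (simp add: Max_ge)
    have "m \<in> (\<lambda>b. \<bar>f b\<bar>) ` B"
      unfolding m_def using assms False by (intro Max_in) auto
    then obtain c where c: "c \<in> B" "\<bar>f c\<bar> = m" by auto
    show ?thesis
    proof (cases "m = 0")
      case True
      then show ?thesis using m[OF that] by simp
    next
      case False
      then have "m > 0" using m[OF that] by linarith
      define h where "h = (\<lambda>b. if b \<in> B then f b / m else 0)"
      have "h \<in> K1"
        using m \<open>m > 0\<close> c unfolding K1_def K_def h_def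
        by (auto simp: field_simps abs_le_iff minus_le_iff intro!: bexI[of _ c])
      have "(\<Sum>b\<in>B. h b *\<^sub>R b) = (1 / m) *\<^sub>R (\<Sum>b\<in>B. f b *\<^sub>R b)"
        by (simp add: scaleR_sum_right h_def)
      then have "\<mu> \<le> (1 / m) * norm (\<Sum>b\<in>B. f b *\<^sub>R b)"
        using f0(2)[OF \<open>h \<in> K1\<close>] \<open>m > 0\<close> by (simp add: \<mu>_def)
      then have "\<mu> * m \<le> norm (\<Sum>b\<in>B. f b *\<^sub>R b)"
        using \<open>m > 0\<close> by (simp add: field_simps)
      moreover have "\<mu> * \<bar>f b\<bar> \<le> \<mu> * m"
        using m[OF that] \<open>\<mu> > 0\<close> by simp
      ultimately show ?thesis by linarith
    qed
  qed
  ultimately show thesis using that by blast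
qed

lemma finite_span_coefficients:
  fixes B :: "'e::real_normed_vector set"
  assumes "finite B" "span B = UNIV"
  obtains C M r where "finite C" "M \<ge> 0"
    "\<forall>u::'e. u = (\<Sum>b\<in>C. r u b *\<^sub>R b)" "\<forall>(u::'e). \<forall>b\<in>C. \<bar>r u b\<bar> \<le> M * norm u"
proof -
  obtain C :: "'e set" where C: "finite C" "independent C" "span C = UNIV"
    using finite_span_imp_basis[OF assms] .
  obtain \<mu> where \<mu>: "\<mu> > 0"
      "\<And>f b. b \<in> C \<Longrightarrow> \<mu> * \<bar>f b\<bar> \<le> norm (\<Sum>b\<in>C. f b *\<^sub>R b)"
    using independent_coefficients_bound[OF C(1,2)] by blast
  have "\<forall>u. \<exists>f. u = (\<Sum>b\<in>C. f b *\<^sub>R b)"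
    using C span_finite[OF C(1)] by (metis (no_types, lifting) UNIV_I imageE)
  then obtain r where r: "\<forall>u::'e. u = (\<Sum>b\<in>C. r u b *\<^sub>R b)"
    by metis
  have "\<bar>r u b\<bar> \<le> (1 / \<mu>) * norm u" if "b \<in> C" for u b
    using \<mu>(2)[OF that, of "r u"] \<mu>(1) r[rule_format, of u] by (simp add: field_simps)
  with \<mu>(1) show thesis
    by (intro that[of C "1 / \<mu>" r] C(1) r) auto
qed

text \<open>\<open>C\<close> and \<open>M\<close> are chosen before \<open>L\<close>. For a family
  of linear maps the bound is thus an explicit expression in the finitely many values on
  \<open>C\<close>, and inherits their continuity in a parameter.\<close>

lemma finite_span_linear_bound:
  fixes B :: "'e::real_normed_vector set"
  assumes "finite B" "span B = UNIV"
  obtains C M where "finite C" "M \<ge> 0"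
    "\<forall>(L :: 'e \<Rightarrow> 'b::real_normed_vector) u. linear L \<longrightarrow>
       norm (L u) \<le> M * (\<Sum>b\<in>C. norm (L b)) * norm u"
proof -
  obtain C M r where C: "finite C" "M \<ge> 0"
    "\<forall>u::'e. u = (\<Sum>b\<in>C. r u b *\<^sub>R b)" "\<forall>(u::'e). \<forall>b\<in>C. \<bar>r u b\<bar> \<le> M * norm u"
    using finite_span_coefficients[OF assms] .
  have "norm (L u) \<le> M * (\<Sum>b\<in>C. norm (L b)) * norm u" if "linear L" for L :: "'e \<Rightarrow> 'b" and u
  proof -
    have "L u = (\<Sum>b\<in>C. r u b *\<^sub>R L b)"
      using that by (subst C(3)[rule_format, of u]) (simp add: linear_sum linear_scale)
    also have "norm \<dots> \<le> (\<Sum>b\<in>C. (M * norm u) * norm (L b))"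
      using C(4) by (intro sum_norm_le) (simp add: mult_right_mono)
    finally show ?thesis
      by (simp add: sum_distrib_left sum_distrib_right mult_ac)
  qed
  with C that show thesis by blast
qed

text \<open>The ball is a closed subset of the continuous image of a compact box of coefficients.
  Compactness is later used to minimise a metric over the unit sphere.\<close>

lemma finite_span_imp_compact_cball:
  fixes B :: "'e::real_normed_vector set"
  assumes "finite B" "span B = UNIV"
  shows "compact (cball (0::'e) R)"
proof -
  obtain C M r where C: "finite C" "M \<ge> 0"
    "\<forall>u::'e. u = (\<Sum>b\<in>C. r u b *\<^sub>R b)" "\<forall>(u::'e). \<forall>b\<in>C. \<bar>r u b\<bar> \<le> M * norm u"
    using finite_span_coefficients[OF assms] .
  define K where "K = {f :: 'e \<Rightarrow> real. \<forall>b. f b \<in> (if b \<in> C then {-(M*R)..M*R} else {0})}"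
  have "compact ((\<lambda>f. \<Sum>b\<in>C. f b *\<^sub>R b) ` K)"
    unfolding K_def
    by (intro compact_continuous_image continuous_on_linear_combination compact_bounded_coefficients)
  then have "compact ((\<lambda>f. \<Sum>b\<in>C. f b *\<^sub>R b) ` K \<inter> cball 0 R)"
    by (intro compact_Int_closed closed_cball)
  moreover have "cball 0 R \<subseteq> (\<lambda>f. \<Sum>b\<in>C. f b *\<^sub>R b) ` K"
  proof
    fix u :: 'e assume "u \<in> cball 0 R"
    then have "M * norm u \<le> M * R"
      using C(2) by (simp add: mult_left_mono)
    then have "\<bar>r u b\<bar> \<le> M * R" if "b \<in> C" for b
      using C(4)[rule_format, OF that, of u] by linarith
    then have "(\<lambda>b. if b \<in> C then r u b else 0) \<in> K"
      unfolding K_def by (fastforce simp: abs_le_iff)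
    moreover have "u = (\<Sum>b\<in>C. (if b \<in> C then r u b else 0) *\<^sub>R b)"
      using C(3)[rule_format, of u] by simp
    ultimately show "u \<in> (\<lambda>f. \<Sum>b\<in>C. f b *\<^sub>R b) ` K"
      by - (rule rev_image_eqI)
  qed
  ultimately show ?thesis
    by (simp add: Int_absorb1)
qed

lemma finite_span_linear_inj_imp_surj:
  assumes "finite (B :: 'e::real_vector set)" "span B = UNIV"
    and "linear (f :: 'e \<Rightarrow> 'e)" "inj f"
  shows "surj f"
proof -
  obtain C where C: "finite C" "independent C" "span C = (UNIV :: 'e set)"
    using finite_span_imp_basis[OF assms(1,2)] .
  interpret finite_dimensional_vector_space "scaleR :: real \<Rightarrow> 'e \<Rightarrow> 'e" C
    using C by unfold_locales
      (auto simp: algebra_simps span_raw_def dependent_raw_def)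
  show ?thesis
    using linear_inj_imp_surj assms(3,4) by (simp add: linear_def real_scaleR_def[abs_def] )
qed

text \<open>The reverse triangle inequality gives norm u \<le> 2 * norm (W u). This yields
  injectivity, hence bijectivity in finite dimension, and the same inequality read at a preimage
  bounds the inverse.\<close>

lemma blinfun_near_id_bij:
  fixes W :: "'e::real_normed_vector \<Rightarrow>\<^sub>L 'e"
  assumes "finite (B :: 'e set)" "span B = UNIV" and W: "norm (W - id_blinfun) \<le> 1 / 2"
  shows "bij (blinfun_apply W)" "norm (inv (blinfun_apply W) u) \<le> 2 * norm u"
proof -
  have lower: "norm u \<le> 2 * norm (blinfun_apply W u)" for u
  proof -
    have "norm (blinfun_apply (W - id_blinfun) u) \<le> 1 / 2 * norm u"
      by (rule order_trans[OF norm_blinfun]) (intro mult_right_mono W norm_ge_zero)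
    then have "norm (blinfun_apply W u - u) \<le> 1 / 2 * norm u"
      by (simp add: blinfun.diff_left)
    then show ?thesis
      using norm_triangle_ineq2[of u "u - blinfun_apply W u"]
      by (simp add: norm_minus_commute)
  qed
  have lin: "linear (blinfun_apply W)"
    by (simp add: blinfun.bounded_linear_right bounded_linear.linear)
  have "inj (blinfun_apply W)"
    unfolding linear_injective_0[OF lin]
  proof (intro allI impI)
    fix u assume "blinfun_apply W u = 0"
    with lower[of u] show "u = 0" by simp
  qed
  moreover from this have "surj (blinfun_apply W)"
    by (rule finite_span_linear_inj_imp_surj[OF assms(1,2) lin])
  ultimately show "bij (blinfun_apply W)" by (rule bijI)
  then show "norm (inv (blinfun_apply W) u) \<le> 2 * norm u"
    using lower[of "inv (blinfun_apply W) u"] by (simp add: bij_is_surj surj_f_inv_f)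
qed

text \<open>This computes the derivative in the compatibility tensor without differentiating
  inversion itself. The increment r of the function and q(a) = P(a) - W(a) P(b) satisfy W(a) r =
  q(a). Here q vanishes at b and has the claimed derivative, so r = O(norm (a - b)), and q - r = (W
  - I) r is of smaller order because W tends to the identity.\<close>

lemma has_derivative_inv_blinfun_apply:
  fixes W :: "'a::real_normed_vector \<Rightarrow> 'e::real_normed_vector \<Rightarrow>\<^sub>L 'e"
  assumes B: "finite (B :: 'e set)" "span B = UNIV"
    and W: "(W has_derivative W') (at b)" "W b = id_blinfun"
    and P: "(P has_derivative P') (at b)"
  shows "((\<lambda>a. inv (blinfun_apply (W a)) (P a)) has_derivative
           (\<lambda>v. P' v - blinfun_apply (W' v) (P b))) (at b)"
proof -
  define q where "q a = P a - blinfun_apply (W a) (P b)" for a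
  define q' where "q' v = P' v - blinfun_apply (W' v) (P b)" for v
  have "(q has_derivative q') (at b)"
    unfolding q_def q'_def
    by (auto intro!: derivative_eq_intros P W)
  then have q: "bounded_linear q'"
      "\<And>e. e > 0 \<Longrightarrow> \<exists>d>0. \<forall>a. norm (a - b) < d \<longrightarrow>
         norm (q a - q' (a - b)) \<le> e * norm (a - b)"
    unfolding has_derivative_at_alt by (auto simp: q_def W(2))
  obtain K where K: "K > 0" "\<And>v. norm (q' v) \<le> norm v * K"
    using bounded_linear.pos_bounded[OF q(1)] by blast
  obtain d1 where d1: "d1 > 0"
      "\<And>a. norm (a - b) < d1 \<Longrightarrow> norm (q a - q' (a - b)) \<le> norm (a - b)"
    using q(2)[of 1] by auto
  have q_le: "norm (q a) \<le> (K + 1) * norm (a - b)" if "norm (a - b) < d1" for a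
    using norm_triangle_ineq[of "q a - q' (a - b)" "q' (a - b)"] d1(2)[OF that] K(2)[of "a - b"]
    by (simp add: algebra_simps)
  have inv_id: "inv (blinfun_apply (W b)) (P b) = P b"
    by (simp add: W(2) inv_f_eq)
  have "\<exists>d>0. \<forall>a. norm (a - b) < d \<longrightarrow>
      norm (inv (blinfun_apply (W a)) (P a) - inv (blinfun_apply (W b)) (P b) - q' (a - b))
        \<le> e * norm (a - b)" if "e > 0" for e
  proof -
    \<comment> \<open>The bound 1 / 2 makes \<open>W a\<close> invertible with inverse of norm at
      most 2; the other one makes 2 (K + 1) \<eta> at most e / 2, where K + 1 is the growth constant
      of q near b.\<close>
    define \<eta> where "\<eta> = min (1 / 2) (e / (4 * (K + 1)))"
    have "\<eta> > 0" using \<open>e > 0\<close> K(1) by (simp add: \<eta>_def)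
    obtain d2 where d2: "d2 > 0"
        "\<And>a. norm (a - b) < d2 \<Longrightarrow> norm (q a - q' (a - b)) \<le> e / 2 * norm (a - b)"
      using q(2)[of "e / 2"] \<open>e > 0\<close> by auto
    have "isCont W b"
      using W(1) has_derivative_continuous by blast
    then obtain d3 where d3: "d3 > 0"
        "\<And>a. norm (a - b) < d3 \<Longrightarrow> norm (W a - id_blinfun) < \<eta>"
      using \<open>\<eta> > 0\<close> unfolding continuous_at_eps_delta W(2)[symmetric] dist_norm by blast
    have "norm (inv (blinfun_apply (W a)) (P a) - inv (blinfun_apply (W b)) (P b) - q' (a - b))
        \<le> e * norm (a - b)" if a: "norm (a - b) < min d1 (min d2 d3)" for a
    proof -
      define r where "r = inv (blinfun_apply (W a)) (P a) - P b"
      have small: "norm (W a - id_blinfun) \<le> \<eta>" "\<eta> \<le> 1 / 2"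
        using d3(2)[of a] a by (linarith, simp only: \<eta>_def min.cobounded1)
      then have "norm (W a - id_blinfun) \<le> 1 / 2" by linarith
      note bij = blinfun_near_id_bij[OF B this]
      have "blinfun_apply (W a) r = q a"
        using bij(1) by (simp add: r_def q_def blinfun.diff_right bij_is_surj surj_f_inv_f)
      then have r: "r = inv (blinfun_apply (W a)) (q a)"
        using bij(1) by (metis bij_is_inj inv_f_f)
      have "norm r \<le> 2 * ((K + 1) * norm (a - b))"
        using bij(2)[of "q a"] q_le[of a] a unfolding r by simp
      moreover have "norm (blinfun_apply (W a - id_blinfun) r) \<le> \<eta> * norm r"
        by (rule order_trans[OF norm_blinfun]) (intro mult_right_mono small norm_ge_zero)
      ultimately have "norm (blinfun_apply (W a - id_blinfun) r)
          \<le> \<eta> * (2 * ((K + 1) * norm (a - b)))"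
        using \<open>\<eta> > 0\<close> by (meson less_imp_le mult_left_mono order_trans)
      also have "\<dots> = (2 * (K + 1) * \<eta>) * norm (a - b)" by simp
      also have "\<dots> \<le> e / 2 * norm (a - b)"
      proof (rule mult_right_mono)
        have "\<eta> \<le> e / (4 * (K + 1))" by (simp add: \<eta>_def)
        then show "2 * (K + 1) * \<eta> \<le> e / 2"
          using K(1) by (simp add: field_simps)
      qed simp
      finally have "norm (q a - r) \<le> e / 2 * norm (a - b)"
        using \<open>blinfun_apply (W a) r = q a\<close> by (simp add: blinfun.diff_left)
      then have "norm (r - q' (a - b)) \<le> e * norm (a - b)"
        using d2(2)[of a] a norm_triangle_ineq[of "r - q a" "q a - q' (a - b)"]
        by (simp add: norm_minus_commute)
      then show ?thesis by (simp add: r_def inv_id)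
    qed
    moreover have "min d1 (min d2 d3) > 0" using d1 d2 d3 by simp
    ultimately show ?thesis by blast
  qed
  then show ?thesis
    unfolding has_derivative_at_alt q'_def[symmetric] using q(1) by simp
qed

section \<open>Iterated directional derivatives\<close>

text \<open>The direction comes before the point, so that \<open>dird f v\<close> is again a
  function of the point and iterates exactly as in the recursion of \<open>Ck_on\<close>.\<close>

definition dird :: "('a::real_normed_vector \<Rightarrow> 'b::real_normed_vector) \<Rightarrow> 'a \<Rightarrow> 'a \<Rightarrow> 'b"
where "dird f v x = frechet_derivative f (at x) v"

lemma Ck_on_Suc_dird:
  "Ck_on (Suc k) S f \<longleftrightarrow> (\<forall>x\<in>S. f differentiable (at x)) \<and> (\<forall>v. Ck_on k S (dird f v))"
  by (simp add: dird_def[abs_def])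

lemma has_derivative_dird:
  "f differentiable (at x) \<Longrightarrow> (f has_derivative (\<lambda>v. dird f v x)) (at x)"
  by (simp add: dird_def frechet_derivative_works[symmetric])

lemma dird_eqI: "(f has_derivative f') (at x) \<Longrightarrow> dird f v x = f' v"
  unfolding dird_def by (metis frechet_derivative_at)

lemma linear_dird: "f differentiable (at x) \<Longrightarrow> linear (\<lambda>v. dird f v x)"
  using has_derivative_dird has_derivative_linear by blast

lemma Ck_on_imp_continuous_on: "Ck_on k S f \<Longrightarrow> continuous_on S f"
  by (cases k) (auto intro!: continuous_at_imp_continuous_on differentiable_imp_continuous_within)

lemma Ck_on_dird: "Ck_on (Suc k) S f \<Longrightarrow> Ck_on k S (dird f v)"
  unfolding Ck_on_Suc_dird by blast

lemma Ck_on_differentiable: "Ck_on (Suc k) S f \<Longrightarrow> x \<in> S \<Longrightarrow> f differentiable (at x)"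
  by simp

lemma dird_cong_open:
  assumes "open S" "x \<in> S" "\<And>z. z \<in> S \<Longrightarrow> f z = g z" "g differentiable (at x)"
  shows "dird f v x = dird g v x"
proof (rule dird_eqI)
  show "(f has_derivative (\<lambda>v. dird g v x)) (at x)"
    by (rule has_derivative_transform_within_open[OF has_derivative_dird[OF assms(4)] assms(1,2)])
      (simp add: assms(3))
qed

lemma dird_add: "f differentiable (at x) \<Longrightarrow> g differentiable (at x) \<Longrightarrow>
    dird (\<lambda>z. f z + g z) v x = dird f v x + dird g v x"
  by (rule dird_eqI) (intro has_derivative_add has_derivative_dird)

lemma dird_scaleR: "f differentiable (at x) \<Longrightarrow> dird (\<lambda>z. r *\<^sub>R f z) v x = r *\<^sub>R dird f v x"
  by (rule dird_eqI) (intro has_derivative_scaleR_right has_derivative_dird)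

text \<open>An identity that is linear in the parameter holds on an open set and can therefore be
  differentiated in the outer direction. In the applications \<open>\<iota>\<close> is the inclusion
  u \<mapsto> (0, u) of the second factor, and the lemma gives linearity of higher derivatives in
  their inner directions.\<close>

lemma linear_dird_inner:
  assumes "open S" "x \<in> S" "linear \<iota>"
    and f: "\<And>u z. z \<in> S \<Longrightarrow> F u differentiable (at z)"
    and lin: "\<And>z. z \<in> S \<Longrightarrow> linear (\<lambda>u. F (\<iota> u) z)"
  shows "linear (\<lambda>u. dird (F (\<iota> u)) v x)"
proof (rule linearI)
  fix u u'
  have "dird (F (\<iota> (u + u'))) v x = dird (\<lambda>z. F (\<iota> u) z + F (\<iota> u') z) v x"
    using assms by (intro dird_cong_open[OF assms(1,2)] differentiable_add)
      (simp_all add: linear_add[OF lin])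
  then show "dird (F (\<iota> (u + u'))) v x = dird (F (\<iota> u)) v x + dird (F (\<iota> u')) v x"
    using assms(2) by (simp add: dird_add f)
next
  fix r u
  have "dird (F (\<iota> (r *\<^sub>R u))) v x = dird (\<lambda>z. r *\<^sub>R F (\<iota> u) z) v x"
    using assms by (intro dird_cong_open[OF assms(1,2)] differentiable_scaleR)
      (simp_all add: linear_scale[OF lin])
  then show "dird (F (\<iota> (r *\<^sub>R u))) v x = r *\<^sub>R dird (F (\<iota> u)) v x"
    using assms(2) by (simp add: dird_scaleR f)
qed

lemma has_vector_derivative_line:
  assumes "f differentiable (at (x + r *\<^sub>R u))"
  shows "((\<lambda>r. f (x + r *\<^sub>R u)) has_vector_derivative dird f u (x + r *\<^sub>R u)) (at r)"
proof -
  have "((\<lambda>r. f (x + r *\<^sub>R u)) has_derivative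
      (\<lambda>h. dird f (h *\<^sub>R u) (x + r *\<^sub>R u))) (at r)"
    by (rule has_derivative_compose[where f = "\<lambda>r. x + r *\<^sub>R u"])
      (auto intro!: derivative_eq_intros has_derivative_dird assms)
  then show ?thesis
    unfolding has_vector_derivative_def by (simp add: linear_scale[OF linear_dird[OF assms]])
qed

lemma norm_diff_le_of_vector_derivative:
  fixes \<phi> :: "real \<Rightarrow> 'b::real_normed_vector"
  assumes "\<And>r. r \<in> {0..s} \<Longrightarrow> (\<phi> has_vector_derivative \<phi>' r) (at r)"
    and "\<And>r. r \<in> {0..s} \<Longrightarrow> norm (\<phi>' r) \<le> K" and "0 \<le> s"
  shows "norm (\<phi> s - \<phi> 0) \<le> K * s"
proof -
  have "norm (\<phi> s - \<phi> 0) \<le> K * norm (s - 0)"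
  proof (rule differentiable_bound[where S = "{0..s}" and f' = "\<lambda>r h. h *\<^sub>R \<phi>' r"])
    fix r assume r: "r \<in> {0..s}"
    show "(\<phi> has_derivative (\<lambda>h. h *\<^sub>R \<phi>' r)) (at r within {0..s})"
      using assms(1)[OF r] has_derivative_at_withinI unfolding has_vector_derivative_def by blast
    show "onorm (\<lambda>h. h *\<^sub>R \<phi>' r) \<le> K"
      using assms(2)[OF r] by (intro onorm_le) (simp add: mult.commute[of K] mult_left_mono)
  qed (use assms(3) in auto)
  then show ?thesis using assms(3) by simp
qed

text \<open>Three mean value inequalities: for \<open>\<phi>2\<close>, then for
  \<open>\<phi>1\<close> minus its linear part, then for \<open>\<phi>\<close> minus its quadratic
  Taylor polynomial. Each factor r \<le> 1 is simply dropped, which leaves K in place of K /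
  6.\<close>

lemma taylor_2_remainder:
  fixes \<phi> :: "real \<Rightarrow> 'b::real_normed_vector"
  assumes "\<And>r. r \<in> {0..1} \<Longrightarrow> (\<phi> has_vector_derivative \<phi>1 r) (at r)"
    and "\<And>r. r \<in> {0..1} \<Longrightarrow> (\<phi>1 has_vector_derivative \<phi>2 r) (at r)"
    and "\<And>r. r \<in> {0..1} \<Longrightarrow> (\<phi>2 has_vector_derivative \<phi>3 r) (at r)"
    and "\<And>r. r \<in> {0..1} \<Longrightarrow> norm (\<phi>3 r) \<le> K"
  shows "norm (\<phi> 1 - \<phi> 0 - \<phi>1 0 - (1 / 2) *\<^sub>R \<phi>2 0) \<le> K"
proof -
  have "K \<ge> 0"
    using order_trans[OF norm_ge_zero assms(4)[of 0]] by simp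
  have b2: "norm (\<phi>2 r - \<phi>2 0) \<le> K" if "r \<in> {0..1}" for r
  proof -
    have "norm (\<phi>2 r - \<phi>2 0) \<le> K * r"
      using that assms by (intro norm_diff_le_of_vector_derivative[where \<phi>' = \<phi>3]) auto
    also have "K * r \<le> K"
      using that \<open>K \<ge> 0\<close> by (simp add: mult_left_le)
    finally show ?thesis .
  qed
  have b1: "norm (\<phi>1 r - \<phi>1 0 - r *\<^sub>R \<phi>2 0) \<le> K" if "r \<in> {0..1}" for r
  proof -
    have "norm ((\<phi>1 r - r *\<^sub>R \<phi>2 0) - (\<phi>1 0 - 0 *\<^sub>R \<phi>2 0)) \<le> K * r"
      using that b2
      by (intro norm_diff_le_of_vector_derivative[where \<phi>' = "\<lambda>r. \<phi>2 r - \<phi>2 0"])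
        (auto intro!: derivative_eq_intros assms(2))
    also have "K * r \<le> K"
      using that \<open>K \<ge> 0\<close> by (simp add: mult_left_le)
    finally show ?thesis by (simp add: algebra_simps)
  qed
  have "norm ((\<phi> 1 - 1 *\<^sub>R \<phi>1 0 - (1\<^sup>2 / 2) *\<^sub>R \<phi>2 0) - (\<phi> 0 - 0 *\<^sub>R \<phi>1 0 - (0\<^sup>2 / 2) *\<^sub>R \<phi>2 0)) \<le> K * 1"
    using b1
    by (intro norm_diff_le_of_vector_derivative
        [where \<phi>' = "\<lambda>r. \<phi>1 r - \<phi>1 0 - r *\<^sub>R \<phi>2 0" and \<phi> = "\<lambda>r. \<phi> r - r *\<^sub>R \<phi>1 0 - (r\<^sup>2 / 2) *\<^sub>R \<phi>2 0"])
      (auto intro!: derivative_eq_intros assms(1))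
  then show ?thesis by (simp add: algebra_simps)
qed

text \<open>Schwarz's theorem by second differences: over the parallelogram spanned by r u and r v,
  the second difference of f is r^2 times the mixed derivative up to o(r^2), and it is symmetric in
  u and v.\<close>

lemma dird_swap:
  assumes "open S" "x \<in> S" and f: "Ck_on 2 S f"
  shows "dird (dird f u) v x = dird (dird f v) u x"
proof -
  have second: "\<exists>d>0. \<forall>r. 0 < r \<and> r < d \<longrightarrow>
      norm (f (x + r *\<^sub>R u + r *\<^sub>R v) - f (x + r *\<^sub>R u) - (f (x + r *\<^sub>R v) - f x)
        - (r * r) *\<^sub>R dird (dird f u) v x) \<le> e * (r * r)" if "e > 0" for e u v
  proof -
    have Ck: "Ck_on (Suc (Suc 0)) S f" using f by (simp add: numeral_2_eq_2)
    have df: "f differentiable (at z)" if "z \<in> S" for z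
      using Ck_on_differentiable[OF Ck that] .
    have df1: "dird f u differentiable (at z)" if "z \<in> S" for z
      using Ck_on_differentiable[OF Ck_on_dird[OF Ck] that] .
    have "continuous_on S (dird (dird f u) v)"
      by (rule Ck_on_imp_continuous_on[OF Ck_on_dird[OF Ck_on_dird[OF Ck]]])
    then have "isCont (dird (dird f u) v) x"
      using assms(1,2) continuous_on_eq_continuous_at by blast
    then obtain d1 where d1: "d1 > 0"
        "\<And>z. dist z x < d1 \<Longrightarrow> dist (dird (dird f u) v z) (dird (dird f u) v x) < e"
      using \<open>e > 0\<close> unfolding continuous_at_eps_delta by blast
    obtain d2 where d2: "d2 > 0" "ball x d2 \<subseteq> S"
      using assms(1,2) open_contains_ball by blast
    \<comment> \<open>The summand 1 keeps \<open>n\<close> positive when both directions vanish and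
      makes the estimate of \<open>near\<close> strict.\<close>
    define n where "n = norm u + norm v + 1"
    have "n > 0" by (simp add: n_def add_nonneg_pos)
    define d where "d = min d1 d2 / n"
    have "d > 0" using d1(1) d2(1) \<open>n > 0\<close> by (simp add: d_def)
    have near: "dist (x + q *\<^sub>R u + q' *\<^sub>R v) x < min d1 d2"
      if "0 \<le> q" "q \<le> r" "0 \<le> q'" "q' \<le> r" "0 < r" "r < d" for q q' r
    proof -
      have "norm (q *\<^sub>R u + q' *\<^sub>R v) \<le> r * norm u + r * norm v"
        using that by (intro norm_triangle_le add_mono) (auto intro!: mult_right_mono)
      also have "\<dots> < r * n" using that by (simp add: n_def algebra_simps)
      also have "\<dots> < d * n" using that \<open>n > 0\<close> by simp
      finally show ?thesis using \<open>n > 0\<close> by (simp add: d_def dist_norm add.assoc)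
    qed
    have "norm (f (x + r *\<^sub>R u + r *\<^sub>R v) - f (x + r *\<^sub>R u) - (f (x + r *\<^sub>R v) - f x)
        - (r * r) *\<^sub>R dird (dird f u) v x) \<le> e * (r * r)" if r: "0 < r" "r < d" for r
    proof -
      have inS: "x + q *\<^sub>R u + q' *\<^sub>R v \<in> S" if "0 \<le> q" "q \<le> r" "0 \<le> q'" "q' \<le> r" for q q'
        using near[OF that r] d2(2) by (auto simp: dist_commute)
      \<comment> \<open>Mean value inequality in direction \<open>v\<close>, applied to the
        derivative in direction \<open>u\<close> with its expected linear growth subtracted.\<close>
      have inner: "norm (dird f u (x + q *\<^sub>R u + r *\<^sub>R v) - dird f u (x + q *\<^sub>R u)
          - r *\<^sub>R dird (dird f u) v x) \<le> e * r" if q: "0 \<le> q" "q \<le> r" for q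
      proof -
        have "norm ((dird f u (x + q *\<^sub>R u + r *\<^sub>R v) - r *\<^sub>R dird (dird f u) v x)
           - (dird f u (x + q *\<^sub>R u + 0 *\<^sub>R v) - 0 *\<^sub>R dird (dird f u) v x)) \<le> e * r"
        proof (rule norm_diff_le_of_vector_derivative[where \<phi>' =
              "\<lambda>q'. dird (dird f u) v (x + q *\<^sub>R u + q' *\<^sub>R v) - dird (dird f u) v x"])
          fix q' assume q': "q' \<in> {0..r}"
          show "((\<lambda>r. dird f u (x + q *\<^sub>R u + r *\<^sub>R v) - r *\<^sub>R dird (dird f u) v x)
             has_vector_derivative dird (dird f u) v (x + q *\<^sub>R u + q' *\<^sub>R v) - dird (dird f u) v x) (at q')"
            using q' q by (auto intro!: derivative_eq_intros has_vector_derivative_line df1 inS)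
          show "norm (dird (dird f u) v (x + q *\<^sub>R u + q' *\<^sub>R v) - dird (dird f u) v x) \<le> e"
            using near[of q r q'] q q' r d1(2) by (simp add: dist_norm less_imp_le)
        qed (use r in auto)
        then show ?thesis by (simp add: algebra_simps)
      qed
      \<comment> \<open>Mean value inequality in direction \<open>u\<close> for the first difference
        of \<open>f\<close> in direction \<open>v\<close>; \<open>inner\<close> bounds the
        derivative of this function of q.\<close>
      have "norm ((f (x + r *\<^sub>R v + r *\<^sub>R u) - f (x + r *\<^sub>R u) - (r * r) *\<^sub>R dird (dird f u) v x)
         - (f (x + r *\<^sub>R v + 0 *\<^sub>R u) - f (x + 0 *\<^sub>R u) - (0 * r) *\<^sub>R dird (dird f u) v x)) \<le> (e * r) * r"
      proof (rule norm_diff_le_of_vector_derivative[where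
            \<phi> = "\<lambda>q. f (x + r *\<^sub>R v + q *\<^sub>R u) - f (x + q *\<^sub>R u) - (q * r) *\<^sub>R dird (dird f u) v x" and
            \<phi>' = "\<lambda>q. dird f u (x + r *\<^sub>R v + q *\<^sub>R u) - dird f u (x + q *\<^sub>R u) - r *\<^sub>R dird (dird f u) v x"])
        fix q assume q: "q \<in> {0..r}"
        have "x + r *\<^sub>R v + q *\<^sub>R u \<in> S" "x + q *\<^sub>R u \<in> S"
          using inS[of q r] inS[of q 0] q r by (auto simp: algebra_simps)
        then show "((\<lambda>q. f (x + r *\<^sub>R v + q *\<^sub>R u) - f (x + q *\<^sub>R u) - (q * r) *\<^sub>R dird (dird f u) v x)
            has_vector_derivative
            dird f u (x + r *\<^sub>R v + q *\<^sub>R u) - dird f u (x + q *\<^sub>R u) - r *\<^sub>R dird (dird f u) v x) (at q)"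
          by (auto intro!: derivative_eq_intros has_vector_derivative_line df)
        show "norm (dird f u (x + r *\<^sub>R v + q *\<^sub>R u) - dird f u (x + q *\<^sub>R u) - r *\<^sub>R dird (dird f u) v x) \<le> e * r"
          using inner[of q] q by (simp add: algebra_simps)
      qed (use r in auto)
      then show ?thesis by (simp add: algebra_simps)
    qed
    with \<open>d > 0\<close> show ?thesis by blast
  qed
  have "norm (dird (dird f u) v x - dird (dird f v) u x) \<le> 0 + e" if "e > 0" for e
  proof -
    obtain d where d: "d > 0" "\<And>r. 0 < r \<and> r < d \<Longrightarrow>
      norm (f (x + r *\<^sub>R u + r *\<^sub>R v) - f (x + r *\<^sub>R u) - (f (x + r *\<^sub>R v) - f x)
        - (r * r) *\<^sub>R dird (dird f u) v x) \<le> e / 2 * (r * r)"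
      using second[of "e / 2"] \<open>e > 0\<close> by (metis half_gt_zero)
    obtain d' where d': "d' > 0" "\<And>r. 0 < r \<and> r < d' \<Longrightarrow>
      norm (f (x + r *\<^sub>R v + r *\<^sub>R u) - f (x + r *\<^sub>R v) - (f (x + r *\<^sub>R u) - f x)
        - (r * r) *\<^sub>R dird (dird f v) u x) \<le> e / 2 * (r * r)"
      using second[of "e / 2"] \<open>e > 0\<close> by (metis half_gt_zero)
    define r where "r = min d d' / 2"
    have r: "0 < r" "r < d" "r < d'" using d(1) d'(1) by (auto simp: r_def)
    \<comment> \<open>Both orders of differentiation produce this same second difference, so the two
      derivatives are each within e / 2 of P / r^2.\<close>
    define P where "P = f (x + r *\<^sub>R u + r *\<^sub>R v) - f (x + r *\<^sub>R u) - (f (x + r *\<^sub>R v) - f x)"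
    have "f (x + r *\<^sub>R v + r *\<^sub>R u) - f (x + r *\<^sub>R v) - (f (x + r *\<^sub>R u) - f x) = P"
      by (simp add: P_def algebra_simps)
    with d'(2)[of r] r have "norm (P - (r * r) *\<^sub>R dird (dird f v) u x) \<le> e / 2 * (r * r)" by simp
    moreover have "norm (P - (r * r) *\<^sub>R dird (dird f u) v x) \<le> e / 2 * (r * r)"
      using d(2)[of r] r by (simp add: P_def)
    ultimately have "norm ((P - (r * r) *\<^sub>R dird (dird f v) u x) - (P - (r * r) *\<^sub>R dird (dird f u) v x))
        \<le> e / 2 * (r * r) + e / 2 * (r * r)"
      by (rule norm_triangle_le_diff[OF add_mono])
    also have "(P - (r * r) *\<^sub>R dird (dird f v) u x) - (P - (r * r) *\<^sub>R dird (dird f u) v x)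
       = (r * r) *\<^sub>R (dird (dird f u) v x - dird (dird f v) u x)"
      by (simp add: algebra_simps)
    finally have "(r * r) * norm (dird (dird f u) v x - dird (dird f v) u x) \<le> (r * r) * e"
      by (simp add: mult.commute)
    with r(1) show ?thesis by simp
  qed
  then have "norm (dird (dird f u) v x - dird (dird f v) u x) \<le> 0"
    by (rule field_le_epsilon)
  then show ?thesis by simp
qed

section \<open>Continuous families of multilinear maps and Taylor expansion along the
  diagonal\<close>

lemma linear_family_bound:
  fixes B :: "'e::real_normed_vector set" and L :: "'z::topological_space \<Rightarrow> 'e \<Rightarrow> 'b::real_normed_vector"
  assumes B: "finite B" "span B = UNIV"
    and "\<And>z. z \<in> S \<Longrightarrow> linear (L z)" "\<And>u. continuous_on S (\<lambda>z. L z u)"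
  obtains N :: "'z \<Rightarrow> real"
  where "continuous_on S N" "\<forall>z\<in>S. \<forall>u. norm (L z u) \<le> N z * norm u"
    "\<forall>z. (\<forall>u. L z u = 0) \<longrightarrow> N z = 0"
proof -
  obtain C M where C: "finite C" "M \<ge> 0" "\<forall>(L :: 'e \<Rightarrow> 'b) u. linear L \<longrightarrow>
       norm (L u) \<le> M * (\<Sum>b\<in>C. norm (L b)) * norm u"
    using finite_span_linear_bound[OF B] .
  show thesis
    using C assms
    by (intro that[of "\<lambda>z. M * (\<Sum>b\<in>C. norm (L z b))"]) (auto intro!: continuous_intros)
qed

text \<open>Freeze the first argument on the finite set \<open>C\<close>, bound the resulting linear
  families, and recombine. The clause that \<open>N\<close> vanishes where the family does is meant
  for differences: the majorant of L z - L z0 is continuous and zero at z0, hence small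
  nearby.\<close>

lemma bilinear_family_bound:
  fixes B :: "'e::real_normed_vector set" and L :: "'z::topological_space \<Rightarrow> 'e \<Rightarrow> 'e \<Rightarrow> 'b::real_normed_vector"
  assumes B: "finite B" "span B = UNIV"
    and lin: "\<And>z v. z \<in> S \<Longrightarrow> linear (\<lambda>u. L z u v)" "\<And>z u. z \<in> S \<Longrightarrow> linear (L z u)"
    and cont: "\<And>u v. continuous_on S (\<lambda>z. L z u v)"
  obtains N :: "'z \<Rightarrow> real"
  where "continuous_on S N" "\<forall>z\<in>S. \<forall>u v. norm (L z u v) \<le> N z * (norm u * norm v)"
    "\<forall>z. (\<forall>u v. L z u v = 0) \<longrightarrow> N z = 0"
proof -
  obtain C M where C: "finite C" "M \<ge> 0" "\<forall>(L :: 'e \<Rightarrow> 'b) u. linear L \<longrightarrow>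
       norm (L u) \<le> M * (\<Sum>b\<in>C. norm (L b)) * norm u"
    using finite_span_linear_bound[OF B] .
  have "\<exists>N. continuous_on S N \<and> (\<forall>z\<in>S. \<forall>v. norm (L z u v) \<le> N z * norm v) \<and>
      (\<forall>z. (\<forall>v. L z u v = 0) \<longrightarrow> N z = 0)" for u
    using linear_family_bound[OF B, of S "\<lambda>z. L z u"] lin(2) cont by metis
  then obtain N where N: "\<And>u. continuous_on S (N u)"
      "\<And>u z v. z \<in> S \<Longrightarrow> norm (L z u v) \<le> N u z * norm v"
      "\<And>u z. (\<forall>v. L z u v = 0) \<Longrightarrow> N u z = 0"
    by metis
  have "norm (L z u v) \<le> (M * (\<Sum>b\<in>C. N b z)) * (norm u * norm v)" if "z \<in> S" for z u v
  proof -
    have "norm (L z u v) \<le> M * (\<Sum>b\<in>C. norm (L z b v)) * norm u"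
      using C(3)[rule_format, OF lin(1)[OF that]] .
    also have "\<dots> \<le> M * (\<Sum>b\<in>C. N b z * norm v) * norm u"
      using C(2) N(2)[OF that] by (intro mult_right_mono mult_left_mono sum_mono) auto
    finally show ?thesis by (simp add: sum_distrib_left sum_distrib_right mult_ac)
  qed
  then show thesis
    by (intro that[of "\<lambda>z. M * (\<Sum>b\<in>C. N b z)"]) (auto intro!: continuous_intros N(1) sum.neutral N(3))
qed

lemma trilinear_family_bound:
  fixes B :: "'e::real_normed_vector set"
    and L :: "'z::topological_space \<Rightarrow> 'e \<Rightarrow> 'e \<Rightarrow> 'e \<Rightarrow> 'b::real_normed_vector"
  assumes B: "finite B" "span B = UNIV"
    and lin: "\<And>z v w. z \<in> S \<Longrightarrow> linear (\<lambda>u. L z u v w)" "\<And>z u w. z \<in> S \<Longrightarrow> linear (\<lambda>v. L z u v w)"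
      "\<And>z u v. z \<in> S \<Longrightarrow> linear (L z u v)"
    and cont: "\<And>u v w. continuous_on S (\<lambda>z. L z u v w)"
  obtains N :: "'z \<Rightarrow> real"
  where "continuous_on S N"
    "\<forall>z\<in>S. \<forall>u v w. norm (L z u v w) \<le> N z * (norm u * (norm v * norm w))"
proof -
  obtain C M where C: "finite C" "M \<ge> 0" "\<forall>(L :: 'e \<Rightarrow> 'b) u. linear L \<longrightarrow>
       norm (L u) \<le> M * (\<Sum>b\<in>C. norm (L b)) * norm u"
    using finite_span_linear_bound[OF B] .
  have "\<exists>N. continuous_on S N \<and> (\<forall>z\<in>S. \<forall>v w. norm (L z u v w) \<le> N z * (norm v * norm w))" for u
    using bilinear_family_bound[OF B, of S "\<lambda>z. L z u"] lin(2,3) cont by metis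
  then obtain N where N: "\<And>u. continuous_on S (N u)"
      "\<And>u z v w. z \<in> S \<Longrightarrow> norm (L z u v w) \<le> N u z * (norm v * norm w)"
    by metis
  have "norm (L z u v w) \<le> (M * (\<Sum>b\<in>C. N b z)) * (norm u * (norm v * norm w))" if "z \<in> S" for z u v w
  proof -
    have "norm (L z u v w) \<le> M * (\<Sum>b\<in>C. norm (L z b v w)) * norm u"
      using C(3)[rule_format, OF lin(1)[OF that]] .
    also have "\<dots> \<le> M * (\<Sum>b\<in>C. N b z * (norm v * norm w)) * norm u"
      using C(2) N(2)[OF that] by (intro mult_right_mono mult_left_mono sum_mono) auto
    finally show ?thesis by (simp add: sum_distrib_left sum_distrib_right mult_ac)
  qed
  then show thesis
    by (intro that[of "\<lambda>z. M * (\<Sum>b\<in>C. N b z)"]) (auto intro!: continuous_intros N(1))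
qed

lemma eventually_bounded_of_continuous_on:
  fixes N :: "'z::t2_space \<Rightarrow> real"
  assumes "continuous_on S N" "open S" "z \<in> S"
  shows "\<forall>\<^sub>F x in nhds z. x \<in> S \<and> N x \<le> \<bar>N z\<bar> + 1"
proof -
  have "N \<midarrow>z\<rightarrow> N z"
    by (rule isContD) (use assms in \<open>simp add: continuous_on_eq_continuous_at\<close>)
  then have "\<forall>\<^sub>F x in at z. N x < \<bar>N z\<bar> + 1"
    by (rule order_tendstoD) linarith
  then have "\<forall>\<^sub>F x in nhds z. N x \<le> \<bar>N z\<bar> + 1"
    unfolding eventually_at_filter by (rule eventually_mono) (smt (verit) UNIV_I)
  then show ?thesis
    using assms eventually_nhds_in_open[of S z] by (simp add: eventually_conj_iff)
qed

abbreviation hess2 ::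
  "('e::real_normed_vector \<times> 'e \<Rightarrow> 'b::real_normed_vector) \<Rightarrow> 'e \<Rightarrow> 'e \<Rightarrow> 'e \<times> 'e \<Rightarrow> 'b"
where "hess2 f u v \<equiv> dird (dird f (0, u)) (0, v)"

text \<open>Expansion in the second variable with base point (a, a). The base point is free and the
  constants are uniform near \<open>a0\<close>, because a and b will be the chart values of
  \<open>y s\<close> and \<open>y t\<close>, which both move. The continuous majorant of the third
  derivative is bounded near (a0, a0), which turns it into a cubic remainder.\<close>

lemma diagonal_taylor:
  fixes B :: "'e::real_normed_vector set" and f :: "'e \<times> 'e \<Rightarrow> 'b::real_normed_vector"
  assumes B: "finite B" "span B = UNIV" and "open S" "(a0, a0) \<in> S" and f: "Ck_on 3 S f"
  obtains \<epsilon> K where "\<epsilon> > 0" "K \<ge> 0"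
    "\<forall>a b. dist a a0 < \<epsilon> \<longrightarrow> dist b a0 < \<epsilon> \<longrightarrow> (a, b) \<in> S \<and>
       norm (f (a, b) - f (a, a) - dird f (0, b - a) (a, a)
         - (1 / 2) *\<^sub>R hess2 f (b - a) (b - a) (a, a)) \<le> K * norm (b - a) ^ 3"
    "\<forall>a u v. dist a a0 < \<epsilon> \<longrightarrow> norm (hess2 f u v (a, a)) \<le> K * (norm u * norm v)"
proof -
  have Ck: "Ck_on (Suc (Suc (Suc 0))) S f" using f by (simp add: numeral_3_eq_3)
  note Ck1 = Ck_on_dird[OF Ck]
  note Ck2 = Ck_on_dird[OF Ck1]
  note Ck3 = Ck_on_dird[OF Ck2]
  note df = Ck_on_differentiable[OF Ck]
  note df1 = Ck_on_differentiable[OF Ck1]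
  note df2 = Ck_on_differentiable[OF Ck2]
  have \<iota>: "linear (\<lambda>u::'e. (0::'e, u))" by (intro linearI) auto
  have l1: "linear (\<lambda>u. dird f (0, u) z)" if "z \<in> S" for z
    using linear_compose[OF \<iota> linear_dird[OF df[OF that]]] by (simp add: o_def)
  have l1': "linear (\<lambda>v. dird (dird f u) (0, v) z)" if "z \<in> S" for z u
    using linear_compose[OF \<iota> linear_dird[OF df1[OF that]]] by (simp add: o_def)
  have l2: "linear (\<lambda>u. dird (dird f (0, u)) v z)" if "z \<in> S" for z v
    using linear_dird_inner[OF \<open>open S\<close> that \<iota>, of "dird f"] df1 l1 by blast
  have l3: "linear (\<lambda>w. dird (dird (dird f u) v) (0, w) z)" if "z \<in> S" for z u v
    using linear_compose[OF \<iota> linear_dird[OF df2[OF that]]] by (simp add: o_def)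
  have l3': "linear (\<lambda>v. dird (dird (dird f u) (0, v)) w z)" if "z \<in> S" for z u w
    using linear_dird_inner[OF \<open>open S\<close> that \<iota>, of "dird (dird f u)"] df2 l1' by blast
  have l3'': "linear (\<lambda>u. dird (dird (dird f (0, u)) v) w z)" if "z \<in> S" for z v w
    using linear_dird_inner[OF \<open>open S\<close> that \<iota>, of "\<lambda>u. dird (dird f u) v"] df2 l2 by blast
  obtain N2 where N2: "continuous_on S N2"
      "\<forall>z\<in>S. \<forall>u v. norm (hess2 f u v z) \<le> N2 z * (norm u * norm v)"
    using bilinear_family_bound[OF B, of S "\<lambda>z u v. hess2 f u v z",
        OF l2 l1' Ck_on_imp_continuous_on[OF Ck2]] by metis
  obtain N3 where N3: "continuous_on S N3"
      "\<forall>z\<in>S. \<forall>u v w. norm (dird (hess2 f u v) (0, w) z) \<le> N3 z * (norm u * (norm v * norm w))"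
    using trilinear_family_bound[OF B, of S "\<lambda>z u v w. dird (hess2 f u v) (0, w) z",
        OF l3'' l3' l3 Ck_on_imp_continuous_on[OF Ck3]] .
  \<comment> \<open>The values at (a0, a0), increased by 1, bound the majorants of the second and
    third derivatives on a whole neighbourhood.\<close>
  define K where "K = max (\<bar>N2 (a0, a0)\<bar> + 1) (\<bar>N3 (a0, a0)\<bar> + 1)"
  have "K \<ge> 0" by (simp add: K_def)
  have "\<forall>\<^sub>F z in nhds (a0, a0). z \<in> S \<and> N2 z \<le> K \<and> N3 z \<le> K"
    using eventually_conj[OF eventually_bounded_of_continuous_on[OF N2(1) \<open>open S\<close> assms(4)]
        eventually_bounded_of_continuous_on[OF N3(1) \<open>open S\<close> assms(4)]]
    by (rule eventually_mono) (auto simp: K_def)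
  then obtain d where d: "d > 0" "\<And>z. dist z (a0, a0) < d \<Longrightarrow> z \<in> S \<and> N2 z \<le> K \<and> N3 z \<le> K"
    unfolding eventually_nhds_metric by blast
  \<comment> \<open>Distance in the product is at most the sum of the two distances, hence the
    radius d / 2 in each factor.\<close>
  have near: "dist (a, b) (a0, a0) < d" if "dist a a0 < d / 2" "dist b a0 < d / 2" for a b
  proof -
    have "dist (a, b) (a0, a0) \<le> dist a a0 + dist b a0"
      by (simp add: dist_Pair_Pair sqrt_sum_squares_le_sum)
    with that show ?thesis by linarith
  qed
  have "norm (f (a, b) - f (a, a) - dird f (0, b - a) (a, a)
         - (1 / 2) *\<^sub>R hess2 f (b - a) (b - a) (a, a)) \<le> K * norm (b - a) ^ 3"
    if ab: "dist a a0 < d / 2" "dist b a0 < d / 2" for a b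
  proof -
    define v where "v = b - a"
    have line: "dist ((a, a) + r *\<^sub>R (0, v)) (a0, a0) < d" if "r \<in> {0..1}" for r
    proof -
      have "a + r *\<^sub>R v \<in> ball a0 (d / 2)"
      proof -
        \<comment> \<open>The segment from (a, a) to (a, b) moves in the second factor only and
          stays near (a0, a0) by convexity of balls.\<close>
        have "a + r *\<^sub>R v = (1 - r) *\<^sub>R a + r *\<^sub>R b" by (simp add: v_def algebra_simps)
        then show ?thesis
          using convexD_alt[OF convex_ball, of a a0 "d / 2" b r] ab that by (simp add: dist_commute)
      qed
      then show ?thesis using near[of a "a + r *\<^sub>R v"] ab by (simp add: dist_commute)
    qed
    have "norm (f ((a, a) + 1 *\<^sub>R (0, v)) - f ((a, a) + 0 *\<^sub>R (0, v))
        - dird f (0, v) ((a, a) + 0 *\<^sub>R (0, v)) - (1 / 2) *\<^sub>R hess2 f v v ((a, a) + 0 *\<^sub>R (0, v)))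
        \<le> K * norm v ^ 3"
    proof (rule taylor_2_remainder)
      fix r :: real assume r: "r \<in> {0..1}"
      note z = d(2)[OF line[OF r]]
      show "((\<lambda>r. f ((a, a) + r *\<^sub>R (0, v))) has_vector_derivative
          dird f (0, v) ((a, a) + r *\<^sub>R (0, v))) (at r)"
        using z by (intro has_vector_derivative_line df) blast
      show "((\<lambda>r. dird f (0, v) ((a, a) + r *\<^sub>R (0, v))) has_vector_derivative
          hess2 f v v ((a, a) + r *\<^sub>R (0, v))) (at r)"
        using z by (intro has_vector_derivative_line df1) blast
      show "((\<lambda>r. hess2 f v v ((a, a) + r *\<^sub>R (0, v))) has_vector_derivative
          dird (hess2 f v v) (0, v) ((a, a) + r *\<^sub>R (0, v))) (at r)"
        using z by (intro has_vector_derivative_line df2) blast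
      have "norm (dird (hess2 f v v) (0, v) ((a, a) + r *\<^sub>R (0, v)))
          \<le> N3 ((a, a) + r *\<^sub>R (0, v)) * (norm v * (norm v * norm v))"
        using N3(2) z by blast
      also have "\<dots> \<le> K * (norm v * (norm v * norm v))"
        using z by (intro mult_right_mono) auto
      finally show "norm (dird (hess2 f v v) (0, v) ((a, a) + r *\<^sub>R (0, v))) \<le> K * norm v ^ 3"
        by (simp add: power3_eq_cube mult.assoc)
    qed
    then show ?thesis by (simp add: v_def)
  qed
  moreover have "(a, b) \<in> S" if "dist a a0 < d / 2" "dist b a0 < d / 2" for a b
    using d(2)[OF near[OF that]] by blast
  moreover have "norm (hess2 f u v (a, a)) \<le> K * (norm u * norm v)" if "dist a a0 < d / 2" for a u v
  proof -
    have z: "(a, a) \<in> S" "N2 (a, a) \<le> K"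
      using d(2)[OF near[OF that that]] by auto
    then have "norm (hess2 f u v (a, a)) \<le> N2 (a, a) * (norm u * norm v)"
      using N2(2) by blast
    also have "\<dots> \<le> K * (norm u * norm v)"
      using z by (intro mult_right_mono) auto
    finally show ?thesis .
  qed
  ultimately show thesis
    using \<open>d > 0\<close> \<open>K \<ge> 0\<close> by (intro that[of "d / 2" K]) simp_all
qed

section \<open>Logarithms and parallelisms in a chart\<close>

lemma has_derivative_partial_snd:
  assumes "f differentiable (at (a, b))"
  shows "((\<lambda>b. f (a, b)) has_derivative (\<lambda>v. dird f (0, v) (a, b))) (at b)"
  by (rule has_derivative_compose[where f = "\<lambda>b. (a, b)" and f' = "\<lambda>v. (0, v)" and x = b and s = UNIV
        and g = f and g' = "\<lambda>v. dird f v (a, b)", OF _ has_derivative_dird[OF assms]])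
    (auto intro!: derivative_eq_intros)

lemma has_derivative_partial_fst:
  assumes "f differentiable (at (a, b))"
  shows "((\<lambda>a. f (a, b)) has_derivative (\<lambda>v. dird f (v, 0) (a, b))) (at a)"
  by (rule has_derivative_compose[where f = "\<lambda>a. (a, b)" and f' = "\<lambda>v. (v, 0)" and x = a and s = UNIV
        and g = f and g' = "\<lambda>v. dird f v (a, b)", OF _ has_derivative_dird[OF assms]])
    (auto intro!: derivative_eq_intros)

lemma has_derivative_diagonal:
  assumes "f differentiable (at (a, a))"
  shows "((\<lambda>a. f (a, a)) has_derivative (\<lambda>v. dird f (v, v) (a, a))) (at a)"
  by (rule has_derivative_compose[where f = "\<lambda>a. (a, a)" and f' = "\<lambda>v. (v, v)" and x = a and s = UNIV
        and g = f and g' = "\<lambda>v. dird f v (a, a)", OF _ has_derivative_dird[OF assms]])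
    (auto intro!: derivative_eq_intros)

definition coord_domain :: "('m, 'e) chart \<Rightarrow> ('m \<times> 'm) set \<Rightarrow> ('e \<times> 'e) set"
where "coord_domain c D = {(a, b). a \<in> crange c \<and> b \<in> crange c \<and> (cinv c a, cinv c b) \<in> D}"

locale manifold =
  fixes A :: "('m::{t2_space, second_countable_topology}, 'e::real_normed_vector) chart set"
  assumes manifold: "smooth_manifold A"
begin

text \<open>This is the expression whose smoothness \<open>logarithm\<close> demands, with one chart
  used in both slots; \<open>Ck_on_log_coord\<close> is then a matter of unfolding.\<close>

definition log_coord :: "('m, 'e) chart \<Rightarrow> ('m \<Rightarrow> 'm \<Rightarrow> 'e) \<Rightarrow> 'e \<times> 'e \<Rightarrow> 'e"
where "log_coord c \<psi> = (\<lambda>(a, b). blinfun_apply (to_coord A c (cinv c a)) (\<psi> (cinv c a) (cinv c b)))"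

text \<open>Two charts are kept because the transport that bounds \<alpha> ends at a point
  \<open>y t1\<close> which may lie outside the chart around \<open>y t0\<close>.\<close>

definition par_coord ::
  "('m, 'e) chart \<Rightarrow> ('m, 'e) chart \<Rightarrow> ('m \<Rightarrow> 'm \<Rightarrow> 'e \<Rightarrow>\<^sub>L 'e) \<Rightarrow> 'e \<times> 'e \<Rightarrow> 'e \<Rightarrow>\<^sub>L 'e"
where "par_coord c c' U = (\<lambda>(a, b). to_coord A c (cinv c a) o\<^sub>L U (cinv c a) (cinv c' b)
                        o\<^sub>L from_coord A c' (cinv c' b))"

lemma finite_span: obtains B :: "'e set" where "finite B" "span B = UNIV"
  using manifold unfolding smooth_manifold_def by blast

lemma chart_at: "chart_at A m \<in> A" "m \<in> cdom (chart_at A m)"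
proof -
  have "\<exists>c. c \<in> A \<and> m \<in> cdom c"
    using manifold unfolding smooth_manifold_def by blast
  from someI_ex[OF this] show "chart_at A m \<in> A" "m \<in> cdom (chart_at A m)"
    by (auto simp: chart_at_def)
qed

lemma is_chart: "c \<in> A \<Longrightarrow> is_chart c"
  using manifold unfolding smooth_manifold_def by blast

lemma open_cdom: "c \<in> A \<Longrightarrow> open (cdom c)"
  and open_crange: "c \<in> A \<Longrightarrow> open (crange c)"
  and continuous_on_cmap: "c \<in> A \<Longrightarrow> continuous_on (cdom c) (cmap c)"
  and continuous_on_cinv: "c \<in> A \<Longrightarrow> continuous_on (crange c) (cinv c)"
  and cinv_cmap: "c \<in> A \<Longrightarrow> m \<in> cdom c \<Longrightarrow> cinv c (cmap c m) = m"
  using is_chart unfolding is_chart_def homeomorphism_def by blast+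

lemma cmap_cinv: "a \<in> crange c \<Longrightarrow> cmap c (cinv c a) = a"
  and cinv_in_cdom: "a \<in> crange c \<Longrightarrow> cinv c a \<in> cdom c"
  by (auto intro: f_inv_into_f inv_into_into)

lemma open_overlap:
  assumes "c \<in> A" "c' \<in> A"
  shows "open (cmap c ` (cdom c \<inter> cdom c'))"
proof -
  have "cmap c ` (cdom c \<inter> cdom c') = crange c \<inter> cinv c -` cdom c'"
    using cinv_cmap[OF assms(1)] by (auto simp: cinv_in_cdom cmap_cinv image_iff intro!: bexI)
  then show ?thesis
    using continuous_open_preimage[OF continuous_on_cinv open_crange open_cdom] assms by simp
qed

lemma transition_has_derivative:
  assumes "c \<in> A" "c' \<in> A" "m \<in> cdom c" "m \<in> cdom c'"
  shows "((cmap c' \<circ> cinv c) has_derivative blinfun_apply (coord_change c c' m)) (at (cmap c m))"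
proof -
  have "Ck_on (Suc 0) (cmap c ` (cdom c \<inter> cdom c')) (cmap c' \<circ> cinv c)"
    using manifold assms(1,2) unfolding smooth_manifold_def smooth_on_def by blast
  then have "(cmap c' \<circ> cinv c) differentiable (at (cmap c m))"
    by (rule Ck_on_differentiable) (use assms in blast)
  then have d: "((cmap c' \<circ> cinv c) has_derivative
      frechet_derivative (cmap c' \<circ> cinv c) (at (cmap c m))) (at (cmap c m))"
    using frechet_derivative_works by blast
  then show ?thesis
    by (simp add: coord_change_def bounded_linear_Blinfun_apply[OF has_derivative_bounded_linear])
qed

lemma has_derivative_change_chart:
  assumes "c \<in> A" "c' \<in> A" "m \<in> cdom c" "m \<in> cdom c'"
    and f: "((f \<circ> cinv c) has_derivative L) (at (cmap c m))"
  shows "((f \<circ> cinv c') has_derivative (\<lambda>v. L (blinfun_apply (coord_change c' c m) v))) (at (cmap c' m))"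
proof -
  have "((\<lambda>b. (f \<circ> cinv c) ((cmap c \<circ> cinv c') b)) has_derivative
      (\<lambda>v. L (blinfun_apply (coord_change c' c m) v))) (at (cmap c' m))"
    by (rule has_derivative_compose[OF transition_has_derivative])
      (use assms in \<open>simp_all add: cinv_cmap o_def\<close>)
  then show ?thesis
  proof (rule has_derivative_transform_within_open[OF _ open_overlap[OF assms(2,1)]])
    show "cmap c' m \<in> cmap c' ` (cdom c' \<inter> cdom c)" using assms by blast
    fix b assume "b \<in> cmap c' ` (cdom c' \<inter> cdom c)"
    then show "(f \<circ> cinv c) ((cmap c \<circ> cinv c') b) = (f \<circ> cinv c') b"
      using cinv_cmap assms(1,2) by auto
  qed
qed

text \<open>Both sides are the derivative at \<open>cmap c m\<close> of the same transition map,
  once through the chain rule and once directly.\<close>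

lemma coord_change_trans:
  assumes "c \<in> A" "c' \<in> A" "c'' \<in> A" "m \<in> cdom c" "m \<in> cdom c'" "m \<in> cdom c''"
  shows "blinfun_apply (coord_change c' c'' m) (blinfun_apply (coord_change c c' m) v)
       = blinfun_apply (coord_change c c'' m) v"
proof -
  note 1 = transition_has_derivative[OF assms(2,3,5,6)]
  have "((cmap c'' \<circ> cinv c) has_derivative
      (\<lambda>v. blinfun_apply (coord_change c' c'' m) (blinfun_apply (coord_change c c' m) v))) (at (cmap c m))"
    by (rule has_derivative_change_chart[OF assms(2,1,5,4) 1])
  from has_derivative_unique[OF this transition_has_derivative[OF assms(1,3,4,6)]] show ?thesis
    by metis
qed

lemma coord_change_self:
  assumes "c \<in> A" "m \<in> cdom c"
  shows "coord_change c c m = id_blinfun"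
proof -
  have "((cmap c \<circ> cinv c) has_derivative (\<lambda>v. v)) (at (cmap c m))"
    by (rule has_derivative_transform_within_open[OF has_derivative_ident open_crange[OF assms(1)]])
      (use assms in \<open>auto simp: cmap_cinv cinv_cmap\<close>)
  from has_derivative_unique[OF transition_has_derivative[OF assms(1,1,2,2)] this]
  show ?thesis by (intro blinfun_eqI) simp
qed

lemma from_to_coord:
  assumes "c \<in> A" "m \<in> cdom c"
  shows "blinfun_apply (from_coord A c m) (blinfun_apply (to_coord A c m) v) = v"
    and "blinfun_apply (to_coord A c m) (blinfun_apply (from_coord A c m) v) = v"
  using assms chart_at[of m] by (simp_all add: coord_change_trans coord_change_self)

lemma mdiff_coord:
  assumes "c \<in> A" "m \<in> cdom c" "((f \<circ> cinv c) has_derivative L) (at (cmap c m))"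
  shows "mdiff A f m v = L (blinfun_apply (to_coord A c m) v)"
proof -
  note has_derivative_change_chart[OF assms(1) chart_at(1) assms(2) chart_at(2) assms(3)]
  from frechet_derivative_at[OF this] show ?thesis
    unfolding mdiff_def by metis
qed

lemma has_mdiff_at_coord:
  assumes "c \<in> A" "m \<in> cdom c" "has_mdiff_at A f m L"
  shows "((f \<circ> cinv c) has_derivative (\<lambda>v. L (blinfun_apply (from_coord A c m) v))) (at (cmap c m))"
  using has_derivative_change_chart[OF chart_at(1) assms(1) chart_at(2) assms(2)] assms(3)
  unfolding has_mdiff_at_def .

lemma open_coord_domain:
  assumes "c \<in> A" "open D"
  shows "open (coord_domain c D)"
proof -
  have "continuous_on (crange c \<times> crange c) (\<lambda>z. (cinv c (fst z), cinv c (snd z)))"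
    by (intro continuous_on_Pair continuous_on_compose2[OF continuous_on_cinv[OF assms(1)]]
        continuous_intros) auto
  from continuous_open_preimage[OF this open_Times[OF open_crange open_crange, OF assms(1,1)] assms(2)]
  have "open ((crange c \<times> crange c) \<inter> (\<lambda>z. (cinv c (fst z), cinv c (snd z))) -` D)" .
  moreover have "(crange c \<times> crange c) \<inter> (\<lambda>z. (cinv c (fst z), cinv c (snd z))) -` D = coord_domain c D"
    by (auto simp: coord_domain_def)
  ultimately show ?thesis by simp
qed

lemma coord_domain_cmap:
  "c \<in> A \<Longrightarrow> n \<in> cdom c \<Longrightarrow> m \<in> cdom c \<Longrightarrow> (cmap c n, cmap c m) \<in> coord_domain c D \<longleftrightarrow> (n, m) \<in> D"
  by (simp add: coord_domain_def cinv_cmap)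

lemma coord_domain_diagonal:
  "diagonal_domain D \<Longrightarrow> a \<in> crange c \<Longrightarrow> (a, a) \<in> coord_domain c D"
  by (auto simp: coord_domain_def diagonal_domain_def)

section \<open>Logarithm and compatibility tensor in one chart\<close>

context
  fixes c D \<psi>
  assumes c: "c \<in> A" and log: "logarithm A D \<psi>"
begin

lemma log_domain: "diagonal_domain D" "open D"
  using log unfolding logarithm_def diagonal_domain_def by blast+

lemma Ck_on_log_coord: "Ck_on k (coord_domain c D) (log_coord c \<psi>)"
  using log c unfolding logarithm_def smooth_on_def coord_domain_def log_coord_def by blast

lemma log_coord_differentiable:
  "z \<in> coord_domain c D \<Longrightarrow> log_coord c \<psi> differentiable (at z)"
  "z \<in> coord_domain c D \<Longrightarrow> dird (log_coord c \<psi>) v differentiable (at z)"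
  using Ck_on_differentiable Ck_on_log_coord Ck_on_dird by blast+

lemma log_coord_diagonal: "log_coord c \<psi> (a, a) = 0"
  using log unfolding logarithm_def log_coord_def by (simp add: blinfun.zero_right)

lemma log_coord_cmap:
  "n \<in> cdom c \<Longrightarrow> m \<in> cdom c \<Longrightarrow>
    log_coord c \<psi> (cmap c n, cmap c m) = blinfun_apply (to_coord A c n) (\<psi> n m)"
  by (simp add: log_coord_def cinv_cmap[OF c])

text \<open>With the first argument frozen at \<open>a\<close>, the factor \<open>to_coord\<close>
  is a constant linear map. It conjugates the normalisation of the logarithm, whose differential is
  the identity, into the identity of \<open>'e\<close>.\<close>

lemma dird_log_coord_diagonal:
  assumes a: "a \<in> crange c"
  shows "dird (log_coord c \<psi>) (0, v) (a, a) = v"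
proof -
  define m where "m = cinv c a"
  have m: "m \<in> cdom c" "cmap c m = a" using a by (simp_all add: m_def cinv_in_cdom cmap_cinv)
  have "has_mdiff_at A (\<psi> m) m id"
    using log unfolding logarithm_def by blast
  from bounded_linear.has_derivative[OF blinfun.bounded_linear_right has_mdiff_at_coord[OF c m(1) this],
      of "to_coord A c m"]
  have "((\<lambda>b. log_coord c \<psi> (a, b)) has_derivative (\<lambda>v. v)) (at a)"
    by (simp add: log_coord_def m(2) from_to_coord[OF c m(1)] flip: m_def)
  from has_derivative_unique[OF has_derivative_partial_snd[OF log_coord_differentiable(1)
        [OF coord_domain_diagonal[OF log_domain(1) a]]] this] show ?thesis
    by (rule fun_cong)
qed

text \<open>Differentiating \<open>\<partial>\<^sub>2\<psi>(a, a) = id\<close> along the diagonal trades the mixed second derivative of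
  the logarithm for its Hessian in the second argument.\<close>

lemma mixed_derivative_log_coord:
  assumes a: "a \<in> crange c"
  shows "dird (dird (log_coord c \<psi>) (0, w)) (v, 0) (a, a) = - hess2 (log_coord c \<psi>) w v (a, a)"
proof -
  have "((\<lambda>a. dird (log_coord c \<psi>) (0, w) (a, a)) has_derivative (\<lambda>v. 0)) (at a)"
    by (rule has_derivative_transform_within_open[OF has_derivative_const open_crange[OF c] a])
      (simp add: dird_log_coord_diagonal)
  moreover note d = log_coord_differentiable(2)[OF coord_domain_diagonal[OF log_domain(1) a], of "(0, w)"]
  ultimately have "dird (dird (log_coord c \<psi>) (0, w)) (v, v) (a, a) = 0"
    using fun_cong[OF has_derivative_unique[OF has_derivative_diagonal[OF d]]] by blast
  moreover have "dird (dird (log_coord c \<psi>) (0, w)) ((v, 0) + (0, v)) (a, a) =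
      dird (dird (log_coord c \<psi>) (0, w)) (v, 0) (a, a) + hess2 (log_coord c \<psi>) w v (a, a)"
    by (rule linear_add[OF linear_dird[OF d]])
  ultimately show ?thesis by (simp add: eq_neg_iff_add_eq_0)
qed

lemma hess2_log_coord_sym:
  assumes a: "a \<in> crange c"
  shows "hess2 (log_coord c \<psi>) v w (a, a) = hess2 (log_coord c \<psi>) w v (a, a)"
  using dird_swap[OF open_coord_domain[OF c log_domain(2)] coord_domain_diagonal[OF log_domain(1) a]
      Ck_on_log_coord] .

lemma linear_hess2_log_coord:
  assumes a: "a \<in> crange c"
  shows "linear (\<lambda>v. hess2 (log_coord c \<psi>) v w (a, a))" "linear (\<lambda>v. hess2 (log_coord c \<psi>) w v (a, a))"
proof -
  have "linear (\<lambda>v::'e. (0::'e, v))" by (intro linearI) auto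
  from linear_compose[OF this linear_dird[OF log_coord_differentiable(2)
        [OF coord_domain_diagonal[OF log_domain(1) a], of "(0, w)"]]]
  show "linear (\<lambda>v. hess2 (log_coord c \<psi>) w v (a, a))" by (simp add: o_def)
  then show "linear (\<lambda>v. hess2 (log_coord c \<psi>) v w (a, a))"
    by (simp add: hess2_log_coord_sym[OF a, of _ w])
qed

lemma log_parallelism_coord:
  assumes "n \<in> cdom c" "m \<in> cdom c" "(n, m) \<in> D"
  shows "blinfun_apply (log_parallelism A \<psi> n m) w =
    blinfun_apply (from_coord A c n)
      (dird (log_coord c \<psi>) (0, blinfun_apply (to_coord A c m) w) (cmap c n, cmap c m))"
proof -
  let ?L = "\<lambda>v. blinfun_apply (from_coord A c n) (dird (log_coord c \<psi>) (0, v) (cmap c n, cmap c m))"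
  have "(cmap c n, cmap c m) \<in> coord_domain c D"
    using assms coord_domain_cmap[OF c] by blast
  note has_derivative_partial_snd[OF log_coord_differentiable(1)[OF this]]
  from bounded_linear.has_derivative[OF blinfun.bounded_linear_right this, of "from_coord A c n"]
  have d: "((\<lambda>b. blinfun_apply (from_coord A c n) (log_coord c \<psi> (cmap c n, b))) has_derivative ?L)
      (at (cmap c m))" .
  have "((\<psi> n \<circ> cinv c) has_derivative ?L) (at (cmap c m))"
    by (rule has_derivative_transform_within_open[OF d open_crange[OF c]])
      (use assms in \<open>auto simp: log_coord_def cinv_cmap[OF c] from_to_coord[OF c]\<close>)
  note mdiff_coord[OF c assms(2) this]
  then have "mdiff A (\<psi> n) m = (\<lambda>w. ?L (blinfun_apply (to_coord A c m) w))" by blast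
  \<comment> \<open>\<open>Blinfun\<close> has the intended value only on bounded linear maps, so
    the differential must be shown to be one.\<close>
  moreover have "bounded_linear (\<lambda>w. ?L (blinfun_apply (to_coord A c m) w))"
    using bounded_linear_compose[OF has_derivative_bounded_linear[OF d] blinfun.bounded_linear_right] .
  ultimately show ?thesis
    unfolding log_parallelism_def by (simp add: bounded_linear_Blinfun_apply)
qed

text \<open>In the chart the differentiated function is W(a)^{-1} P(a), where W is the parallelism
  and P the second partial derivative of the logarithm, both with second argument b. The derivative
  of P along the first slot is the mixed derivative, that is, minus the Hessian; the derivative of W
  is the part that depends on \<open>U\<close> alone.\<close>

lemma gauge_compat_coord:
  assumes U: "parallelism A D U" and m: "m \<in> cdom c"
  defines "b \<equiv> cmap c m"
  shows "blinfun_apply (to_coord A c m) (gauge_compat A \<psi> U m v w) =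
      - hess2 (log_coord c \<psi>) (blinfun_apply (to_coord A c m) w) (blinfun_apply (to_coord A c m) v) (b, b)
      - blinfun_apply (dird (par_coord c c U) (blinfun_apply (to_coord A c m) v, 0) (b, b))
          (blinfun_apply (to_coord A c m) w)"
proof -
  obtain B :: "'e set" where B: "finite B" "span B = UNIV" by (rule finite_span)
  let ?u = "blinfun_apply (to_coord A c m) w"
  define W where "W a = par_coord c c U (a, b)" for a
  define P where "P a = dird (log_coord c \<psi>) (0, ?u) (a, b)" for a
  have b: "b \<in> crange c" "cinv c b = m"
    using m by (simp_all add: b_def cinv_cmap[OF c])
  note bb = coord_domain_diagonal[OF log_domain(1) b(1)]
  have "Ck_on (Suc 0) (coord_domain c D) (par_coord c c U)"
    using U c unfolding parallelism_def smooth_on_def coord_domain_def par_coord_def by blast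
  then have "par_coord c c U differentiable (at (b, b))"
    using bb by (rule Ck_on_differentiable)
  then have W: "(W has_derivative (\<lambda>v. dird (par_coord c c U) (v, 0) (b, b))) (at b)"
    unfolding W_def[abs_def] by (rule has_derivative_partial_fst)
  have "U m m = id_blinfun" using U unfolding parallelism_def by blast
  then have Wb: "W b = id_blinfun"
    unfolding W_def par_coord_def by (intro blinfun_eqI) (simp add: b from_to_coord[OF c m])
  have P: "(P has_derivative (\<lambda>v. - hess2 (log_coord c \<psi>) ?u v (b, b))) (at b)"
    using has_derivative_partial_fst[OF log_coord_differentiable(2)[OF bb, of "(0, ?u)"]]
    unfolding P_def[abs_def] by (simp add: mixed_derivative_log_coord[OF b(1)])
  have Pb: "P b = ?u" unfolding P_def by (rule dird_log_coord_diagonal[OF b(1)])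
  define R where "R v = - hess2 (log_coord c \<psi>) ?u v (b, b)
      - blinfun_apply (dird (par_coord c c U) (v, 0) (b, b)) ?u" for v
  have "((\<lambda>a. inv (blinfun_apply (W a)) (P a)) has_derivative R) (at b)"
    using has_derivative_inv_blinfun_apply[OF B W Wb P] unfolding Pb R_def[abs_def] .
  from bounded_linear.has_derivative[OF blinfun.bounded_linear_right this, of "from_coord A c m"]
  have d: "((\<lambda>a. blinfun_apply (from_coord A c m) (inv (blinfun_apply (W a)) (P a))) has_derivative
      (\<lambda>v. blinfun_apply (from_coord A c m) (R v))) (at b)" .
  have "isCont W b" using W has_derivative_continuous by blast
  then have "\<forall>\<^sub>F a in at b. dist (W a) (W b) < 1 / 2"
    by (intro tendstoD[OF isContD]) simp_all
  then have "\<forall>\<^sub>F a in at b. norm (W a - id_blinfun) \<le> 1 / 2"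
    by (rule eventually_mono) (simp add: Wb dist_norm)
  moreover have "\<forall>\<^sub>F a in at b. (a, b) \<in> coord_domain c D"
  proof -
    have "isCont (\<lambda>a. (a, b)) b" by simp
    from topological_tendstoD[OF this[unfolded isCont_def] open_coord_domain[OF c log_domain(2)] bb]
    show ?thesis .
  qed
  \<comment> \<open>Near b the map \<open>W a\<close> is bijective, hence so is \<open>U n m\<close>
    between the two coordinate changes, and the \<open>inv\<close> in \<open>compat\<close> is a
    genuine inverse there.\<close>
  ultimately have ev: "\<forall>\<^sub>F a in at b. blinfun_apply (from_coord A c m) (inv (blinfun_apply (W a)) (P a)) =
      ((\<lambda>n. inv (blinfun_apply (U n m)) (blinfun_apply (log_parallelism A \<psi> n m) w)) \<circ> cinv c) a"
  proof eventually_elim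
    case (elim a)
    define n where "n = cinv c a"
    have n: "n \<in> cdom c" "cmap c n = a" "(n, m) \<in> D"
      using elim(2) b(2) unfolding coord_domain_def n_def by (auto simp: cinv_in_cdom cmap_cinv)
    have bij: "bij (blinfun_apply (W a))" by (rule blinfun_near_id_bij[OF B elim(1)])
    have U_eq: "blinfun_apply (U n m) u =
        blinfun_apply (from_coord A c n) (blinfun_apply (W a) (blinfun_apply (to_coord A c m) u))" for u
      unfolding W_def par_coord_def by (simp add: b n_def[symmetric] from_to_coord[OF c] m n)
    have "inj (blinfun_apply (U n m))"
      by (rule injI) (metis U_eq bij bij_is_inj from_to_coord[OF c] injD m n(1))
    moreover have "blinfun_apply (U n m) (blinfun_apply (from_coord A c m) (inv (blinfun_apply (W a)) (P a)))
        = blinfun_apply (log_parallelism A \<psi> n m) w"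
      unfolding U_eq log_parallelism_coord[OF n(1) m n(3)]
      using bij by (simp add: from_to_coord[OF c m] bij_is_surj surj_f_inv_f P_def n(2) b_def)
    ultimately show ?case
      by (simp add: inv_f_eq n_def[symmetric])
  qed
  have "((\<lambda>n. inv (blinfun_apply (U n m)) (blinfun_apply (log_parallelism A \<psi> n m) w)) \<circ> cinv c
      has_derivative (\<lambda>v. blinfun_apply (from_coord A c m) (R v))) (at b)"
  proof (rule has_derivative_transform_eventually[OF d ev])
    \<comment> \<open>The filter \<open>at b\<close> leaves out b, so the values at b are compared
      separately.\<close>
    show "blinfun_apply (from_coord A c m) (inv (blinfun_apply (W b)) (P b)) =
      ((\<lambda>n. inv (blinfun_apply (U n m)) (blinfun_apply (log_parallelism A \<psi> n m) w)) \<circ> cinv c) b"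
      using Pb Wb \<open>U m m = id_blinfun\<close> log_domain(1) m
      by (simp add: b inv_f_eq log_parallelism_coord[OF m m] diagonal_domain_def
          dird_log_coord_diagonal b_def[symmetric])
  qed simp
  from mdiff_coord[OF c m this[unfolded b_def]] show ?thesis
    unfolding gauge_compat_def compat_def by (simp add: from_to_coord[OF c m] R_def b_def)
qed

end

end

section \<open>Estimates for tensors and Riemannian norms\<close>

text \<open>A Lebesgue number argument: cover \<open>{0..T}\<close> by finitely many intervals of
  half the local radius. If s lies in one of them and t - s is at most every half radius of the
  finite cover, then s and t both lie in the full interval. Nonnegativity of w allows passing to the
  largest constant.\<close>

lemma uniform_of_local_estimate:
  fixes f w :: "real \<Rightarrow> real \<Rightarrow> real"
  assumes local: "\<forall>t0\<in>{0..T}. \<exists>\<epsilon>>0. \<exists>C. \<forall>s t. 0 \<le> s \<and> s \<le> t \<and> t \<le> T \<and> \<bar>s - t0\<bar> < \<epsilon> \<and> \<bar>t - t0\<bar> < \<epsilon> \<longrightarrow>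
      P s t \<and> f s t \<le> C * w s t"
    and w: "\<And>s t. 0 \<le> s \<Longrightarrow> s \<le> t \<Longrightarrow> t \<le> T \<Longrightarrow> 0 \<le> w s t"
  shows "\<exists>C. \<exists>\<delta>>0. \<forall>s t. 0 \<le> s \<and> s \<le> t \<and> t \<le> T \<and> t - s \<le> \<delta> \<longrightarrow> P s t \<and> f s t \<le> C * w s t"
proof -
  obtain \<epsilon> C where \<epsilon>: "\<And>t0. t0 \<in> {0..T} \<Longrightarrow> 0 < \<epsilon> t0"
    and C: "\<And>t0 s t. t0 \<in> {0..T} \<Longrightarrow> 0 \<le> s \<and> s \<le> t \<and> t \<le> T \<and> \<bar>s - t0\<bar> < \<epsilon> t0 \<and> \<bar>t - t0\<bar> < \<epsilon> t0 \<Longrightarrow>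
      P s t \<and> f s t \<le> C t0 * w s t"
    using local by metis
  obtain F where F: "finite F" "F \<subseteq> {0..T}" "{0..T} \<subseteq> (\<Union>t0\<in>F. ball t0 (\<epsilon> t0 / 2))"
  proof (rule compactE_image[OF compact_Icc[of 0 T], of "{0..T}" "\<lambda>t0. ball t0 (\<epsilon> t0 / 2)"])
    show "{0..T} \<subseteq> (\<Union>t0\<in>{0..T}. ball t0 (\<epsilon> t0 / 2))"
      using \<epsilon> by fastforce
  qed auto
  \<comment> \<open>The inserted 1 keeps the set nonempty even if \<open>F\<close> is empty.\<close>
  define \<delta> where "\<delta> = Min (insert 1 ((\<lambda>t0. \<epsilon> t0 / 2) ` F))"
  have \<delta>: "\<delta> > 0" "\<And>t0. t0 \<in> F \<Longrightarrow> \<delta> \<le> \<epsilon> t0 / 2"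
  proof -
    have "\<forall>t0\<in>F. \<epsilon> t0 > 0" using F(2) \<epsilon> by blast
    then show "\<delta> > 0" unfolding \<delta>_def using F(1) by (subst Min_gr_iff) auto
    show "\<delta> \<le> \<epsilon> t0 / 2" if "t0 \<in> F" for t0
      unfolding \<delta>_def using F(1) that by (intro Min_le) auto
  qed
  have C_le: "C t0 \<le> Max (C ` F)" if "t0 \<in> F" for t0
    using F(1) that by simp
  have "P s t \<and> f s t \<le> Max (C ` F) * w s t" if st: "0 \<le> s \<and> s \<le> t \<and> t \<le> T \<and> t - s \<le> \<delta>" for s t
  proof -
    have "s \<in> {0..T}" using st by auto
    then obtain t0 where t0: "t0 \<in> F" "\<bar>s - t0\<bar> < \<epsilon> t0 / 2"
      using F(3) by (auto simp: dist_real_def abs_minus_commute)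
    with \<delta>(2)[OF t0(1)] st have "\<bar>s - t0\<bar> < \<epsilon> t0" "\<bar>t - t0\<bar> < \<epsilon> t0"
      by linarith+
    with st t0(1) F(2) have "P s t \<and> f s t \<le> C t0 * w s t"
      by (intro C) auto
    moreover have "C t0 * w s t \<le> Max (C ` F) * w s t"
      using w st C_le[OF t0(1)] by (intro mult_right_mono) auto
    ultimately show ?thesis by linarith
  qed
  with \<delta>(1) show ?thesis by blast
qed

lemma continuous_on_imp_locally_bounded:
  fixes f :: "'a::metric_space \<Rightarrow> 'b::real_normed_vector"
  assumes "continuous_on S f" "x0 \<in> S"
  obtains \<epsilon> where "\<epsilon> > 0" "\<And>x. x \<in> S \<Longrightarrow> dist x x0 < \<epsilon> \<Longrightarrow> norm (f x) \<le> norm (f x0) + 1"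
proof -
  obtain \<epsilon> where \<epsilon>: "\<epsilon> > 0" "\<And>x. x \<in> S \<Longrightarrow> dist x x0 < \<epsilon> \<Longrightarrow> dist (f x) (f x0) < 1"
    using assms unfolding continuous_on_iff by (metis zero_less_one)
  have "norm (f x) \<le> norm (f x0) + 1" if "x \<in> S" "dist x x0 < \<epsilon>" for x
    using \<epsilon>(2)[OF that] norm_triangle_ineq2[of "f x" "f x0"] by (simp add: dist_norm)
  with \<epsilon>(1) that show thesis by blast
qed

text \<open>A supremum of reals is informative only for a set bounded above. The comparison
  \<open>l\<close> with the given norm bounds the unit ball of \<open>N\<close>, hence the values of
  F on it; homogeneity then gives the estimate for all v.\<close>

lemma norm_le_op_norm:
  assumes F: "bounded_linear F" and N: "\<And>r v. N (r *\<^sub>R v) = \<bar>r\<bar> * N v"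
    and l: "l > 0" "\<And>v. l * norm v \<le> N v"
  shows "norm (F v) \<le> op_norm N norm F * N v"
proof (cases "v = 0")
  case True
  then show ?thesis using F N[of 0 0] by (simp add: linear_simps)
next
  case False
  obtain K where K: "\<And>v. norm (F v) \<le> norm v * K" "K > 0"
    using bounded_linear.pos_bounded[OF F] by blast
  have "N v > 0" using l(1) l(2)[of v] False by (smt (verit) mult_pos_pos zero_less_norm_iff)
  have "bdd_above ((\<lambda>v. norm (F v)) ` {v. N v \<le> 1})"
  proof (rule bdd_aboveI2)
    fix v assume "v \<in> {v. N v \<le> 1}"
    then have "l * norm v \<le> 1" using l(2)[of v] by simp
    then have "norm v \<le> 1 / l" using l(1) by (simp add: field_simps)
    then show "norm (F v) \<le> 1 / l * K"
      using K by (meson less_imp_le mult_right_mono order_trans)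
  qed
  moreover have "(1 / N v) *\<^sub>R v \<in> {v. N v \<le> 1}"
    using \<open>N v > 0\<close> by (simp add: N)
  ultimately have "norm (F ((1 / N v) *\<^sub>R v)) \<le> op_norm N norm F"
    unfolding op_norm_def by (rule cSUP_upper[rotated])
  then show ?thesis
    using \<open>N v > 0\<close> F by (simp add: linear_simps field_simps)
qed

lemma norm_tens: "norm (tens w v) = norm w * norm v" for w :: "real^'k" and v :: "'a::real_normed_vector"
  by (simp add: tens_def norm_vec_def L2_set_left_distrib)

lemma tens_norm_tens:
  fixes w :: "real^'k"
  assumes "bilinear (g m)" "0 \<le> g m v v"
  shows "tens_norm g m (tens w v) = norm w * tnorm g m v"
proof -
  have "tens_norm g m (tens w v) = sqrt (\<Sum>i\<in>UNIV. (w $ i)\<^sup>2 * g m v v)"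
    using assms(1) by (simp add: tens_norm_def tens_def bilinear_lmul bilinear_rmul power2_eq_square mult.assoc)
  also have "\<dots> = sqrt (\<Sum>i\<in>UNIV. (w $ i)\<^sup>2) * tnorm g m v"
    by (simp add: tnorm_def real_sqrt_mult flip: sum_distrib_right)
  finally show ?thesis by (simp add: norm_vec_def L2_set_def)
qed

lemma id_tens_tens: "linear L \<Longrightarrow> id_tens L (tens w v) = tens w (L v)"
  by (simp add: id_tens_def tens_def linear_scale)

text \<open>A symmetric bilinear map sees only the symmetric part of X, and the weak geometric
  condition fixes this part as half the tensor square of x. Here the second level of the rough path
  turns into a quadratic term in its increment.\<close>

lemma bilin_tens_sym:
  fixes X :: "real^'k^'k" and Q :: "'a::real_vector \<Rightarrow> 'a \<Rightarrow> 'b::real_vector"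
  assumes X: "(1 / 2) *\<^sub>R (X + transpose X) = (1 / 2) *\<^sub>R tens x x"
    and Q: "\<And>v. linear (\<lambda>u. Q u v)" "\<And>u. linear (Q u)" "\<And>u v. Q u v = Q v u"
    and L: "linear L"
  shows "bilin_tens Q L X = (1 / 2) *\<^sub>R Q (L x) (L x)"
proof -
  let ?q = "\<lambda>i j. Q (L (axis i 1)) (L (axis j 1))"
  have X_sym: "X $ i $ j + X $ j $ i = x $ i * x $ j" for i j
  proof -
    have "(1 / 2) * (X $ i $ j + X $ j $ i) = (1 / 2) * (x $ i * x $ j)"
      using arg_cong[OF X, of "\<lambda>Y. Y $ i $ j"] by (simp add: transpose_def tens_def)
    then show ?thesis by simp
  qed
  have Lx: "L x = (\<Sum>i\<in>UNIV. x $ i *\<^sub>R L (axis i 1))"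
  proof -
    have "L x = L (\<Sum>i\<in>UNIV. x $ i *\<^sub>R axis i 1)"
      by (metis basis_expansion scalar_mult_eq_scaleR)
    then show ?thesis using L by (simp add: linear_sum linear_scale)
  qed
  have "Q (L x) (L x) = (\<Sum>i\<in>UNIV. \<Sum>j\<in>UNIV. (x $ i * x $ j) *\<^sub>R ?q i j)"
    unfolding Lx by (simp add: linear_sum[OF Q(1)] linear_scale[OF Q(1)] linear_sum[OF Q(2)]
        linear_scale[OF Q(2)] scaleR_sum_right) (subst sum.swap, simp add: mult.commute)
  also have "\<dots> = (\<Sum>i\<in>UNIV. \<Sum>j\<in>UNIV. (X $ i $ j) *\<^sub>R ?q i j) + (\<Sum>i\<in>UNIV. \<Sum>j\<in>UNIV. (X $ j $ i) *\<^sub>R ?q i j)"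
    by (simp add: X_sym[symmetric] scaleR_add_left sum.distrib)
  also have "(\<Sum>i\<in>UNIV. \<Sum>j\<in>UNIV. (X $ j $ i) *\<^sub>R ?q i j) = (\<Sum>i\<in>UNIV. \<Sum>j\<in>UNIV. (X $ i $ j) *\<^sub>R ?q i j)"
    by (subst sum.swap, intro sum.cong refl, subst Q(3)) (rule refl)
  finally have "Q (L x) (L x) = 2 *\<^sub>R bilin_tens Q L X"
    by (simp add: bilin_tens_def scaleR_2)
  then show ?thesis by simp
qed

lemma linear_bilin_tens:
  "linear \<tau> \<Longrightarrow> \<tau> (bilin_tens S L X) = bilin_tens (\<lambda>v w. \<tau> (S v w)) L X"
  by (simp add: bilin_tens_def linear_sum linear_scale)

section \<open>Riemannian norms compared with the model norm in a chart\<close>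

locale riemannian_manifold = manifold A
  for A :: "('m::{t2_space, second_countable_topology}, 'e::real_normed_vector) chart set" +
  fixes g :: "'m \<Rightarrow> 'e \<Rightarrow> 'e \<Rightarrow> real"
  assumes metric: "riemannian_metric A g"
begin

lemma bilinear_metric: "bilinear (g m)"
  and metric_pos: "v \<noteq> 0 \<Longrightarrow> 0 < g m v v"
  using metric unfolding riemannian_metric_def by blast+

lemma metric_nonneg: "0 \<le> g m v v"
  using metric_pos[of v m] bilinear_lzero[OF bilinear_metric] by (cases "v = 0") (auto intro: less_imp_le)

lemma tnorm_nonneg: "0 \<le> tnorm g m v"
  by (simp add: tnorm_def metric_nonneg)

lemma tnorm_scaleR: "tnorm g m (r *\<^sub>R v) = \<bar>r\<bar> * tnorm g m v"
  by (simp add: tnorm_def bilinear_lmul[OF bilinear_metric] bilinear_rmul[OF bilinear_metric]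
      real_sqrt_mult flip: mult.assoc)

lemma tens_norm_scaleR: "tens_norm g m (r *\<^sub>R \<xi>) = \<bar>r\<bar> * tens_norm g m \<xi>"
  by (simp add: tens_norm_def bilinear_lmul[OF bilinear_metric] bilinear_rmul[OF bilinear_metric]
      real_sqrt_mult sum_distrib_left[symmetric] flip: mult.assoc)

text \<open>At the single point \<open>m0\<close> the lower bound comes from compactness of the unit
  sphere. Continuity of the metric coefficients carries it over to nearby points with half the
  constant.\<close>

lemma tnorm_locally_equivalent:
  assumes c: "c \<in> A" and m0: "m0 \<in> cdom c"
  obtains \<epsilon> \<Lambda> where "\<epsilon> > 0" "\<Lambda> > 0"
    "\<forall>m\<in>cdom c. dist (cmap c m) (cmap c m0) < \<epsilon> \<longrightarrow>
       (\<forall>v. norm (blinfun_apply (to_coord A c m) v) \<le> \<Lambda> * tnorm g m v \<and>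
            tnorm g m v \<le> \<Lambda> * norm (blinfun_apply (to_coord A c m) v))"
proof -
  obtain B :: "'e set" where B: "finite B" "span B = UNIV" by (rule finite_span)
  define G where "G a u w = g (cinv c a) (blinfun_apply (from_coord A c (cinv c a)) u)
    (blinfun_apply (from_coord A c (cinv c a)) w)" for a u w
  define a0 where "a0 = cmap c m0"
  have a0: "a0 \<in> crange c" using m0 by (simp add: a0_def)
  have lin_from: "linear (blinfun_apply (from_coord A c n))" for n
    by (simp add: blinfun.bounded_linear_right bounded_linear.linear)
  have lin: "linear (\<lambda>u. G a u w)" "linear (G a u)" for a u w
    using linear_compose[OF lin_from, of "\<lambda>v. g (cinv c a) v (blinfun_apply (from_coord A c (cinv c a)) w)"]
      linear_compose[OF lin_from, of "g (cinv c a) (blinfun_apply (from_coord A c (cinv c a)) u)"]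
      bilinear_metric[of "cinv c a"]
    by (auto simp: bilinear_def G_def[abs_def] o_def)
  have "Ck_on 0 (crange c) (\<lambda>a. G a u w)" for u w
    using metric c unfolding riemannian_metric_def smooth_on_def G_def by blast
  then have cont: "continuous_on (crange c) (\<lambda>a. G a u w)" for u w by simp
  obtain N where N: "continuous_on (crange c) N"
      "\<forall>a\<in>crange c. \<forall>u w. norm (G a u w) \<le> N a * (norm u * norm w)"
    using bilinear_family_bound[OF B, of "crange c" G] lin cont by metis
  \<comment> \<open>\<open>N'\<close> controls the deviation from the metric at \<open>a0\<close>
    and vanishes there, so it drops below \<mu> / 2 nearby.\<close>
  obtain N' where N': "continuous_on (crange c) N'"
      "\<forall>a\<in>crange c. \<forall>u w. norm (G a u w - G a0 u w) \<le> N' a * (norm u * norm w)" "N' a0 = 0"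
    using bilinear_family_bound[OF B, of "crange c" "\<lambda>a u w. G a u w - G a0 u w",
        OF linear_compose_sub[OF lin(1,1)] linear_compose_sub[OF lin(2,2)]
          continuous_on_diff[OF cont continuous_on_const]] by (metis diff_self)
  have pos: "G a0 u u > 0" if "u \<noteq> 0" for u
  proof -
    have "blinfun_apply (from_coord A c m0) u \<noteq> 0"
      using from_to_coord(2)[OF c m0, of u] that by (metis blinfun.zero_right)
    then show ?thesis
      using metric_pos by (simp add: G_def a0_def cinv_cmap[OF c m0])
  qed
  have "\<exists>\<mu>>0. \<forall>u. \<mu> * (norm u)\<^sup>2 \<le> G a0 u u"
  proof (cases "sphere (0::'e) 1 = {}")
    \<comment> \<open>Dimension 0: the sphere is empty and there is nothing to minimise
      over.\<close>
    case True
    have "u = 0" for u :: 'e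
    proof (rule ccontr)
      assume "u \<noteq> 0"
      then have "(1 / norm u) *\<^sub>R u \<in> sphere 0 1" by simp
      with True show False by blast
    qed
    moreover have "G a0 0 0 = 0" using lin(2) linear_0 by blast
    ultimately show ?thesis by (intro exI[of _ 1]) (metis mult_zero_right norm_zero order_refl power_zero_numeral zero_less_one)
  next
    case False
    have "sphere (0::'e) 1 = cball 0 1 \<inter> {u. norm u = 1}" by auto
    moreover have "closed {u::'e. norm u = 1}"
      by (intro closed_Collect_eq continuous_intros)
    ultimately have cS: "compact (sphere (0::'e) 1)"
      using compact_Int_closed[OF finite_span_imp_compact_cball[OF B]] by metis
    have "bounded_bilinear (G a0)"
    proof
      show "\<exists>K. \<forall>a b. norm (G a0 a b) \<le> norm a * norm b * K"
        using N(2) a0 by (metis mult.commute)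
    qed (use lin in \<open>auto simp: linear_add linear_scale linear_add[OF lin(1)] linear_scale[OF lin(1)]\<close>)
    then have cG: "continuous_on (sphere 0 1) (\<lambda>u. G a0 u u)"
      by (rule bounded_bilinear.continuous_on) (rule continuous_on_id)+
    obtain u0 where u0: "u0 \<in> sphere 0 1" "\<And>u. u \<in> sphere 0 1 \<Longrightarrow> G a0 u0 u0 \<le> G a0 u u"
      using continuous_attains_inf[OF cS False cG] by blast
    have "G a0 u0 u0 * (norm u)\<^sup>2 \<le> G a0 u u" for u
    proof (cases "u = 0")
      case True
      then show ?thesis by (simp add: linear_0[OF lin(2)])
    next
      case False
      then have "G a0 u0 u0 \<le> G a0 ((1 / norm u) *\<^sub>R u) ((1 / norm u) *\<^sub>R u)"
        by (intro u0(2)) simp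
      also have "\<dots> = G a0 u u / (norm u)\<^sup>2"
        by (simp add: linear_scale[OF lin(1)] linear_scale[OF lin(2)] power2_eq_square)
      finally show ?thesis using False by (simp add: field_simps)
    qed
    moreover have "G a0 u0 u0 > 0" using u0(1) by (intro pos) auto
    ultimately show ?thesis by blast
  qed
  then obtain \<mu> where \<mu>: "\<mu> > 0" "\<And>u. \<mu> * (norm u)\<^sup>2 \<le> G a0 u u" by blast
  obtain \<epsilon>1 where \<epsilon>1: "\<epsilon>1 > 0" "\<And>a. a \<in> crange c \<Longrightarrow> dist a a0 < \<epsilon>1 \<Longrightarrow> norm (N a) \<le> norm (N a0) + 1"
    using continuous_on_imp_locally_bounded[OF N(1) a0] by blast
  obtain \<epsilon>2 where \<epsilon>2: "\<epsilon>2 > 0" "\<And>a. a \<in> crange c \<Longrightarrow> dist a a0 < \<epsilon>2 \<Longrightarrow> dist (N' a) (N' a0) < \<mu> / 2"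
    using N'(1) a0 \<mu>(1) unfolding continuous_on_iff by (meson half_gt_zero)
  \<comment> \<open>The first entry comes from the lower bound \<mu> / 2 of the metric, the second
    from the upper bound norm (N a0) + 1, both after taking square roots.\<close>
  define \<Lambda> where "\<Lambda> = max (sqrt (2 / \<mu>)) (sqrt (norm (N a0) + 1))"
  have "\<Lambda> > 0" using \<mu>(1) by (simp add: \<Lambda>_def less_max_iff_disj)
  have "norm (blinfun_apply (to_coord A c m) v) \<le> \<Lambda> * tnorm g m v \<and>
            tnorm g m v \<le> \<Lambda> * norm (blinfun_apply (to_coord A c m) v)"
    if m: "m \<in> cdom c" "dist (cmap c m) (cmap c m0) < min \<epsilon>1 \<epsilon>2" for m v
  proof -
    define a where "a = cmap c m"
    define u where "u = blinfun_apply (to_coord A c m) v"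
    have a: "a \<in> crange c" "dist a a0 < \<epsilon>1" "dist a a0 < \<epsilon>2" using m by (auto simp: a_def a0_def)
    have G: "G a u u = g m v v"
      by (simp add: G_def a_def u_def cinv_cmap[OF c m(1)] from_to_coord[OF c m(1)])
    have "\<bar>G a u u\<bar> \<le> N a * (norm u)\<^sup>2" "\<bar>G a u u - G a0 u u\<bar> \<le> N' a * (norm u)\<^sup>2"
      using N(2) N'(2) a(1) by (auto simp: power2_eq_square)
    moreover have "N a * (norm u)\<^sup>2 \<le> (norm (N a0) + 1) * (norm u)\<^sup>2"
      using \<epsilon>1(2)[OF a(1,2)] by (intro mult_right_mono) auto
    moreover have "N' a * (norm u)\<^sup>2 \<le> \<mu> / 2 * (norm u)\<^sup>2"
      using \<epsilon>2(2)[OF a(1,3)] N'(3) by (intro mult_right_mono) (auto simp: dist_real_def)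
    ultimately have "g m v v \<le> (norm (N a0) + 1) * (norm u)\<^sup>2" "\<mu> / 2 * (norm u)\<^sup>2 \<le> g m v v"
      using \<mu>(2)[of u] unfolding G[symmetric] by linarith+
    then have "g m v v \<le> (norm (N a0) + 1) * (norm u)\<^sup>2" "(norm u)\<^sup>2 \<le> 2 / \<mu> * g m v v"
      using \<mu>(1) by (simp_all add: field_simps)
    from this[THEN real_sqrt_le_mono]
    have "tnorm g m v \<le> sqrt (norm (N a0) + 1) * norm u" "norm u \<le> sqrt (2 / \<mu>) * tnorm g m v"
      by (simp_all only: tnorm_def real_sqrt_mult real_sqrt_abs abs_norm_cancel)
    moreover have "sqrt (norm (N a0) + 1) * norm u \<le> \<Lambda> * norm u" "sqrt (2 / \<mu>) * tnorm g m v \<le> \<Lambda> * tnorm g m v"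
      using tnorm_nonneg by (auto intro!: mult_right_mono simp: \<Lambda>_def)
    ultimately show ?thesis by (auto simp: u_def)
  qed
  with \<epsilon>1(1) \<epsilon>2(1) \<open>\<Lambda> > 0\<close> show thesis
    by (intro that[of "min \<epsilon>1 \<epsilon>2" \<Lambda>]) auto
qed

text \<open>A qualitative bound at one point, with \<open>l\<close> depending on \<open>m\<close>:
  it serves to make the suprema in \<open>op_norm\<close> finite, so that
  \<open>norm_le_op_norm\<close> applies.\<close>

lemma tnorm_lower_bound:
  obtains l where "l > 0" "\<forall>v. l * norm v \<le> tnorm g m v" "\<forall>\<xi> :: 'e^'k. l * norm \<xi> \<le> tens_norm g m \<xi>"
proof -
  define c where "c = chart_at A m"
  have c: "c \<in> A" "m \<in> cdom c" by (simp_all add: c_def chart_at)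
  obtain \<Lambda> where \<Lambda>: "\<Lambda> > 0" "\<And>v. norm (blinfun_apply (to_coord A c m) v) \<le> \<Lambda> * tnorm g m v"
    using tnorm_locally_equivalent[OF c] c(2) by (metis dist_self)
  \<comment> \<open>The chart is \<open>chart_at A m\<close> itself, so the change of coordinates at
    \<open>m\<close> is the identity.\<close>
  have "norm v \<le> \<Lambda> * tnorm g m v" for v
    using \<Lambda>(2)[of v] c(2) coord_change_self[OF c] by (simp add: c_def)
  then have l: "(1 / \<Lambda>) * norm v \<le> tnorm g m v" for v
    using \<Lambda>(1) by (simp add: field_simps)
  have "(1 / \<Lambda>) * norm \<xi> \<le> tens_norm g m \<xi>" for \<xi> :: "'e^'k"
  proof -
    have "(1 / \<Lambda>) * norm \<xi> = L2_set (\<lambda>i. (1 / \<Lambda>) * norm (\<xi> $ i)) UNIV"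
      unfolding norm_vec_def using \<Lambda>(1) by (intro L2_set_right_distrib) simp
    also have "\<dots> \<le> L2_set (\<lambda>i. tnorm g m (\<xi> $ i)) UNIV"
      using \<Lambda>(1) l by (intro L2_set_mono) auto
    also have "\<dots> = tens_norm g m \<xi>"
      by (simp add: L2_set_def tens_norm_def tnorm_def metric_nonneg)
    finally show ?thesis .
  qed
  with l \<Lambda>(1) show thesis by (intro that[of "1 / \<Lambda>"]) auto
qed

end

section \<open>Controlled paths on a manifold\<close>

locale rough_manifold = riemannian_manifold A g
  for A :: "('m::{t2_space, second_countable_topology}, 'e::real_normed_vector) chart set"
    and g :: "'m \<Rightarrow> 'e \<Rightarrow> 'e \<Rightarrow> real" +
  fixes p T :: real
    and \<omega> :: "real \<Rightarrow> real \<Rightarrow> real"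
    and x :: "real \<Rightarrow> real^'k"
    and X :: "real \<Rightarrow> real \<Rightarrow> real^'k^'k"
    and y :: "real \<Rightarrow> 'm"
    and y' :: "real \<Rightarrow> (real^'k) \<Rightarrow>\<^sub>L 'e"
  assumes p: "1 \<le> p"
    and rough_path: "weak_geometric_rough_path p T \<omega> x X"
    and y: "(y, y') \<in> CRP_M A g p T \<omega> x"
begin

text \<open>The length scale of the rough path: an estimate of order i becomes one by the i-th power
  of \<theta>.\<close>

definition \<theta> :: "real \<Rightarrow> real \<Rightarrow> real"
where "\<theta> s t = \<omega> s t powr (1 / p)"

lemma \<omega>_nonneg: "0 \<le> s \<Longrightarrow> s \<le> t \<Longrightarrow> t \<le> T \<Longrightarrow> 0 \<le> \<omega> s t"
  using rough_path unfolding weak_geometric_rough_path_def control_def by blast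

lemma \<omega>_le:
  assumes "0 \<le> s" "s \<le> t" "t \<le> T"
  shows "\<omega> s t \<le> \<omega> 0 T"
proof -
  have "\<omega> 0 s + \<omega> s t \<le> \<omega> 0 t" "\<omega> 0 t + \<omega> t T \<le> \<omega> 0 T"
    using rough_path assms unfolding weak_geometric_rough_path_def control_def by auto
  then show ?thesis
    using \<omega>_nonneg[of 0 s] \<omega>_nonneg[of t T] assms by linarith
qed

lemma \<theta>_nonneg: "0 \<le> \<theta> s t"
  by (simp add: \<theta>_def)

lemma \<theta>_le: "0 \<le> s \<Longrightarrow> s \<le> t \<Longrightarrow> t \<le> T \<Longrightarrow> \<theta> s t \<le> \<theta> 0 T"
  using p \<omega>_nonneg \<omega>_le by (simp add: \<theta>_def powr_mono2)

lemma \<theta>_powers: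
  "\<omega> s t powr (1 / p) = \<theta> s t" "\<omega> s t powr (2 / p) = (\<theta> s t)\<^sup>2" "\<omega> s t powr (3 / p) = \<theta> s t ^ 3"
proof -
  have "1 / p + 1 / p = 2 / p" "2 / p + 1 / p = 3 / p" by (simp_all add: field_simps)
  then show "\<omega> s t powr (1 / p) = \<theta> s t" "\<omega> s t powr (2 / p) = (\<theta> s t)\<^sup>2" "\<omega> s t powr (3 / p) = \<theta> s t ^ 3"
    by (simp_all only: \<theta>_def power2_eq_square power3_eq_cube powr_add[symmetric])
qed

lemma path_bounds:
  assumes "0 \<le> s" "s \<le> t" "t \<le> T"
  shows "norm (x t - x s) \<le> \<theta> s t" "norm (x t - x s) \<le> \<theta> 0 T"
    "(1 / 2) *\<^sub>R (X s t + transpose (X s t)) = (1 / 2) *\<^sub>R tens (x t - x s) (x t - x s)"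
proof -
  show 1: "norm (x t - x s) \<le> \<theta> s t" and
    "(1 / 2) *\<^sub>R (X s t + transpose (X s t)) = (1 / 2) *\<^sub>R tens (x t - x s) (x t - x s)"
    using rough_path assms unfolding weak_geometric_rough_path_def \<theta>_def by auto
  show "norm (x t - x s) \<le> \<theta> 0 T"
    using 1 \<theta>_le[OF assms] by linarith
qed

lemma continuous_on_y: "continuous_on {0..T} y"
  using y unfolding CRP_M_def by blast

lemma path_near:
  assumes c: "c \<in> A" and t0: "t0 \<in> {0..T}" "y t0 \<in> cdom c" and "\<eta> > 0"
  obtains \<epsilon> where "\<epsilon> > 0" "\<And>s. s \<in> {0..T} \<Longrightarrow> dist s t0 < \<epsilon> \<Longrightarrow>
    y s \<in> cdom c \<and> dist (cmap c (y s)) (cmap c (y t0)) < \<eta>"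
proof -
  have "open (cdom c \<inter> cmap c -` ball (cmap c (y t0)) \<eta>)"
    by (rule continuous_open_preimage[OF continuous_on_cmap open_cdom open_ball]) (fact c)+
  moreover have "y t0 \<in> cdom c \<inter> cmap c -` ball (cmap c (y t0)) \<eta>"
    using t0(2) \<open>\<eta> > 0\<close> by simp
  moreover have "(y \<longlongrightarrow> y t0) (at t0 within {0..T})"
    using continuous_on_y t0(1) unfolding continuous_on_def by blast
  ultimately have "\<forall>\<^sub>F s in at t0 within {0..T}. y s \<in> cdom c \<inter> cmap c -` ball (cmap c (y t0)) \<eta>"
    by (intro topological_tendstoD)
  then obtain \<epsilon> where "\<epsilon> > 0" "\<And>s. s \<in> {0..T} \<Longrightarrow> s \<noteq> t0 \<Longrightarrow> dist s t0 < \<epsilon> \<Longrightarrow>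
      y s \<in> cdom c \<inter> cmap c -` ball (cmap c (y t0)) \<eta>"
    unfolding eventually_at by blast
  then have "y s \<in> cdom c \<and> dist (cmap c (y s)) (cmap c (y t0)) < \<eta>" if "s \<in> {0..T}" "dist s t0 < \<epsilon>" for s
    using that t0(2) \<open>\<eta> > 0\<close> by (cases "s = t0") (auto simp: dist_commute)
  with \<open>\<epsilon> > 0\<close> that show thesis by blast
qed

lemma continuous_on_y_chart:
  assumes "c \<in> A"
  shows "continuous_on {s \<in> {0..T}. y s \<in> cdom c} (\<lambda>s. cmap c (y s))"
  by (intro continuous_on_compose2[OF continuous_on_cmap[OF assms]] continuous_on_subset[OF continuous_on_y]) auto

text \<open>The form of \<open>y'\<close> that \<open>CRP_M\<close> requires to be continuous; the
  components \<open>y' s\<close> themselves may jump with \<open>chart_at A (y s)\<close>.\<close>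

definition velocity :: "('m, 'e) chart \<Rightarrow> real \<Rightarrow> (real^'k) \<Rightarrow>\<^sub>L 'e"
where "velocity c s = to_coord A c (y s) o\<^sub>L y' s"

text \<open>\<open>\<psi>(a, b) = b - a + O(\<bar>b - a\<bar>\<^sup>2)\<close> in a chart, so that the increment itself can replace the
  logarithm of the gauge in which the path is controlled.\<close>

lemma increment_estimate:
  assumes c: "c \<in> A" and t0: "t0 \<in> {0..T}" "y t0 \<in> cdom c"
  obtains \<epsilon> K where "\<epsilon> > 0" "K \<ge> 0"
    "\<forall>s t. 0 \<le> s \<and> s \<le> t \<and> t \<le> T \<and> \<bar>s - t0\<bar> < \<epsilon> \<and> \<bar>t - t0\<bar> < \<epsilon> \<longrightarrow>
      norm (cmap c (y t) - cmap c (y s) - blinfun_apply (velocity c s) (x t - x s)) \<le> K * (\<theta> s t)\<^sup>2 \<and>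
      norm (cmap c (y t) - cmap c (y s)) \<le> K * \<theta> s t \<and>
      norm (blinfun_apply (velocity c s) (x t - x s)) \<le> K * \<theta> s t"
proof -
  obtain B :: "'e set" where B: "finite B" "span B = UNIV" by (rule finite_span)
  define a where "a s = cmap c (y s)" for s
  \<comment> \<open>A gauge supplied by \<open>CRP_M\<close>; it may differ from both gauges that
    are finally compared.\<close>
  obtain D \<psi> U where G: "gauge_on A D \<psi> U" and ap: "approx p T \<omega> 2 (\<lambda>s t. (y s, y t) \<in> D)
      (\<lambda>s. tnorm g (y s)) (\<lambda>s t. \<psi> (y s) (y t)) (\<lambda>s t. blinfun_apply (y' s) (x t - x s))"
    using y unfolding CRP_M_def by blast
  then have log: "logarithm A D \<psi>" unfolding gauge_on_def by blast
  note [simp] = log_coord_diagonal[OF c log]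
  obtain C \<delta> where \<delta>: "\<delta> > 0" and C: "\<forall>s t. 0 \<le> s \<and> s \<le> t \<and> t \<le> T \<and> t - s \<le> \<delta> \<longrightarrow>
      tnorm g (y s) (\<psi> (y s) (y t) - blinfun_apply (y' s) (x t - x s)) \<le> C * (\<theta> s t)\<^sup>2"
    using ap unfolding approx_def \<theta>_powers by blast
  have a0: "a t0 \<in> crange c" using t0(2) by (simp add: a_def)
  obtain \<epsilon>1 K1 where T1: "\<epsilon>1 > 0" "K1 \<ge> 0"
    "\<forall>a' b'. dist a' (a t0) < \<epsilon>1 \<longrightarrow> dist b' (a t0) < \<epsilon>1 \<longrightarrow> (a', b') \<in> coord_domain c D \<and>
       norm (log_coord c \<psi> (a', b') - log_coord c \<psi> (a', a') - dird (log_coord c \<psi>) (0, b' - a') (a', a')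
         - (1 / 2) *\<^sub>R hess2 (log_coord c \<psi>) (b' - a') (b' - a') (a', a')) \<le> K1 * norm (b' - a') ^ 3"
    "\<forall>a' u v. dist a' (a t0) < \<epsilon>1 \<longrightarrow> norm (hess2 (log_coord c \<psi>) u v (a', a')) \<le> K1 * (norm u * norm v)"
    using diagonal_taylor[OF B open_coord_domain[OF c log_domain(2)[OF c log]]
        coord_domain_diagonal[OF log_domain(1)[OF c log] a0] Ck_on_log_coord[OF c log]] by metis
  obtain \<epsilon>2 \<Lambda> where \<Lambda>: "\<epsilon>2 > 0" "\<Lambda> > 0"
    "\<forall>m\<in>cdom c. dist (cmap c m) (a t0) < \<epsilon>2 \<longrightarrow>
       (\<forall>v. norm (blinfun_apply (to_coord A c m) v) \<le> \<Lambda> * tnorm g m v)"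
    using tnorm_locally_equivalent[OF c t0(2)] unfolding a_def by metis
  have "continuous_on {s \<in> {0..T}. y s \<in> cdom c} (velocity c)"
    using y c unfolding CRP_M_def velocity_def[abs_def] by blast
  then obtain \<epsilon>3 where \<epsilon>3: "\<epsilon>3 > 0" "\<And>s. s \<in> {s \<in> {0..T}. y s \<in> cdom c} \<Longrightarrow> dist s t0 < \<epsilon>3 \<Longrightarrow>
      norm (velocity c s) \<le> norm (velocity c t0) + 1"
    using continuous_on_imp_locally_bounded[of _ "velocity c" t0] t0 by blast
  define V where "V = norm (velocity c t0) + 1"
  have "V \<ge> 0" by (simp add: V_def)
  \<comment> \<open>Two points within \<eta> of \<open>a t0\<close> have a difference d with norm d
    \<le> 1, so the cubic remainder is at most quadratic, and (K1 + 1) * norm d \<le> 1 / 4, so the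
    quadratic error in l = d + ... can be absorbed. The summand 1 avoids dividing by zero.\<close>
  define \<eta> where "\<eta> = min (min \<epsilon>1 \<epsilon>2) (min (1 / 2) (1 / (8 * (K1 + 1))))"
  have \<eta>: "\<eta> > 0" "\<eta> \<le> \<epsilon>1" "\<eta> \<le> \<epsilon>2" "\<eta> \<le> 1 / 2" "\<eta> \<le> 1 / (8 * (K1 + 1))"
  proof -
    show "\<eta> > 0" using T1(1,2) \<Lambda>(1) by (simp add: \<eta>_def)
  qed (unfold \<eta>_def, linarith+)
  obtain \<epsilon>4 where \<epsilon>4: "\<epsilon>4 > 0" "\<And>s. s \<in> {0..T} \<Longrightarrow> dist s t0 < \<epsilon>4 \<Longrightarrow> y s \<in> cdom c \<and> dist (a s) (a t0) < \<eta>"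
    using path_near[OF c t0 \<eta>(1)] unfolding a_def by blast
  define \<epsilon> where "\<epsilon> = min (\<delta> / 2) (min \<epsilon>3 \<epsilon>4)"
  have "\<epsilon> > 0" using \<delta> \<epsilon>3(1) \<epsilon>4(1) by (simp add: \<epsilon>_def)
  \<comment> \<open>The constant in \<open>approx\<close> may be negative, hence the absolute
    value.\<close>
  define R where "R = \<Lambda> * \<bar>C\<bar>"
  \<comment> \<open>With \<theta> \<le> \<theta> 0 T, the logarithm l is at most (V + R * \<theta> 0
    T) * \<theta>, and norm d \<le> 2 * norm l. In \<open>K\<close> the last entry adds the error R
    of l - v and the error 2 * K1 * (norm d)^2 of l - d.\<close>
  define K' where "K' = 2 * (V + R * \<theta> 0 T)"
  define K where "K = max (max K' V) (R + 2 * K1 * K'\<^sup>2)"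
  have "R \<ge> 0" using \<Lambda>(2) by (simp add: R_def)
  have "K \<ge> 0" using \<open>V \<ge> 0\<close> by (simp add: K_def le_max_iff_disj)
  have main: "norm (a t - a s - blinfun_apply (velocity c s) (x t - x s)) \<le> K * (\<theta> s t)\<^sup>2 \<and>
      norm (a t - a s) \<le> K * \<theta> s t \<and> norm (blinfun_apply (velocity c s) (x t - x s)) \<le> K * \<theta> s t"
    if st: "0 \<le> s" "s \<le> t" "t \<le> T" "\<bar>s - t0\<bar> < \<epsilon>" "\<bar>t - t0\<bar> < \<epsilon>" for s t
  proof -
    have "t - s \<le> \<delta>"
      using st(4,5) unfolding \<epsilon>_def by linarith
    then have near: "dist s t0 < \<epsilon>3" "dist s t0 < \<epsilon>4" "dist t t0 < \<epsilon>4" "t - s \<le> \<delta>"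
        "s \<in> {0..T}" "t \<in> {0..T}"
      using st by (simp_all add: \<epsilon>_def dist_real_def)
    have ys: "y s \<in> cdom c" "dist (a s) (a t0) < \<eta>" and yt: "y t \<in> cdom c" "dist (a t) (a t0) < \<eta>"
      using \<epsilon>4(2) near by auto
    define d where "d = a t - a s"
    define v where "v = blinfun_apply (velocity c s) (x t - x s)"
    define l where "l = log_coord c \<psi> (a s, a t)"
    note \<theta>0 = \<theta>_nonneg[of s t] and \<theta>T = \<theta>_le[OF st(1-3)]
    have "norm d \<le> 2 * \<eta>"
      using dist_triangle2[of "a t" "a s" "a t0"] ys yt by (simp add: d_def dist_norm)
    then have d: "norm d \<le> 1" "(K1 + 1) * norm d \<le> 1 / 4"
    proof -
      show "norm d \<le> 1" using \<open>norm d \<le> 2 * \<eta>\<close> \<eta>(4) by linarith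
      have "(K1 + 1) * norm d \<le> (K1 + 1) * (2 * (1 / (8 * (K1 + 1))))"
        using \<open>norm d \<le> 2 * \<eta>\<close> \<eta>(5) T1(2) by (intro mult_left_mono) auto
      also have "\<dots> = 1 / 4" using T1(2) by (simp add: field_simps)
      finally show "(K1 + 1) * norm d \<le> 1 / 4" .
    qed
    have "norm (velocity c s) \<le> V" using \<epsilon>3(2)[of s] near ys by (simp add: V_def)
    then have v: "norm v \<le> V * \<theta> s t"
      unfolding v_def using path_bounds(1)[OF st(1-3)] \<open>V \<ge> 0\<close>
      by (intro order_trans[OF norm_blinfun] mult_mono) auto
    have "a s \<in> crange c" using ys(1) by (simp add: a_def)
    have "norm (l - d - (1 / 2) *\<^sub>R hess2 (log_coord c \<psi>) d d (a s, a s)) \<le> K1 * norm d ^ 3"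
      using T1(3)[rule_format, of "a s" "a t"] ys(2) yt(2) \<eta>(2)
      by (simp add: l_def d_def dird_log_coord_diagonal[OF c log \<open>a s \<in> crange c\<close>])
    also have "norm d ^ 3 \<le> (norm d)\<^sup>2"
      using d(1) by (simp add: power3_eq_cube power2_eq_square mult_left_le)
    finally have "norm (l - d - (1 / 2) *\<^sub>R hess2 (log_coord c \<psi>) d d (a s, a s)) \<le> K1 * (norm d)\<^sup>2"
      using T1(2) by (simp add: mult_left_mono)
    moreover have "norm ((1 / 2) *\<^sub>R hess2 (log_coord c \<psi>) d d (a s, a s)) \<le> K1 * (norm d)\<^sup>2"
    proof -
      have "norm (hess2 (log_coord c \<psi>) d d (a s, a s)) \<le> K1 * (norm d)\<^sup>2"
        using T1(4)[rule_format, of "a s" d d] ys(2) \<eta>(2) by (simp add: power2_eq_square)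
      then show ?thesis
        using norm_ge_zero[of "hess2 (log_coord c \<psi>) d d (a s, a s)"] by (simp del: norm_ge_zero)
    qed
    ultimately have ld: "norm (l - d) \<le> 2 * K1 * (norm d)\<^sup>2"
      using norm_triangle_ineq[of "l - d - (1 / 2) *\<^sub>R hess2 (log_coord c \<psi>) d d (a s, a s)"
          "(1 / 2) *\<^sub>R hess2 (log_coord c \<psi>) d d (a s, a s)"] by simp
    have "l - v = blinfun_apply (to_coord A c (y s)) (\<psi> (y s) (y t) - blinfun_apply (y' s) (x t - x s))"
      by (simp add: l_def v_def a_def log_coord_cmap[OF c log ys(1) yt(1)] velocity_def blinfun.diff_right)
    also have "norm \<dots> \<le> \<Lambda> * tnorm g (y s) (\<psi> (y s) (y t) - blinfun_apply (y' s) (x t - x s))"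
      using \<Lambda>(3) ys \<eta>(3) by (auto simp: a_def)
    also have "\<dots> \<le> \<Lambda> * (\<bar>C\<bar> * (\<theta> s t)\<^sup>2)"
    proof (rule mult_left_mono)
      have "tnorm g (y s) (\<psi> (y s) (y t) - blinfun_apply (y' s) (x t - x s)) \<le> C * (\<theta> s t)\<^sup>2"
        using C st near(4) by blast
      also have "\<dots> \<le> \<bar>C\<bar> * (\<theta> s t)\<^sup>2" by (intro mult_right_mono) auto
      finally show "tnorm g (y s) (\<psi> (y s) (y t) - blinfun_apply (y' s) (x t - x s)) \<le> \<bar>C\<bar> * (\<theta> s t)\<^sup>2" .
    qed (use \<Lambda>(2) in simp)
    finally have lv: "norm (l - v) \<le> R * (\<theta> s t)\<^sup>2" by (simp add: R_def)
    have "R * (\<theta> s t)\<^sup>2 \<le> R * \<theta> 0 T * \<theta> s t"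
      using \<theta>T \<theta>0 \<open>R \<ge> 0\<close> by (simp add: power2_eq_square mult_left_mono mult_right_mono flip: mult.assoc)
    then have l: "norm l \<le> (V + R * \<theta> 0 T) * \<theta> s t"
      using norm_triangle_ineq[of "l - v" v] lv v by (simp add: algebra_simps)
    \<comment> \<open>Absorption: the error of l - d is at most half of norm d, so d is bounded by
      twice l, which is already known to be of order 1.\<close>
    have "2 * K1 * (norm d)\<^sup>2 = (2 * (K1 * norm d)) * norm d" by (simp add: power2_eq_square)
    also have "\<dots> \<le> (1 / 2) * norm d"
    proof (rule mult_right_mono)
      have "(K1 + 1) * norm d = K1 * norm d + norm d" by (simp add: algebra_simps)
      then show "2 * (K1 * norm d) \<le> 1 / 2" using d(2) norm_ge_zero[of d] by linarith
    qed simp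
    finally have "norm d \<le> 2 * norm l"
      using ld norm_triangle_ineq2[of d l] by (simp add: norm_minus_commute)
    with l have d_le: "norm d \<le> K' * \<theta> s t" by (simp add: K'_def algebra_simps)
    then have "(norm d)\<^sup>2 \<le> (K' * \<theta> s t)\<^sup>2" by (intro power_mono) auto
    then have "2 * K1 * (norm d)\<^sup>2 \<le> 2 * K1 * (K'\<^sup>2 * (\<theta> s t)\<^sup>2)"
      using T1(2) by (intro mult_left_mono) (auto simp: power_mult_distrib)
    then have "norm (d - v) \<le> (R + 2 * K1 * K'\<^sup>2) * (\<theta> s t)\<^sup>2"
      using norm_triangle_ineq[of "l - v" "d - l"] ld lv by (simp add: norm_minus_commute algebra_simps)
    also have "\<dots> \<le> K * (\<theta> s t)\<^sup>2" by (intro mult_right_mono) (auto simp: K_def)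
    finally have "norm (d - v) \<le> K * (\<theta> s t)\<^sup>2" .
    moreover have "K' * \<theta> s t \<le> K * \<theta> s t" "V * \<theta> s t \<le> K * \<theta> s t"
      using \<theta>0 by (auto intro!: mult_right_mono simp: K_def)
    ultimately show ?thesis using d_le v unfolding d_def v_def by linarith
  qed
  show thesis
    using main by (intro that[OF \<open>\<epsilon> > 0\<close> \<open>K \<ge> 0\<close>]) (auto simp: a_def)
qed

end

lemma bounded_linear_tens: "bounded_linear (tens w :: 'a::real_normed_vector \<Rightarrow> 'a^'k)"
  by (rule bounded_linear_intro[where K = "norm w"])
    (simp_all add: norm_tens mult.commute, simp_all add: tens_def vec_eq_iff algebra_simps)

lemma bounded_linear_id_tens:
  fixes L :: "'a::real_normed_vector \<Rightarrow>\<^sub>L 'b::real_normed_vector"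
  shows "bounded_linear (id_tens (blinfun_apply L) :: 'a^'k \<Rightarrow> 'b^'k)"
proof (rule bounded_linear_intro[where K = "norm L"])
  fix \<xi> :: "'a^'k"
  have "norm (id_tens (blinfun_apply L) \<xi>) \<le> L2_set (\<lambda>i. norm L * norm (\<xi> $ i)) UNIV"
    unfolding norm_vec_def by (intro L2_set_mono) (simp_all add: id_tens_def norm_blinfun)
  also have "\<dots> = norm \<xi> * norm L"
    by (simp add: norm_vec_def L2_set_right_distrib mult.commute[of _ "norm L"])
  finally show "norm (id_tens (blinfun_apply L) \<xi>) \<le> norm \<xi> * norm L" .
qed (simp_all add: id_tens_def vec_eq_iff blinfun.add_right blinfun.scaleR_right)

context rough_manifold
begin

text \<open>The approximating expression no longer mentions \<psi>: it consists of the coordinate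
  increment and a first derivative of \<open>U\<close>. Any two logarithms forming gauges with the
  same \<open>U\<close> are therefore compared through it.\<close>

lemma log_expansion:
  assumes c: "c \<in> A" and t0: "t0 \<in> {0..T}" "y t0 \<in> cdom c" and G: "gauge_on A D \<psi> U"
  obtains \<epsilon> K where "\<epsilon> > 0"
    "\<forall>s t. 0 \<le> s \<and> s \<le> t \<and> t \<le> T \<and> \<bar>s - t0\<bar> < \<epsilon> \<and> \<bar>t - t0\<bar> < \<epsilon> \<longrightarrow> (y s, y t) \<in> D \<and>
      norm (blinfun_apply (to_coord A c (y s))
          (\<psi> (y s) (y t) + bilin_tens (gauge_compat A \<psi> U (y s)) (blinfun_apply (y' s)) (X s t))
        - (cmap c (y t) - cmap c (y s) - bilin_tens
            (\<lambda>v w. blinfun_apply (dird (par_coord c c U) (v, 0) (cmap c (y s), cmap c (y s))) w)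
            (blinfun_apply (velocity c s)) (X s t)))
      \<le> K * \<theta> s t ^ 3"
proof -
  obtain B :: "'e set" where B: "finite B" "span B = UNIV" by (rule finite_span)
  define a where "a s = cmap c (y s)" for s
  define f where "f = log_coord c \<psi>"
  have log: "logarithm A D \<psi>" and U: "parallelism A D U" using G unfolding gauge_on_def by blast+
  have a0: "a t0 \<in> crange c" using t0(2) by (simp add: a_def)
  obtain \<epsilon>1 K1 where T1: "\<epsilon>1 > 0" "K1 \<ge> 0"
    "\<forall>a' b'. dist a' (a t0) < \<epsilon>1 \<longrightarrow> dist b' (a t0) < \<epsilon>1 \<longrightarrow> (a', b') \<in> coord_domain c D \<and>
       norm (f (a', b') - f (a', a') - dird f (0, b' - a') (a', a')
         - (1 / 2) *\<^sub>R hess2 f (b' - a') (b' - a') (a', a')) \<le> K1 * norm (b' - a') ^ 3"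
    "\<forall>a' u v. dist a' (a t0) < \<epsilon>1 \<longrightarrow> norm (hess2 f u v (a', a')) \<le> K1 * (norm u * norm v)"
    using diagonal_taylor[OF B open_coord_domain[OF c log_domain(2)[OF c log]]
        coord_domain_diagonal[OF log_domain(1)[OF c log] a0] Ck_on_log_coord[OF c log]]
    unfolding f_def by metis
  obtain \<epsilon>2 where \<epsilon>2: "\<epsilon>2 > 0" "\<And>s. s \<in> {0..T} \<Longrightarrow> dist s t0 < \<epsilon>2 \<Longrightarrow> y s \<in> cdom c \<and> dist (a s) (a t0) < \<epsilon>1"
    using path_near[OF c t0 T1(1)] unfolding a_def by blast
  obtain \<epsilon>3 K where inc: "\<epsilon>3 > 0" "K \<ge> 0"
    "\<forall>s t. 0 \<le> s \<and> s \<le> t \<and> t \<le> T \<and> \<bar>s - t0\<bar> < \<epsilon>3 \<and> \<bar>t - t0\<bar> < \<epsilon>3 \<longrightarrow>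
      norm (a t - a s - blinfun_apply (velocity c s) (x t - x s)) \<le> K * (\<theta> s t)\<^sup>2 \<and>
      norm (a t - a s) \<le> K * \<theta> s t \<and>
      norm (blinfun_apply (velocity c s) (x t - x s)) \<le> K * \<theta> s t"
    using increment_estimate[OF c t0] unfolding a_def .
  have main: "(y s, y t) \<in> D \<and>
      norm (blinfun_apply (to_coord A c (y s))
          (\<psi> (y s) (y t) + bilin_tens (gauge_compat A \<psi> U (y s)) (blinfun_apply (y' s)) (X s t))
        - (a t - a s - bilin_tens (\<lambda>v w. blinfun_apply (dird (par_coord c c U) (v, 0) (a s, a s)) w)
            (blinfun_apply (velocity c s)) (X s t)))
      \<le> K1 * (K ^ 3 + K\<^sup>2) * \<theta> s t ^ 3"
    if st: "0 \<le> s" "s \<le> t" "t \<le> T" "\<bar>s - t0\<bar> < min \<epsilon>2 \<epsilon>3" "\<bar>t - t0\<bar> < min \<epsilon>2 \<epsilon>3" for s t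
  proof -
    have ys: "y s \<in> cdom c" "dist (a s) (a t0) < \<epsilon>1" and yt: "y t \<in> cdom c" "dist (a t) (a t0) < \<epsilon>1"
      using \<epsilon>2(2)[of s] \<epsilon>2(2)[of t] st by (auto simp: dist_real_def)
    have as: "a s \<in> crange c" using ys(1) by (simp add: a_def)
    define \<tau> where "\<tau> = blinfun_apply (to_coord A c (y s))"
    define V where "V = blinfun_apply (velocity c s)"
    \<comment> \<open>Up to sign, the Christoffel symbols of the connection induced by
      \<open>U\<close>.\<close>
    define \<Gamma> where "\<Gamma> v w = blinfun_apply (dird (par_coord c c U) (v, 0) (a s, a s)) w" for v w
    \<comment> \<open>The arguments are interchanged to match \<open>gauge_compat_coord\<close>,
      where the first argument of the tensor is the outer direction of differentiation.\<close>
    define H where "H v w = hess2 f w v (a s, a s)" for v w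
    define d where "d = a t - a s"
    define v where "v = V (x t - x s)"
    have V: "V w = \<tau> (blinfun_apply (y' s) w)" for w
      by (simp add: V_def velocity_def \<tau>_def)
    have H: "linear (\<lambda>v. H v w)" "linear (H w)" "H v w = H w v" for v w
      unfolding H_def[abs_def] f_def
      by (rule linear_hess2_log_coord[OF c log as] hess2_log_coord_sym[OF c log as])+
    have lin_\<tau>: "linear \<tau>" and lin_V: "linear V"
      by (simp_all add: \<tau>_def V_def blinfun.bounded_linear_right bounded_linear.linear)
    have "\<tau> (bilin_tens (gauge_compat A \<psi> U (y s)) (blinfun_apply (y' s)) (X s t))
        = - bilin_tens H V (X s t) - bilin_tens \<Gamma> V (X s t)"
      unfolding linear_bilin_tens[OF lin_\<tau>]
      unfolding \<tau>_def gauge_compat_coord[OF c log U ys(1)]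
      unfolding \<tau>_def[symmetric] bilin_tens_def V H_def \<Gamma>_def f_def[symmetric] a_def[symmetric]
      by (simp add: scaleR_diff_right sum_subtractf sum_negf)
    also have "bilin_tens H V (X s t) = (1 / 2) *\<^sub>R H v v"
      unfolding v_def by (rule bilin_tens_sym[OF path_bounds(3)[OF st(1-3)] H(1,2,3) lin_V])
    finally have "\<tau> (\<psi> (y s) (y t) + bilin_tens (gauge_compat A \<psi> U (y s)) (blinfun_apply (y' s)) (X s t))
        - (d - bilin_tens \<Gamma> V (X s t)) = f (a s, a t) - d - (1 / 2) *\<^sub>R H v v"
      using log_coord_cmap[OF c log ys(1) yt(1)] by (simp add: blinfun.add_right \<tau>_def a_def f_def)
    \<comment> \<open>Polarisation: H(d, d) - H(v, v) = H(d - v, d) + H(v, d - v), each term pairing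
      a factor of order 2 with one of order 1. The first bracket is the Taylor remainder.\<close>
    also have "\<dots> = (f (a s, a t) - d - (1 / 2) *\<^sub>R H d d) + (1 / 2) *\<^sub>R (H (d - v) d + H v (d - v))"
      by (simp add: linear_diff[OF H(1)] linear_diff[OF H(2)] algebra_simps)
    also have "norm \<dots> \<le> K1 * K ^ 3 * \<theta> s t ^ 3 + K1 * K\<^sup>2 * \<theta> s t ^ 3"
    proof (rule norm_triangle_mono)
      have est: "norm (d - v) \<le> K * (\<theta> s t)\<^sup>2" "norm d \<le> K * \<theta> s t" "norm v \<le> K * \<theta> s t"
        using inc(3) st unfolding d_def v_def V_def by auto
      have "norm (f (a s, a t) - d - (1 / 2) *\<^sub>R H d d) \<le> K1 * norm d ^ 3"
        using T1(3)[rule_format, OF ys(2) yt(2)] log_coord_diagonal[OF c log, of "a s"]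
          dird_log_coord_diagonal[OF c log as]
        by (simp add: f_def d_def H_def)
      also have "\<dots> \<le> K1 * (K * \<theta> s t) ^ 3"
        using T1(2) est(2) by (intro mult_left_mono power_mono) auto
      finally show "norm (f (a s, a t) - d - (1 / 2) *\<^sub>R H d d) \<le> K1 * K ^ 3 * \<theta> s t ^ 3"
        by (simp add: power_mult_distrib mult.assoc)
      have Hb: "norm (H u w) \<le> K1 * (norm u * norm w)" for u w
        using T1(4)[rule_format, OF ys(2), of w u] by (simp add: H_def mult.commute)
      have "norm (H (d - v) d) \<le> K1 * ((K * (\<theta> s t)\<^sup>2) * (K * \<theta> s t))"
        using est T1(2) inc(2) \<theta>_nonneg[of s t]
        by (intro order_trans[OF Hb] mult_left_mono mult_mono) auto
      moreover have "norm (H v (d - v)) \<le> K1 * ((K * \<theta> s t) * (K * (\<theta> s t)\<^sup>2))"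
        using est T1(2) inc(2) \<theta>_nonneg[of s t]
        by (intro order_trans[OF Hb] mult_left_mono mult_mono) auto
      ultimately have "norm (H (d - v) d + H v (d - v)) \<le> 2 * (K1 * K\<^sup>2 * \<theta> s t ^ 3)"
        by (intro norm_triangle_le) (simp add: power2_eq_square power3_eq_cube mult_ac)
      then show "norm ((1 / 2) *\<^sub>R (H (d - v) d + H v (d - v))) \<le> K1 * K\<^sup>2 * \<theta> s t ^ 3" by simp
    qed
    finally have "norm (\<tau> (\<psi> (y s) (y t) + bilin_tens (gauge_compat A \<psi> U (y s)) (blinfun_apply (y' s)) (X s t))
        - (d - bilin_tens \<Gamma> V (X s t))) \<le> K1 * (K ^ 3 + K\<^sup>2) * \<theta> s t ^ 3"
      by (simp add: algebra_simps)
    moreover have "(y s, y t) \<in> D"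
      using T1(3)[rule_format, OF ys(2) yt(2)] coord_domain_cmap[OF c ys(1) yt(1)] by (simp add: a_def)
    ultimately show ?thesis by (simp add: \<tau>_def d_def V_def \<Gamma>_def[abs_def])
  qed
  show thesis
    using main \<epsilon>2(1) inc(1) by (intro that[of "min \<epsilon>2 \<epsilon>3"]) (auto simp: a_def)
qed

text \<open>Transporting from a fixed later time \<open>t1\<close> back to \<open>s\<close> avoids inverting the parallelism.\<close>

lemma integrand_locally_bounded:
  fixes \<alpha> :: "real \<Rightarrow> 'e \<Rightarrow>\<^sub>L 'v::real_normed_vector"
  assumes c: "c \<in> A" and t0: "t0 \<in> {0..T}" "y t0 \<in> cdom c"
    and U: "parallelism A D U" and \<alpha>: "(\<alpha>, \<alpha>') \<in> CRP_form D U g p T \<omega> x y"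
  obtains \<epsilon> K where "\<epsilon> > 0" "K \<ge> 0"
    "\<forall>s. s \<in> {0..T} \<and> \<bar>s - t0\<bar> < \<epsilon> \<longrightarrow>
      (\<forall>v. norm (blinfun_apply (\<alpha> s) v) \<le> K * norm (blinfun_apply (to_coord A c (y s)) v))"
proof -
  obtain C1 \<delta>1 where \<delta>1: "\<delta>1 > 0" and C1: "\<And>s t. 0 \<le> s \<Longrightarrow> s \<le> t \<Longrightarrow> t \<le> T \<Longrightarrow> t - s \<le> \<delta>1 \<Longrightarrow>
      (y t, y s) \<in> D \<and> op_norm (tnorm g (y s)) norm
        (\<lambda>v. blinfun_apply (\<alpha> t) (blinfun_apply (U (y t) (y s)) v) - blinfun_apply (\<alpha> s) v
              - blinfun_apply (\<alpha>' s) (tens (x t - x s) v)) \<le> C1 * (\<theta> s t)\<^sup>2"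
    using \<alpha> unfolding CRP_form_def approx_def \<theta>_powers by (auto simp: fun_diff_def)
  obtain C2 \<delta>2 where \<delta>2: "\<delta>2 > 0" and C2: "\<forall>s t. 0 \<le> s \<and> s \<le> t \<and> t \<le> T \<and> t - s \<le> \<delta>2 \<longrightarrow>
      (y t, y s) \<in> D \<and> op_norm (tens_norm g (y s)) norm
        (\<lambda>\<xi>. blinfun_apply (\<alpha>' t) (id_tens (blinfun_apply (U (y t) (y s))) \<xi>)
              - blinfun_apply (\<alpha>' s) \<xi>) \<le> C2 * \<theta> s t"
    using \<alpha> unfolding CRP_form_def approx_def \<theta>_powers by (auto simp: fun_diff_def)
  define \<delta> where "\<delta> = min \<delta>1 \<delta>2"
  \<comment> \<open>One time that serves all s in \<open>{0..T}\<close> close to \<open>t0\<close>: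
    each such s is at most \<open>t1\<close> and within \<delta> of it. The minimum with
    \<open>T\<close> handles \<open>t0\<close> near the right end.\<close>
  define t1 where "t1 = min T (t0 + \<delta> / 2)"
  have "\<delta> > 0" using \<delta>1 \<delta>2 by (simp add: \<delta>_def)
  then have t1: "t0 \<le> t1" "t1 \<le> T" "0 \<le> t1" using t0 by (auto simp: t1_def)
  have before_t1: "s \<le> t1 \<and> t1 - s \<le> \<delta>" if "s \<in> {0..T}" "\<bar>s - t0\<bar> < \<delta> / 2" for s
    using that unfolding t1_def atLeastAtMost_iff by linarith
  obtain \<epsilon>1 \<Lambda> where \<Lambda>: "\<epsilon>1 > 0" "\<Lambda> > 0"
    "\<forall>m\<in>cdom c. dist (cmap c m) (cmap c (y t0)) < \<epsilon>1 \<longrightarrow>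
       (\<forall>v. tnorm g m v \<le> \<Lambda> * norm (blinfun_apply (to_coord A c m) v))"
    using tnorm_locally_equivalent[OF c t0(2)] by metis
  obtain \<epsilon>2 where \<epsilon>2: "\<epsilon>2 > 0" "\<And>s. s \<in> {0..T} \<Longrightarrow> dist s t0 < \<epsilon>2 \<Longrightarrow>
      y s \<in> cdom c \<and> dist (cmap c (y s)) (cmap c (y t0)) < \<epsilon>1"
    using path_near[OF c t0 \<Lambda>(1)] by blast
  \<comment> \<open>In the distinguished chart at \<open>y t1\<close> the change of coordinates is
    the identity, so \<open>Us s\<close> yields the transported vector itself.\<close>
  define c1 where "c1 = chart_at A (y t1)"
  have c1: "c1 \<in> A" "y t1 \<in> cdom c1" by (simp_all add: c1_def chart_at)
  define S where "S = {s \<in> {0..T}. \<bar>s - t0\<bar> < \<delta> / 2 \<and> y s \<in> cdom c}"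
  define Us where "Us s = par_coord c1 c U (cmap c1 (y t1), cmap c (y s))" for s
  have "t0 \<in> S" using t0 \<open>\<delta> > 0\<close> by (simp add: S_def)
  have "continuous_on S Us"
  proof -
    have "Ck_on 0 {(a, b). a \<in> crange c1 \<and> b \<in> crange c \<and> (cinv c1 a, cinv c b) \<in> D} (par_coord c1 c U)"
      using U c c1(1) unfolding parallelism_def smooth_on_def par_coord_def by blast
    then have "continuous_on {(a, b). a \<in> crange c1 \<and> b \<in> crange c \<and> (cinv c1 a, cinv c b) \<in> D} (par_coord c1 c U)"
      by simp
    moreover have "continuous_on S (\<lambda>s. (cmap c1 (y t1), cmap c (y s)))"
      by (intro continuous_on_Pair continuous_on_const continuous_on_subset[OF continuous_on_y_chart[OF c]])
        (auto simp: S_def)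
    moreover have "(\<lambda>s. (cmap c1 (y t1), cmap c (y s))) ` S
        \<subseteq> {(a, b). a \<in> crange c1 \<and> b \<in> crange c \<and> (cinv c1 a, cinv c b) \<in> D}"
    proof clarify
      fix s assume s: "s \<in> S"
      then have "(y t1, y s) \<in> D"
        using C1[of s t1] before_t1[of s] t1 by (auto simp: S_def \<delta>_def)
      with s c1(2) show "cmap c1 (y t1) \<in> crange c1 \<and> cmap c (y s) \<in> crange c \<and>
          (cinv c1 (cmap c1 (y t1)), cinv c (cmap c (y s))) \<in> D"
        by (simp add: S_def cinv_cmap[OF c1] cinv_cmap[OF c])
    qed
    ultimately show ?thesis unfolding Us_def[abs_def] by (rule continuous_on_compose2)
  qed
  then obtain \<epsilon>3 where \<epsilon>3: "\<epsilon>3 > 0" "\<And>s. s \<in> S \<Longrightarrow> dist s t0 < \<epsilon>3 \<Longrightarrow> norm (Us s) \<le> norm (Us t0) + 1"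
    using continuous_on_imp_locally_bounded \<open>t0 \<in> S\<close> by blast
  define u where "u = norm (Us t0) + 1"
  define \<Theta> where "\<Theta> = \<theta> 0 T"
  \<comment> \<open>One summand for each term of \<open>split\<close> below: \<alpha> at
    \<open>t1\<close>, \<alpha>' at \<open>t1\<close>, the defect of \<alpha>' and the defect of
    \<alpha>. Every power of \<theta> s t1 and every increment of x is bounded through
    \<Theta>.\<close>
  define K where "K = norm (\<alpha> t1) * u + (norm (\<alpha>' t1) * (\<Theta> * u) + \<bar>C2\<bar> * \<Theta> * (\<Theta> * \<Lambda>)) + \<bar>C1\<bar> * \<Theta>\<^sup>2 * \<Lambda>"
  have nonneg: "u \<ge> 0" "\<Theta> \<ge> 0" by (simp_all add: u_def \<Theta>_def \<theta>_nonneg)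
  have "K \<ge> 0" using nonneg \<Lambda>(2) unfolding K_def by (intro add_nonneg_nonneg mult_nonneg_nonneg) auto
  have main: "norm (blinfun_apply (\<alpha> s) v) \<le> K * norm (blinfun_apply (to_coord A c (y s)) v)"
    if s: "s \<in> {0..T}" "\<bar>s - t0\<bar> < min (\<delta> / 2) (min \<epsilon>2 \<epsilon>3)" for s v
  proof -
    have ys: "y s \<in> cdom c" "dist (cmap c (y s)) (cmap c (y t0)) < \<epsilon>1"
      using \<epsilon>2(2)[of s] s by (auto simp: dist_real_def)
    have st: "0 \<le> s" "s \<le> t1" "t1 - s \<le> \<delta>1" "t1 - s \<le> \<delta>2"
      using before_t1[of s] s by (auto simp: \<delta>_def)
    define n where "n = norm (blinfun_apply (to_coord A c (y s)) v)"
    define \<xi> where "\<xi> = x t1 - x s"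
    define Uv where "Uv = blinfun_apply (U (y t1) (y s)) v"
    have "n \<ge> 0" by (simp add: n_def)
    have \<xi>: "norm \<xi> \<le> \<Theta>" unfolding \<xi>_def \<Theta>_def by (rule path_bounds(2)[OF st(1,2) t1(2)])
    have \<theta>: "0 \<le> \<theta> s t1" "\<theta> s t1 \<le> \<Theta>" unfolding \<Theta>_def by (rule \<theta>_nonneg \<theta>_le[OF st(1,2) t1(2)])+
    have "Uv = blinfun_apply (Us s) (blinfun_apply (to_coord A c (y s)) v)"
      by (simp add: Uv_def Us_def par_coord_def cinv_cmap[OF c1] cinv_cmap[OF c ys(1)]
          from_to_coord[OF c ys(1)] coord_change_self[OF c1] flip: c1_def)
    also have "norm \<dots> \<le> u * n"
      using \<epsilon>3(2)[of s] s ys(1) unfolding n_def u_def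
      by (intro order_trans[OF norm_blinfun] mult_right_mono) (auto simp: S_def dist_real_def)
    finally have Uv: "norm Uv \<le> u * n" .
    have tn: "tnorm g (y s) v \<le> \<Lambda> * n" using \<Lambda>(3) ys by (simp add: n_def)
    obtain l where l: "l > 0" "\<forall>v. l * norm v \<le> tnorm g (y s) v"
        "\<forall>\<xi> :: 'e^'k. l * norm \<xi> \<le> tens_norm g (y s) \<xi>"
      by (rule tnorm_lower_bound[where m = "y s"])
    let ?F = "\<lambda>v. blinfun_apply (\<alpha> t1) (blinfun_apply (U (y t1) (y s)) v) - blinfun_apply (\<alpha> s) v
              - blinfun_apply (\<alpha>' s) (tens (x t1 - x s) v)"
    let ?F' = "\<lambda>\<zeta>. blinfun_apply (\<alpha>' t1) (id_tens (blinfun_apply (U (y t1) (y s))) \<zeta>) - blinfun_apply (\<alpha>' s) \<zeta>"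
    have "bounded_linear ?F"
      by (intro bounded_linear_sub blinfun.bounded_linear_right
          bounded_linear_compose[OF blinfun.bounded_linear_right blinfun.bounded_linear_right]
          bounded_linear_compose[OF blinfun.bounded_linear_right bounded_linear_tens])
    then have "norm (?F v) \<le> op_norm (tnorm g (y s)) norm ?F * tnorm g (y s) v"
      by (rule norm_le_op_norm[OF _ tnorm_scaleR l(1) l(2)[rule_format]])
    also have "\<dots> \<le> (\<bar>C1\<bar> * \<Theta>\<^sup>2) * (\<Lambda> * n)"
    proof (rule mult_mono[OF _ tn])
      have "op_norm (tnorm g (y s)) norm ?F \<le> C1 * (\<theta> s t1)\<^sup>2" using C1 st t1(2) by blast
      also have "\<dots> \<le> \<bar>C1\<bar> * \<Theta>\<^sup>2" using \<theta> by (intro mult_mono power_mono) auto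
      finally show "op_norm (tnorm g (y s)) norm ?F \<le> \<bar>C1\<bar> * \<Theta>\<^sup>2" .
    qed (simp_all add: tnorm_nonneg)
    finally have F: "norm (?F v) \<le> (\<bar>C1\<bar> * \<Theta>\<^sup>2) * (\<Lambda> * n)" .
    have "bounded_linear ?F'"
      by (intro bounded_linear_sub blinfun.bounded_linear_right
          bounded_linear_compose[OF blinfun.bounded_linear_right bounded_linear_id_tens])
    then have "norm (?F' (tens \<xi> v)) \<le> op_norm (tens_norm g (y s)) norm ?F' * tens_norm g (y s) (tens \<xi> v)"
      by (rule norm_le_op_norm[OF _ tens_norm_scaleR l(1) l(3)[rule_format]])
    also have "\<dots> \<le> (\<bar>C2\<bar> * \<Theta>) * (\<Theta> * (\<Lambda> * n))"
    proof (rule mult_mono)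
      have "op_norm (tens_norm g (y s)) norm ?F' \<le> C2 * \<theta> s t1" using C2 st t1(2) by blast
      also have "\<dots> \<le> \<bar>C2\<bar> * \<Theta>" using \<theta> by (intro mult_mono) auto
      finally show "op_norm (tens_norm g (y s)) norm ?F' \<le> \<bar>C2\<bar> * \<Theta>" .
      show "tens_norm g (y s) (tens \<xi> v) \<le> \<Theta> * (\<Lambda> * n)"
        unfolding tens_norm_tens[OF bilinear_metric metric_nonneg]
        by (intro mult_mono \<xi> tn nonneg tnorm_nonneg)
      show "0 \<le> tens_norm g (y s) (tens \<xi> v)"
        by (simp add: tens_norm_tens[OF bilinear_metric metric_nonneg] tnorm_nonneg)
    qed (simp add: nonneg)
    finally have F': "norm (?F' (tens \<xi> v)) \<le> (\<bar>C2\<bar> * \<Theta>) * (\<Theta> * (\<Lambda> * n))" .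
    \<comment> \<open>Solving the first controlled estimate for \<alpha> s leaves a term with
      \<alpha>' s, which has no a priori bound either. The second estimate, evaluated at
      \<open>tens \<xi> v\<close>, transports this term to \<open>t1\<close> as well.\<close>
    have "id_tens (blinfun_apply (U (y t1) (y s))) (tens \<xi> v) = tens \<xi> Uv"
      unfolding Uv_def by (intro id_tens_tens bounded_linear.linear blinfun.bounded_linear_right)
    then have split: "blinfun_apply (\<alpha> s) v = blinfun_apply (\<alpha> t1) Uv
        - (blinfun_apply (\<alpha>' t1) (tens \<xi> Uv) - ?F' (tens \<xi> v)) - ?F v"
      by (simp add: \<xi>_def Uv_def)
    have "norm (blinfun_apply (\<alpha> t1) Uv) \<le> norm (\<alpha> t1) * (u * n)"
      using Uv by (intro order_trans[OF norm_blinfun] mult_left_mono) auto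
    moreover have "norm (blinfun_apply (\<alpha>' t1) (tens \<xi> Uv)) \<le> norm (\<alpha>' t1) * (\<Theta> * (u * n))"
      using Uv \<xi> nonneg
      by (intro order_trans[OF norm_blinfun] mult_left_mono) (auto simp: norm_tens intro!: mult_mono)
    ultimately have "norm (blinfun_apply (\<alpha> s) v) \<le> norm (\<alpha> t1) * (u * n)
        + (norm (\<alpha>' t1) * (\<Theta> * (u * n)) + (\<bar>C2\<bar> * \<Theta>) * (\<Theta> * (\<Lambda> * n))) + (\<bar>C1\<bar> * \<Theta>\<^sup>2) * (\<Lambda> * n)"
      by (subst split, intro norm_triangle_le_diff add_mono F F')
    also have "\<dots> = K * n" by (simp add: K_def algebra_simps)
    finally show ?thesis by (simp add: n_def)
  qed
  show thesis
    using main \<open>\<delta> > 0\<close> \<epsilon>2(1) \<epsilon>3(1) \<open>K \<ge> 0\<close>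
    by (intro that[of "min (\<delta> / 2) (min \<epsilon>2 \<epsilon>3)" K]) auto
qed

text \<open>Only the estimate of order 3 mentions the logarithm. Changing \<psi> changes its
  right-hand side by \<alpha> applied to the difference of two expressions that both agree with the
  same quantity \<open>Z\<close> up to \<theta>^3. Definedness for the new domain \<open>D'\<close>
  comes along from \<open>log_expansion\<close>.\<close>

lemma is_rough_integral_change_logarithm:
  fixes \<alpha> :: "real \<Rightarrow> 'e \<Rightarrow>\<^sub>L 'v::real_normed_vector"
  assumes U: "parallelism A D0 U" and \<alpha>: "(\<alpha>, \<alpha>') \<in> CRP_form D0 U g p T \<omega> x y"
    and G: "gauge_on A D \<psi> U" and G': "gauge_on A D' \<psi>' U"
    and int: "is_rough_integral A D \<psi> U p T \<omega> x X (y, y') (\<alpha>, \<alpha>') zz"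
  shows "is_rough_integral A D' \<psi>' U p T \<omega> x X (y, y') (\<alpha>, \<alpha>') zz"
proof -
  obtain z z' where zz: "zz = (z, z')" by (cases zz)
  define I where "I \<psi> s t = blinfun_apply (\<alpha> s)
                    (\<psi> (y s) (y t)
                     + bilin_tens (gauge_compat A \<psi> U (y s)) (blinfun_apply (y' s)) (X s t))
                  + blinfun_apply (\<alpha>' s) (id_tens (blinfun_apply (y' s)) (X s t))" for \<psi> s t
  obtain C \<delta> where \<delta>: "\<delta> > 0" and C: "\<forall>s t. 0 \<le> s \<and> s \<le> t \<and> t \<le> T \<and> t - s \<le> \<delta> \<longrightarrow>
      (y s, y t) \<in> D \<and> norm (z t - z s - I \<psi> s t) \<le> C * \<theta> s t ^ 3"
    using int unfolding zz is_rough_integral_def approx_def \<theta>_powers I_def by auto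
  have "\<exists>C. \<exists>\<delta>>0. \<forall>s t. 0 \<le> s \<and> s \<le> t \<and> t \<le> T \<and> t - s \<le> \<delta> \<longrightarrow>
      (y s, y t) \<in> D' \<and> norm (z t - z s - I \<psi>' s t) \<le> C * \<theta> s t ^ 3"
  proof (rule uniform_of_local_estimate, rule ballI)
    fix t0 assume t0: "t0 \<in> {0..T}"
    define c where "c = chart_at A (y t0)"
    have c: "c \<in> A" "y t0 \<in> cdom c" by (simp_all add: c_def chart_at)
    \<comment> \<open>Common to both gauges because they share the parallelism.\<close>
    define Z where "Z s t = cmap c (y t) - cmap c (y s) - bilin_tens
            (\<lambda>v w. blinfun_apply (dird (par_coord c c U) (v, 0) (cmap c (y s), cmap c (y s))) w)
            (blinfun_apply (velocity c s)) (X s t)" for s t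
    define E where "E \<psi> s t = \<psi> (y s) (y t)
        + bilin_tens (gauge_compat A \<psi> U (y s)) (blinfun_apply (y' s)) (X s t)" for \<psi> s t
    obtain \<epsilon>1 K1 where E1: "\<epsilon>1 > 0"
      "\<forall>s t. 0 \<le> s \<and> s \<le> t \<and> t \<le> T \<and> \<bar>s - t0\<bar> < \<epsilon>1 \<and> \<bar>t - t0\<bar> < \<epsilon>1 \<longrightarrow> (y s, y t) \<in> D \<and>
        norm (blinfun_apply (to_coord A c (y s)) (E \<psi> s t) - Z s t) \<le> K1 * \<theta> s t ^ 3"
      using log_expansion[OF c(1) t0 c(2) G] unfolding E_def Z_def .
    obtain \<epsilon>2 K2 where E2: "\<epsilon>2 > 0"
      "\<forall>s t. 0 \<le> s \<and> s \<le> t \<and> t \<le> T \<and> \<bar>s - t0\<bar> < \<epsilon>2 \<and> \<bar>t - t0\<bar> < \<epsilon>2 \<longrightarrow> (y s, y t) \<in> D' \<and>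
        norm (blinfun_apply (to_coord A c (y s)) (E \<psi>' s t) - Z s t) \<le> K2 * \<theta> s t ^ 3"
      using log_expansion[OF c(1) t0 c(2) G'] unfolding E_def Z_def .
    obtain \<epsilon>3 K3 where E3: "\<epsilon>3 > 0" "K3 \<ge> 0"
      "\<forall>s. s \<in> {0..T} \<and> \<bar>s - t0\<bar> < \<epsilon>3 \<longrightarrow>
        (\<forall>v. norm (blinfun_apply (\<alpha> s) v) \<le> K3 * norm (blinfun_apply (to_coord A c (y s)) v))"
      using integrand_locally_bounded[OF c(1) t0 c(2) U \<alpha>] .
    \<comment> \<open>The entry \<delta> / 2 puts s and t within \<delta> of each other, where the
      given estimate for \<psi> applies.\<close>
    define \<epsilon> where "\<epsilon> = min (min \<epsilon>1 \<epsilon>2) (min \<epsilon>3 (\<delta> / 2))"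
    have "(y s, y t) \<in> D' \<and> norm (z t - z s - I \<psi>' s t) \<le> (C + K3 * (K1 + K2)) * \<theta> s t ^ 3"
      if st: "0 \<le> s \<and> s \<le> t \<and> t \<le> T \<and> \<bar>s - t0\<bar> < \<epsilon> \<and> \<bar>t - t0\<bar> < \<epsilon>" for s t
    proof -
      let ?\<tau> = "blinfun_apply (to_coord A c (y s))"
      have near: "0 \<le> s" "s \<le> t" "t \<le> T" "\<bar>s - t0\<bar> < \<epsilon>1" "\<bar>t - t0\<bar> < \<epsilon>1" "\<bar>s - t0\<bar> < \<epsilon>2" "\<bar>t - t0\<bar> < \<epsilon>2"
          "\<bar>s - t0\<bar> < \<epsilon>3" "s \<in> {0..T}" "t - s \<le> \<delta>"
      proof -
        show "t - s \<le> \<delta>" using st unfolding \<epsilon>_def by linarith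
      qed (use st in \<open>simp_all add: \<epsilon>_def\<close>)
      have e1: "norm (?\<tau> (E \<psi> s t) - Z s t) \<le> K1 * \<theta> s t ^ 3" using E1(2) near by blast
      have e2: "norm (?\<tau> (E \<psi>' s t) - Z s t) \<le> K2 * \<theta> s t ^ 3" "(y s, y t) \<in> D'" using E2(2) near by blast+
      have "norm (?\<tau> (E \<psi> s t - E \<psi>' s t)) \<le> K1 * \<theta> s t ^ 3 + K2 * \<theta> s t ^ 3"
        using norm_triangle_le_diff[OF add_mono[OF e1 e2(1)]] by (simp add: blinfun.diff_right)
      then have "norm (blinfun_apply (\<alpha> s) (E \<psi> s t - E \<psi>' s t)) \<le> K3 * (K1 * \<theta> s t ^ 3 + K2 * \<theta> s t ^ 3)"
        using E3(2,3) near by (meson mult_left_mono order_trans)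
      moreover have "z t - z s - I \<psi>' s t = (z t - z s - I \<psi> s t) + blinfun_apply (\<alpha> s) (E \<psi> s t - E \<psi>' s t)"
        by (simp add: I_def E_def blinfun.diff_right)
      ultimately have "norm (z t - z s - I \<psi>' s t) \<le> C * \<theta> s t ^ 3 + K3 * (K1 * \<theta> s t ^ 3 + K2 * \<theta> s t ^ 3)"
        using C near(1-3,10) by (metis (no_types, lifting) add_mono norm_triangle_le)
      with e2(2) show ?thesis by (simp add: algebra_simps)
    qed
    moreover have "\<epsilon> > 0" using E1(1) E2(1) E3(1) \<delta> by (simp add: \<epsilon>_def)
    ultimately show "\<exists>\<epsilon>>0. \<exists>C. \<forall>s t. 0 \<le> s \<and> s \<le> t \<and> t \<le> T \<and> \<bar>s - t0\<bar> < \<epsilon> \<and> \<bar>t - t0\<bar> < \<epsilon> \<longrightarrow>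
      (y s, y t) \<in> D' \<and> norm (z t - z s - I \<psi>' s t) \<le> C * \<theta> s t ^ 3" by blast
  qed (simp add: \<theta>_nonneg)
  then have "approx p T \<omega> 3 (\<lambda>s t. (y s, y t) \<in> D') (\<lambda>s. norm) (\<lambda>s t. z t - z s) (I \<psi>')"
    unfolding approx_def \<theta>_powers .
  with int show ?thesis
    unfolding zz is_rough_integral_def I_def[abs_def] by simp
qed

end

theorem corollary3p31:
  fixes A :: "('m::{t2_space, second_countable_topology}, 'e::real_normed_vector) chart set"
    and g :: "'m \<Rightarrow> 'e \<Rightarrow> 'e \<Rightarrow> real"
    and p T :: real
    and \<omega> :: "real \<Rightarrow> real \<Rightarrow> real"
    and x :: "real \<Rightarrow> real^'k"
    and X :: "real \<Rightarrow> real \<Rightarrow> real^'k^'k"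
    and y :: "real \<Rightarrow> 'm"
    and y' :: "real \<Rightarrow> (real^'k) \<Rightarrow>\<^sub>L 'e"
    and D\<^sub>U D D' :: "('m \<times> 'm) set"
    and U :: "'m \<Rightarrow> 'm \<Rightarrow> 'e \<Rightarrow>\<^sub>L 'e"
    and \<psi> \<psi>' :: "'m \<Rightarrow> 'm \<Rightarrow> 'e"
    and \<alpha> :: "real \<Rightarrow> 'e \<Rightarrow>\<^sub>L 'v::banach"
    and \<alpha>' :: "real \<Rightarrow> ('e^'k) \<Rightarrow>\<^sub>L 'v"
  assumes "smooth_manifold A"
    and "riemannian_metric A g"
    and "0 < T" and "1 \<le> p" and "p < 3"
    and "weak_geometric_rough_path p T \<omega> x X"
    and "(y, y') \<in> CRP_M A g p T \<omega> x"
    and "parallelism A D\<^sub>U U"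
    and "(\<alpha>, \<alpha>') \<in> CRP_form D\<^sub>U U g p T \<omega> x y"
    and "gauge_on A D \<psi> U"
    and "gauge_on A D' \<psi>' U"
  shows "rough_integral A D \<psi> U p T \<omega> x X (y, y') (\<alpha>, \<alpha>') =
         rough_integral A D' \<psi>' U p T \<omega> x X (y, y') (\<alpha>, \<alpha>')"
proof -
  interpret rough_manifold A g p T \<omega> x X y y'
    using assms(1,2,4,6,7) by unfold_locales
  note change = is_rough_integral_change_logarithm[OF assms(8,9)]
  \<comment> \<open>The last argument is omitted: this is an equality of predicates, which can be
    rewritten under the definite description defining \<open>rough_integral\<close>.\<close>
  have "is_rough_integral A D \<psi> U p T \<omega> x X (y, y') (\<alpha>, \<alpha>') =
      is_rough_integral A D' \<psi>' U p T \<omega> x X (y, y') (\<alpha>, \<alpha>')"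
    using change[OF assms(10,11)] change[OF assms(11,10)] by blast
  then show ?thesis unfolding rough_integral_def by simp
qed

end
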